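(* Let $n\ge1$ and let $h(z,\xi)$ be an irreducible polynomial on $\mathbb{C}^n\times\mathbb{C}^n$ with $h(z,\bar z)>0$ for all $z\in\mathbb{C}^n$. Let $B$ be a small ball centered at $0\in\mathbb{C}^n$ and let $F_l:B\to\mathbb{C}^{N_l}$ ($1\le l\le m$) and $G_j:B\to\mathbb{C}^{N'_j}$ ($1\le j\le v$) be non-constant holomorphic algebraic maps satisfying $$h(z,\bar z)^r=\prod_{l=1}^m\big(1+|F_l(z)|^2\big)^{\mu_l}\prod_{j=1}^v\big(1+|G_j(z)|^2\big)^{-\lambda_j}\quad\text{on }B$$ (equivalently, $h(z,\xi)^r=\prod_l(1+F_l(z)\cdot\bar F_l(\xi))^{\mu_l}\prod_j(1+G_j(z)\cdot\bar G_j(\xi))^{-\lambda_j}$ on $B\times B$), where $r\in\mathbb{R}\setminus\{0\}$ and $\mu_l,\lambda_j>0$ satisfy $$\mathrm{span}_{\mathbb{Q}_0^+}\{\lambda_j\}_{j=1}^v\cap\mathrm{span}_{\mathbb{Q}_0^+}\{\mu_l\}_{l=1}^m=\{0\}.$$ Then all $F_l$ and $G_j$ are holomorphic polynomial maps. More precisely, there exist $m_l,n_j\in\mathbb{N}$ and $A_l,B_j>0$ with $$1+F_l(z)\cdot\bar F_l(\xi)=A_lh(z,\xi)^{m_l},\qquad 1+G_j(z)\cdot\bar G_j(\xi)=B_jh(z,\xi)^{n_j},$$ and $r=\sum_{l=1}^m m_l\mu_l-\sum_{j=1}^v\lambda_jn_j$.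
   Context: $\bar F(\xi):=\overline{F(\bar\xi)}$ and $a\cdot b=\sum_ia_ib_i$, so $F(z)\cdot\bar F(\bar z)=|F(z)|^2$. $\mathbb{Q}_0^+$ is the set of nonnegative rationals and $\mathrm{span}_{\mathbb{Q}_0^+}S$ the set of finite nonnegative rational linear combinations of elements of $S$ (the span of the empty set is $\{0\}$). A holomorphic map is algebraic if each component satisfies a nontrivial polynomial equation with polynomial coefficients in $z$. $\mathbb{N}$ denotes the positive integers. *)

theory Defs
  imports "HOL-Analysis.Analysis" "HOL-Library.Poly_Mapping" "HOL-Computational_Algebra.Factorial_Ring"
begin

text \<open>Multivariate complex polynomials in variables X_0, X_1, ...: a monomial is a
finitely supported exponent vector, a polynomial a finitely supported coefficient map.\<close>
type_synonym mpoly = "(nat \<Rightarrow>\<^sub>0 nat) \<Rightarrow>\<^sub>0 complex"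

definition peval :: "mpoly \<Rightarrow> (nat \<Rightarrow> complex) \<Rightarrow> complex" where
  "peval p x = (\<Sum>a\<in>Poly_Mapping.keys p. Poly_Mapping.lookup p a * (\<Prod>i\<in>Poly_Mapping.keys a. x i ^ Poly_Mapping.lookup (a::nat \<Rightarrow>\<^sub>0 nat) i))"

definition pvars :: "mpoly \<Rightarrow> nat set" where
  "pvars p = \<Union>(Poly_Mapping.keys ` Poly_Mapping.keys p)"

definition cvec :: "nat \<Rightarrow> (nat \<Rightarrow> complex) set" where
  "cvec n = {z. \<forall>i\<ge>n. z i = 0}"

definition cnorm :: "nat \<Rightarrow> (nat \<Rightarrow> complex) \<Rightarrow> real" where
  "cnorm n z = sqrt (\<Sum>i<n. (cmod (z i))\<^sup>2)"

definition cball0 :: "nat \<Rightarrow> real \<Rightarrow> (nat \<Rightarrow> complex) set" where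
  "cball0 n \<rho> = {z \<in> cvec n. cnorm n z < \<rho>}"

definition cconj :: "(nat \<Rightarrow> complex) \<Rightarrow> (nat \<Rightarrow> complex)" where
  "cconj z = (\<lambda>i. cnj (z i))"

definition peval2 :: "nat \<Rightarrow> mpoly \<Rightarrow> (nat \<Rightarrow> complex) \<Rightarrow> (nat \<Rightarrow> complex) \<Rightarrow> complex" where
  "peval2 n h z \<xi> = peval h (\<lambda>i. if i < n then z i else \<xi> (i - n))"

definition holo_on :: "nat \<Rightarrow> (nat \<Rightarrow> complex) set \<Rightarrow> ((nat \<Rightarrow> complex) \<Rightarrow> complex) \<Rightarrow> bool" where
  "holo_on n U f \<longleftrightarrow> (\<forall>z\<in>U. \<exists>c::nat \<Rightarrow> complex. \<forall>\<epsilon>>0. \<exists>\<delta>>0. \<forall>w\<in>cvec n.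
      cnorm n w < \<delta> \<longrightarrow> (\<lambda>i. z i + w i) \<in> U \<longrightarrow>
      cmod (f ((\<lambda>i. z i + w i)) - f z - (\<Sum>i<n. c i * w i)) \<le> \<epsilon> * cnorm n w)"

definition holo_map_on :: "nat \<Rightarrow> (nat \<Rightarrow> complex) set \<Rightarrow> nat \<Rightarrow> ((nat \<Rightarrow> complex) \<Rightarrow> nat \<Rightarrow> complex) \<Rightarrow> bool" where
  "holo_map_on n U N F \<longleftrightarrow> (\<forall>k<N. holo_on n U (\<lambda>z. F z k))"

definition algebraic_map_on :: "nat \<Rightarrow> (nat \<Rightarrow> complex) set \<Rightarrow> nat \<Rightarrow> ((nat \<Rightarrow> complex) \<Rightarrow> nat \<Rightarrow> complex) \<Rightarrow> bool" where
  "algebraic_map_on n U N F \<longleftrightarrow> (\<forall>k<N. \<exists>P::mpoly. P \<noteq> 0 \<and> pvars P \<subseteq> {0..n} \<and>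
      (\<forall>z\<in>U. peval P (z(n := F z k)) = 0))"

definition nonconst_map_on :: "(nat \<Rightarrow> complex) set \<Rightarrow> nat \<Rightarrow> ((nat \<Rightarrow> complex) \<Rightarrow> nat \<Rightarrow> complex) \<Rightarrow> bool" where
  "nonconst_map_on U N F \<longleftrightarrow> (\<exists>z1\<in>U. \<exists>z2\<in>U. \<exists>k<N. F z1 k \<noteq> F z2 k)"

definition polynomial_map_on :: "nat \<Rightarrow> (nat \<Rightarrow> complex) set \<Rightarrow> nat \<Rightarrow> ((nat \<Rightarrow> complex) \<Rightarrow> nat \<Rightarrow> complex) \<Rightarrow> bool" where
  "polynomial_map_on n U N F \<longleftrightarrow> (\<forall>k<N. \<exists>P::mpoly. pvars P \<subseteq> {..<n} \<and> (\<forall>z\<in>U. F z k = peval P z))"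

text \<open>F(z) . conj(F(conj xi)), i.e. F(z) . Fbar(xi).\<close>
definition hdot :: "nat \<Rightarrow> ((nat \<Rightarrow> complex) \<Rightarrow> nat \<Rightarrow> complex) \<Rightarrow> (nat \<Rightarrow> complex) \<Rightarrow> (nat \<Rightarrow> complex) \<Rightarrow> complex" where
  "hdot N F z \<xi> = (\<Sum>k<N. F z k * cnj (F (cconj \<xi>) k))"

definition sqnorm :: "nat \<Rightarrow> ((nat \<Rightarrow> complex) \<Rightarrow> nat \<Rightarrow> complex) \<Rightarrow> (nat \<Rightarrow> complex) \<Rightarrow> real" where
  "sqnorm N F z = (\<Sum>k<N. (cmod (F z k))\<^sup>2)"

definition qspan :: "nat \<Rightarrow> (nat \<Rightarrow> real) \<Rightarrow> real set" where
  "qspan k a = {(\<Sum>i<k. of_rat (q i) * a i) | q. \<forall>i<k. q i \<ge> 0}"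

end

(* Put the F_l and G_j into one family with signed exponents c_i and take logarithms:
   r log h = sum c_i log (1 + |F_i|^2).  The span condition says that no nontrivial nonnegative
   rational combination of the c_i vanishes, so some Q-linear phi : R -> Q is positive on all c_i
   (Gordan).  A real linear relation between logarithms of algebraic functions splits along the
   Q-structure of R, so phi may be applied to its coefficients, and up to a constant
   h^q = prod (1 + |F_i|^2)^{p_i} with positive integers p_i.  If q >= 0, the right-hand side is
   1 plus a sum of squares that contains the components of all F_i; a Gram argument then writes
   these as combinations of polynomials h(., w)^q.  If q < 0, the F_i are rational and h is bounded,
   hence constant, along real lines through 0.  Unique factorization finally gives
   1 + F_i . Fbar_i = A_i h^{m_i}.

   To see that the logarithmic relation splits, restrict it to a line and let u be the product of
   powers of algebraic functions that has to be constant.  If it is not, all the functions lie in a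
   finite extension of C(u), and the trace of df/f is the logarithmic derivative of the norm of f,
   whose residue at u = 0 is an integer; these integers satisfy the original relation, hence its
   image under phi, but for f = u the residue is positive. *)
theory Submission
  imports "Jordan_Normal_Form.Determinant" "HOL-Complex_Analysis.Complex_Analysis" Defs
begin

section \<open>Gordan's theorem over the rationals\<close>

text \<open>The functional phi is neither continuous nor C-linear, so it cannot act on an identity
  between functions. It acts on integer vectors only: if sum c_i k_i = 0, then sum phi(c_i) k_i = 0,
  and residues of logarithmic derivatives supply such k. Residues on the Riemann surface of the
  functions would call for places and ramification. The norm down to C(u) avoids them: it is a
  rational function, whose order at 0 is read off in Laurent series after X is written for u.
  Restriction to a line may turn the equation of an algebraic function into 0 = 0. Lines through 0
  are therefore used only when their endpoint avoids the zeros of finitely many leading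
  coefficients; continuation recovers the other points of the ball. Negative powers are kept out of
  all identities off the diagonal, because h(z,\<xi>) may vanish there. For q < 0 the relation
  between rational functions is extended along a whole line beyond the ball, and there the
  positivity of h on all of C^n is what gives the bound.\<close>

interpretation rat_real: vector_space "\<lambda>(q::rat) (x::real). of_rat q * x"
  by unfold_locales (auto simp: algebra_simps of_rat_add of_rat_mult)

interpretation rat_rat: vector_space "\<lambda>(q::rat) (x::rat). q * x"
  by unfold_locales (auto simp: algebra_simps)

interpretation rat_pair: vector_space_pair
  "\<lambda>(q::rat) (x::real). of_rat q * x" "\<lambda>(q::rat) (x::rat). q * x" ..

abbreviation rat_linear :: "(real \<Rightarrow> rat) \<Rightarrow> bool" where
  "rat_linear \<equiv> Vector_Spaces.linear (\<lambda>q x. of_rat q * x) (\<lambda>q x. q * x)"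

text \<open>A Q-basis of \<open>S\<close> stays independent after adding \<open>x\<close>, so the
  values 0 on it and 1 at \<open>x\<close> extend to a linear functional.\<close>

lemma rat_linear_separate:
  assumes S: "rat_real.subspace S" and x: "x \<notin> S"
  shows "\<exists>\<psi>. rat_linear \<psi> \<and> (\<forall>s\<in>S. \<psi> s = 0) \<and> \<psi> x = 1"
proof -
  obtain B where B: "B \<subseteq> S" "rat_real.independent B" "S \<subseteq> rat_real.span B"
    using rat_real.maximal_independent_subset[of S] by blast
  have span: "rat_real.span B = S"
    using B S rat_real.span_minimal by blast
  have "rat_real.independent (insert x B)"
    using B(2) x span by (simp add: rat_real.independent_insert)
  from rat_pair.linear_independent_extend[OF this, of "\<lambda>b. if b = x then 1 else 0"]
  obtain g where g: "rat_linear g" "\<forall>b\<in>insert x B. g b = (if b = x then 1 else 0)"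
    by blast
  have "g s = 0" if "s \<in> S" for s
    using rat_pair.linear_eq_0_on_span[OF g(1), of B s] g(2) that span B(1) x by fastforce
  then show ?thesis using g by auto
qed

text \<open>Either the hypothesis persists modulo the line through the last vector, and a functional for the
  others is corrected by a small multiple of one that is 1 on it; or the last vector is itself a
  nonnegative combination of the others.\<close>

lemma gordan_rat:
  fixes x :: "nat \<Rightarrow> real"
  assumes "rat_real.subspace S"
    and "\<And>q. \<forall>i<k. q i \<ge> 0 \<Longrightarrow> (\<Sum>i<k. of_rat (q i) * x i) \<in> S \<Longrightarrow> \<forall>i<k. q i = 0"
  shows "\<exists>\<phi>. rat_linear \<phi> \<and> (\<forall>s\<in>S. \<phi> s = 0) \<and> (\<forall>i<k. \<phi> (x i) > 0)"
  using assms
proof (induction k arbitrary: S)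
  case 0
  show ?case
    by (rule exI[of _ "\<lambda>_. 0"]) (auto intro: rat_pair.module_hom_zero simp: rat_pair.linear_0)
next
  case (Suc k)
  have notin: "x k \<notin> S"
  proof
    assume "x k \<in> S"
    moreover have "(\<Sum>i<Suc k. of_rat (if i = k then 1 else 0) * x i) = x k" by simp
    ultimately have "\<forall>i<Suc k. (if i = k then 1 else 0 :: rat) = 0"
      by (intro Suc.prems(2)) (simp_all del: sum.lessThan_Suc)
    then show False by auto
  qed
  \<comment> \<open>The quotient by the line through \<open>x k\<close> is formed by enlarging the
    subspace, which is why the induction runs over all \<open>S\<close>.\<close>
  define S' where "S' = {y. \<exists>c. y - of_rat c * x k \<in> S}"
  have S': "S' = rat_real.span (insert (x k) S)"
    unfolding S'_def rat_real.span_insert rat_real.span_eq_iff[THEN iffD2, OF Suc.prems(1)] ..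
  have sub': "rat_real.subspace S'" unfolding S' by simp
  show ?case
  proof (cases "\<forall>q. (\<forall>i<k. q i \<ge> 0) \<and> (\<Sum>i<k. of_rat (q i) * x i) \<in> S' \<longrightarrow> (\<forall>i<k. q i = 0)")
    case True
    then obtain \<phi> where \<phi>: "rat_linear \<phi>" "\<forall>s\<in>S'. \<phi> s = 0" "\<forall>i<k. \<phi> (x i) > 0"
      using Suc.IH[OF sub'] by blast
    obtain \<psi> where \<psi>: "rat_linear \<psi>" "\<forall>s\<in>S. \<psi> s = 0" "\<psi> (x k) = 1"
      using rat_linear_separate[OF Suc.prems(1) notin] by blast
    \<comment> \<open>Large enough for \<open>N * \<phi> (x i)\<close> to outweigh
      \<open>\<psi> (x i)\<close> for every \<open>i < k\<close>; at \<open>x k\<close> the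
      functional \<open>\<phi>\<close> vanishes and \<open>\<psi>\<close> is 1.\<close>
    define N where "N = 1 + (\<Sum>i<k. \<bar>\<psi> (x i)\<bar> / \<phi> (x i))"
    have lin: "rat_linear (\<lambda>y. \<psi> y + N * \<phi> y)"
      by (intro rat_pair.linear_compose_add rat_pair.linear_compose_scale_right \<phi> \<psi>)
    have "S \<subseteq> S'" unfolding S' using rat_real.span_superset by blast
    then have "\<forall>s\<in>S. \<psi> s + N * \<phi> s = 0" using \<phi>(2) \<psi>(2) by auto
    moreover have "\<psi> (x i) + N * \<phi> (x i) > 0" if "i < Suc k" for i
    proof (cases "i = k")
      case True
      have "x k \<in> S'" unfolding S' by (simp add: rat_real.span_base)
      then show ?thesis using True \<phi>(2) \<psi>(3) by simp
    next
      case False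
      then have i: "i < k" using that by simp
      have "\<bar>\<psi> (x i)\<bar> / \<phi> (x i) \<le> (\<Sum>i<k. \<bar>\<psi> (x i)\<bar> / \<phi> (x i))"
        using \<phi>(3) i by (intro member_le_sum) (auto intro!: divide_nonneg_pos)
      then have "\<bar>\<psi> (x i)\<bar> / \<phi> (x i) < N" unfolding N_def by simp
      then have "\<bar>\<psi> (x i)\<bar> < N * \<phi> (x i)" using \<phi>(3) i by (simp add: divide_less_eq)
      then show ?thesis by linarith
    qed
    ultimately show ?thesis using lin by blast
  next
    case False
    then obtain q c where q: "\<forall>i<k. q i \<ge> 0" "\<not> (\<forall>i<k. q i = 0)"
      and S_mem: "(\<Sum>i<k. of_rat (q i) * x i) - of_rat c * x k \<in> S"
      unfolding S'_def by blast
    define s where "s = (\<Sum>i<k. of_rat (q i) * x i) - of_rat c * x k"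
    have s: "s \<in> S" using S_mem s_def by simp
    have eq: "(\<Sum>i<k. of_rat (q i) * x i) = s + of_rat c * x k" by (simp add: s_def)
    \<comment> \<open>Otherwise \<open>- c\<close> is a nonnegative coefficient for
      \<open>x k\<close>, and the hypothesis makes all \<open>q i\<close> vanish.\<close>
    have c: "c > 0"
    proof (rule ccontr)
      assume "\<not> c > 0"
      then have nn: "\<forall>i<Suc k. (if i = k then - c else q i) \<ge> 0" using q(1) by auto
      have "(\<Sum>i<Suc k. of_rat (if i = k then - c else q i) * x i)
          = (\<Sum>i<k. of_rat (q i) * x i) - of_rat c * x k"
        by (simp add: of_rat_minus)
      also have "\<dots> = s" using eq by simp
      finally have "\<forall>i<Suc k. (if i = k then - c else q i) = 0"
        using s by (intro Suc.prems(2) nn) simp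
      then have "\<forall>i<k. q i = 0" by (metis less_Suc_eq less_irrefl)
      then show False using q(2) by blast
    qed
    have "\<forall>i<k. q' i = 0"
      if "\<forall>i<k. q' i \<ge> 0" "(\<Sum>i<k. of_rat (q' i) * x i) \<in> S" for q' :: "nat \<Rightarrow> rat"
    proof -
      have "(\<Sum>i<Suc k. of_rat (if i = k then 0 else q' i) * x i) = (\<Sum>i<k. of_rat (q' i) * x i)"
        by simp
      then have "\<forall>i<Suc k. (if i = k then 0 else q' i) = 0"
        using that by (intro Suc.prems(2)) (simp_all del: sum.lessThan_Suc)
      then show ?thesis by (metis less_Suc_eq less_irrefl)
    qed
    then obtain \<phi> where \<phi>: "rat_linear \<phi>" "\<forall>s\<in>S. \<phi> s = 0" "\<forall>i<k. \<phi> (x i) > 0"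
      using Suc.IH[OF Suc.prems(1)] by blast
    have scl: "\<phi> (of_rat a * y) = a * \<phi> y" for a y
      using rat_pair.linear_scale[OF \<phi>(1)] .
    have "(\<Sum>i<k. q i * \<phi> (x i)) = \<phi> (\<Sum>i<k. of_rat (q i) * x i)"
      by (simp add: rat_pair.linear_sum[OF \<phi>(1)] scl)
    also have "\<dots> = c * \<phi> (x k)"
      unfolding eq rat_pair.linear_add[OF \<phi>(1)] scl using \<phi>(2) s by simp
    finally have "c * \<phi> (x k) = (\<Sum>i<k. q i * \<phi> (x i))" by simp
    moreover have "\<dots> > 0"
    proof -
      obtain j where "j < k" "q j \<noteq> 0" using q(2) by blast
      then show ?thesis using q(1) \<phi>(3)
        by (intro sum_pos2[of _ j]) (auto intro!: mult_pos_pos simp: less_le)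
    qed
    ultimately have "\<phi> (x k) > 0" using c by (metis zero_less_mult_pos)
    then show ?thesis using \<phi> by (metis less_Suc_eq)
  qed
qed

section \<open>Finite-dimensional field extensions and traces\<close>

text \<open>The small field is a type of its own that acts through \<open>\<iota>\<close>: one type
  of rational functions is later embedded in Laurent series once for each choice of a series
  \<open>u\<close>.\<close>

locale field_extension =
  fixes \<iota> :: "'l::field \<Rightarrow> 'k::field_char_0"
  assumes emb_one: "\<iota> 1 = 1"
    and emb_add: "\<iota> (a + b) = \<iota> a + \<iota> b"
    and emb_mult: "\<iota> (a * b) = \<iota> a * \<iota> b"
begin

sublocale vs: vector_space "\<lambda>c x. \<iota> c * x"
  by unfold_locales (simp_all add: emb_one emb_add emb_mult algebra_simps)

lemma emb_zero: "\<iota> 0 = 0"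
  using emb_add[of 0 0] by simp

lemma emb_minus: "\<iota> (- a) = - \<iota> a"
  using emb_add[of a "- a"] by (simp add: emb_zero eq_neg_iff_add_eq_0 add.commute)

lemma emb_sum: "\<iota> (sum f A) = (\<Sum>i\<in>A. \<iota> (f i))"
  by (induction A rule: infinite_finite_induct) (auto simp: emb_zero emb_add)

lemma emb_of_nat: "\<iota> (of_nat n) = of_nat n"
  by (induction n) (auto simp: emb_zero emb_add emb_one)

lemma emb_eq_0_iff: "\<iota> a = 0 \<longleftrightarrow> a = 0"
proof
  assume "\<iota> a = 0"
  then show "a = 0" using emb_mult[of a "inverse a"] emb_one by (cases "a = 0") auto
qed (simp add: emb_zero)

lemma emb_inj: "\<iota> a = \<iota> b \<longleftrightarrow> a = b"
  using emb_eq_0_iff[of "a - b"] emb_add[of a "- b"] by (simp add: emb_minus)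

lemma emb_inverse: "\<iota> (inverse a) = inverse (\<iota> a)"
proof (cases "a = 0")
  case False
  then have "\<iota> a * \<iota> (inverse a) = 1" using emb_mult[of a "inverse a"] by (simp add: emb_one)
  then show ?thesis by (metis inverse_unique)
qed (simp add: emb_zero)

lemma emb_divide: "\<iota> (a / b) = \<iota> a / \<iota> b"
  by (simp add: divide_inverse emb_mult emb_inverse)

text \<open>These are the finite subextensions: closure under inverses follows from finite dimension
  (\<open>fd_ring_inverse\<close>).\<close>

definition fd_ring :: "'k set \<Rightarrow> bool" where
  "fd_ring K \<longleftrightarrow> (\<exists>B. finite B \<and> K = vs.span B) \<and> 1 \<in> K \<and> (\<forall>x\<in>K. \<forall>y\<in>K. x * y \<in> K)"

lemma fd_ring_subspace: "fd_ring K \<Longrightarrow> vs.subspace K"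
  unfolding fd_ring_def by auto

lemma fd_ring_mult: "fd_ring K \<Longrightarrow> x \<in> K \<Longrightarrow> y \<in> K \<Longrightarrow> x * y \<in> K"
  unfolding fd_ring_def by auto

lemma fd_ring_one: "fd_ring K \<Longrightarrow> 1 \<in> K"
  unfolding fd_ring_def by auto

lemma fd_ring_emb: "fd_ring K \<Longrightarrow> \<iota> c \<in> K"
  using vs.subspace_scale[OF fd_ring_subspace fd_ring_one, of K c] by simp

lemma fd_ring_power: "fd_ring K \<Longrightarrow> x \<in> K \<Longrightarrow> x ^ n \<in> K"
  by (induction n) (auto intro: fd_ring_mult fd_ring_one)

lemma fd_ring_minus: "fd_ring K \<Longrightarrow> x \<in> K \<Longrightarrow> - x \<in> K"
  by (metis fd_ring_subspace vs.subspace_neg)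

lemma fd_ring_add: "fd_ring K \<Longrightarrow> x \<in> K \<Longrightarrow> y \<in> K \<Longrightarrow> x + y \<in> K"
  by (metis fd_ring_subspace vs.subspace_add)

lemma fd_ring_sum: "fd_ring K \<Longrightarrow> (\<And>i. i \<in> A \<Longrightarrow> f i \<in> K) \<Longrightarrow> sum f A \<in> K"
  by (metis fd_ring_subspace vs.subspace_sum)

lemma fd_ring_prod: "fd_ring K \<Longrightarrow> (\<And>i. i \<in> A \<Longrightarrow> f i \<in> K) \<Longrightarrow> prod f A \<in> K"
  by (induction A rule: infinite_finite_induct) (auto intro: fd_ring_one fd_ring_mult)

lemma fd_ring_basis:
  assumes "fd_ring K"
  obtains B where "finite B" "vs.independent B" "vs.span B = K"
proof -
  obtain A where A: "finite A" "K = vs.span A" using assms unfolding fd_ring_def by auto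
  obtain B where B: "B \<subseteq> A" "vs.independent B" "A \<subseteq> vs.span B"
    using vs.maximal_independent_subset[of A] by blast
  have "vs.span B = K"
    unfolding A(2) using vs.span_mono[OF B(1)] vs.span_minimal[OF B(3) vs.subspace_span] by (rule subset_antisym)
  then show ?thesis using that B(2) finite_subset[OF B(1) A(1)] by blast
qed

lemma fd_ring_base: "fd_ring (range \<iota>)"
proof -
  have "vs.span {1} = range \<iota>"
    by (auto simp: vs.span_singleton)
  then show ?thesis unfolding fd_ring_def
    by (auto intro!: exI[of _ "{1}"] simp: image_iff emb_one[symmetric] emb_mult[symmetric])
qed

text \<open>Multiplication by a nonzero \<open>x\<close> is injective, so it maps a basis of the
  finite-dimensional \<open>K\<close> to a basis; the preimage of 1 is the inverse.\<close>

lemma fd_ring_inverse: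
  assumes K: "fd_ring K" and x: "x \<in> K"
  shows "inverse x \<in> K"
proof (cases "x = 0")
  case False
  obtain B where B: "finite B" "vs.independent B" "vs.span B = K"
    using fd_ring_basis[OF K] .
  interpret vp: vector_space_pair "\<lambda>c x. \<iota> c * x" "\<lambda>c x. \<iota> c * x" ..
  have lin: "Vector_Spaces.linear (\<lambda>c x. \<iota> c * x) (\<lambda>c x. \<iota> c * x) ((*) x)"
    by (unfold_locales) (auto simp: algebra_simps)
  have inj: "inj_on ((*) x) A" for A using False by (auto simp: inj_on_def)
  have ind: "vs.independent ((*) x ` B)"
    using vp.linear_independent_injective_image[OF lin B(2) inj] .
  have sub: "(*) x ` B \<subseteq> K"
    using B(3) K x vs.span_base by (auto intro: fd_ring_mult)
  have "1 \<in> vs.span ((*) x ` B)"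
  proof (rule ccontr)
    assume no: "1 \<notin> vs.span ((*) x ` B)"
    then have "vs.independent (insert 1 ((*) x ` B))"
      using ind by (rule vs.independent_insertI)
    moreover have "insert 1 ((*) x ` B) \<subseteq> vs.span B" using sub B(3) fd_ring_one[OF K] by auto
    ultimately have "card (insert 1 ((*) x ` B)) \<le> card B"
      using vs.independent_span_bound[OF B(1)] by blast
    moreover have "1 \<notin> (*) x ` B" using no vs.span_base by blast
    ultimately show False using B(1) card_image[OF inj, of B] by simp
  qed
  also have "vs.span ((*) x ` B) = (*) x ` vs.span B"
    using vp.linear_span_image[OF lin] .
  finally obtain y where "y \<in> K" "1 = x * y" using B(3) by auto
  then show ?thesis by (metis inverse_unique)
qed (simp add: K fd_ring_subspace vs.subspace_0)

lemma fd_ring_divide: "fd_ring K \<Longrightarrow> x \<in> K \<Longrightarrow> y \<in> K \<Longrightarrow> x / y \<in> K"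
  by (simp add: divide_inverse fd_ring_inverse fd_ring_mult)

text \<open>Dependence of an indexed family, not of a set: powers of an element may repeat, and then
  the coefficients 1 and -1 give a relation.\<close>

lemma family_dependent:
  assumes "finite B" "\<And>i. i \<le> card B \<Longrightarrow> f i \<in> vs.span B"
  shows "\<exists>c. (\<exists>i\<le>card B. c i \<noteq> 0) \<and> (\<Sum>i\<le>card B. \<iota> (c i) * f i) = 0"
proof (cases "inj_on f {..card B}")
  case True
  have "vs.dependent (f ` {..card B})"
  proof (rule ccontr)
    assume "\<not> ?thesis"
    then have "card (f ` {..card B}) \<le> card B"
      using vs.independent_span_bound[OF assms(1)] assms(2) by blast
    then show False using card_image[OF True] by simp
  qed
  then obtain u v where u: "(\<Sum>w\<in>f ` {..card B}. \<iota> (u w) * w) = 0" "v \<in> f ` {..card B}" "u v \<noteq> 0"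
    using vs.dependent_finite[of "f ` {..card B}"] by auto
  then show ?thesis
    by (intro exI[of _ "u \<circ> f"]) (auto simp: sum.reindex[OF True])
next
  case False
  then obtain i j where ij: "i \<le> card B" "j \<le> card B" "i \<noteq> j" "f i = f j"
    unfolding inj_on_def by auto
  define c where "c = (\<lambda>k. if k = i then 1 else if k = j then - 1 else (0::'l))"
  have "(\<Sum>k\<le>card B. \<iota> (c k) * f k) = (\<Sum>k\<in>{i,j}. \<iota> (c k) * f k)"
    using ij by (intro sum.mono_neutral_right) (auto simp: c_def emb_zero)
  also have "\<dots> = 0" using ij by (simp add: c_def emb_one emb_minus)
  finally show ?thesis using ij(1) by (intro exI[of _ c]) (auto simp: c_def)
qed

lemma fd_ring_algebraic:
  assumes K: "fd_ring K" and x: "x \<in> K"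
  shows "\<exists>p. p \<noteq> 0 \<and> (\<forall>i. coeff p i \<in> range \<iota>) \<and> poly p x = 0"
proof -
  obtain B where B: "finite B" "K = vs.span B" using K unfolding fd_ring_def by auto
  obtain c i where c: "i \<le> card B" "c i \<noteq> 0" "(\<Sum>i\<le>card B. \<iota> (c i) * x ^ i) = 0"
    using family_dependent[OF B(1), of "\<lambda>i. x ^ i"] fd_ring_power[OF K x] B(2) by auto
  define p where "p = (\<Sum>i\<le>card B. monom (\<iota> (c i)) i)"
  have co: "coeff p j = (if j \<le> card B then \<iota> (c j) else 0)" for j
    unfolding p_def by (simp add: coeff_sum)
  have "poly p x = (\<Sum>i\<le>card B. \<iota> (c i) * x ^ i)" unfolding p_def poly_sum poly_monom ..
  then have "poly p x = 0" using c(3) by metis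
  moreover have "coeff p i \<noteq> 0" unfolding co using c(1,2) by (simp add: emb_eq_0_iff)
  then have "p \<noteq> 0" by (metis coeff_0)
  moreover have "coeff p j \<in> range \<iota>" for j by (metis co emb_zero rangeI)
  ultimately show ?thesis by blast
qed

text \<open>The products of elements of \<open>K\<close> with \<open>y ^ i\<close>,
  \<open>i < degree p\<close>, span a ring, because the equation \<open>p\<close> lowers every
  higher power of \<open>y\<close>. A spanning set is enough for \<open>fd_ring\<close>, so
  \<open>p\<close> can be any equation of \<open>y\<close>, minimal or not.\<close>

lemma fd_ring_adjoin:
  assumes K: "fd_ring K" and p: "p \<noteq> 0" "\<And>i. coeff p i \<in> K" "poly p y = 0"
  shows "\<exists>K'. fd_ring K' \<and> K \<subseteq> K' \<and> y \<in> K'"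
proof -
  obtain B where B: "finite B" "K = vs.span B" using K unfolding fd_ring_def by auto
  define d where "d = degree p"
  define a where "a = (\<lambda>i. coeff p i / lead_coeff p)"
  have aK: "a i \<in> K" for i unfolding a_def using K p(2) by (intro fd_ring_divide)
  have d: "d > 0"
  proof (rule ccontr)
    assume "\<not> d > 0"
    then obtain c where "p = [:c:]" using d_def by (metis degree_eq_zeroE neq0_conv)
    then show False using p by auto
  qed
  have "(\<Sum>i\<le>d. coeff p i * y ^ i) = 0" using p(3) by (simp add: poly_altdef d_def)
  then have "lead_coeff p * y ^ d = - (\<Sum>i<d. coeff p i * y ^ i)"
    unfolding d_def by (simp flip: lessThan_Suc_atMost add: eq_neg_iff_add_eq_0 add.commute)
  then have yd: "y ^ d = - (\<Sum>i<d. a i * y ^ i)"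
    using p(1) by (simp add: a_def sum_negf flip: sum_divide_distrib) (simp add: field_simps)
  define B' where "B' = (\<lambda>(b,i). b * y ^ i) ` (B \<times> {..<d})"
  define K' where "K' = vs.span B'"
  have K's: "vs.subspace K'" unfolding K'_def by simp
  have small: "k * y ^ i \<in> K'" if k: "k \<in> K" and i: "i < d" for k i
    using k unfolding B(2)
  proof (induction rule: vs.span_induct_alt)
    case base then show ?case using K's vs.subspace_0 by simp
  next
    case (step c b k)
    have "b * y ^ i \<in> K'" unfolding K'_def using step(1) i by (intro vs.span_base) (auto simp: B'_def)
    then have "\<iota> c * (b * y ^ i) + k * y ^ i \<in> K'"
      using K's step vs.subspace_add vs.subspace_scale by blast
    then show ?case by (simp add: algebra_simps)
  qed
  \<comment> \<open>Replacing \<open>y ^ d\<close> inside \<open>y ^ n\<close> leaves only exponents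
    below \<open>n\<close>.\<close>
  have all: "\<forall>k\<in>K. k * y ^ n \<in> K'" for n
  proof (induction n rule: less_induct)
    case (less n)
    show ?case
    proof (cases "n < d")
      case True then show ?thesis using small by blast
    next
      case False
      have "k * y ^ n \<in> K'" if k: "k \<in> K" for k
      proof -
        have "k * y ^ n = k * (y ^ d * y ^ (n - d))" using False by (simp flip: power_add)
        also have "\<dots> = (\<Sum>i<d. (- (k * a i)) * y ^ (i + (n - d)))"
          unfolding yd by (simp add: sum_distrib_left sum_distrib_right sum_negf power_add mult.assoc)
        also have "\<dots> \<in> K'"
        proof (intro vs.subspace_sum[OF K's])
          fix i assume "i \<in> {..<d}"
          then have "i + (n - d) < n" using False by auto
          moreover have "- (k * a i) \<in> K" using K k aK by (intro fd_ring_minus fd_ring_mult)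
          ultimately show "(- (k * a i)) * y ^ (i + (n - d)) \<in> K'" using less by blast
        qed
        finally show ?thesis .
      qed
      then show ?thesis by blast
    qed
  qed
  have half: "x * (b * y ^ i) \<in> K'" if "x \<in> K'" "b \<in> K" for x b i
    using that(1) unfolding K'_def
  proof (induction rule: vs.span_induct_alt)
    case base then show ?case using K's vs.subspace_0 by (simp flip: K'_def)
  next
    case (step c b' x)
    obtain b1 j where b1: "b' = b1 * y ^ j" "b1 \<in> B" using step(1) by (auto simp: B'_def)
    then have "b1 \<in> K" using B(2) vs.span_base by blast
    then have "b1 * b * y ^ (j + i) \<in> K'" using all K that(2) by (blast intro: fd_ring_mult)
    then have "\<iota> c * (b1 * b * y ^ (j + i)) + x * (b * y ^ i) \<in> K'"
      using K's step vs.subspace_add vs.subspace_scale unfolding K'_def by blast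
    moreover have "\<iota> c * (b1 * b * y ^ (j + i)) + x * (b * y ^ i) = (\<iota> c * b' + x) * (b * y ^ i)"
      by (simp add: b1 algebra_simps power_add)
    ultimately show ?case by (simp flip: K'_def)
  qed
  have mult: "x * z \<in> K'" if "x \<in> K'" "z \<in> K'" for x z
    using that(2) unfolding K'_def
  proof (induction rule: vs.span_induct_alt)
    case base then show ?case using K's vs.subspace_0 by (simp flip: K'_def)
  next
    case (step c b' z)
    obtain b1 j where b1: "b' = b1 * y ^ j" "b1 \<in> B" using step(1) by (auto simp: B'_def)
    then have "b1 \<in> K" using B(2) vs.span_base by blast
    then have "\<iota> c * (x * (b1 * y ^ j)) + x * z \<in> K'"
      using half that(1) K's step vs.subspace_add vs.subspace_scale unfolding K'_def by blast
    moreover have "\<iota> c * (x * (b1 * y ^ j)) + x * z = x * (\<iota> c * b' + z)"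
      by (simp add: b1 algebra_simps)
    ultimately show ?case by (simp flip: K'_def)
  qed
  have KK': "K \<subseteq> K'" using all[of 0] by auto
  moreover have "y \<in> K'" using all[of 1] fd_ring_one[OF K] by force
  moreover have "finite B'" unfolding B'_def using B(1) by simp
  moreover have "fd_ring K'" unfolding fd_ring_def
    using mult fd_ring_one[OF K] KK' \<open>finite B'\<close> K'_def by blast
  ultimately show ?thesis by blast
qed

end

locale field_extension_deriv = field_extension \<iota> for \<iota> :: "'l::field \<Rightarrow> 'k::field_char_0" +
  fixes D :: "'k \<Rightarrow> 'k"
  assumes D_add: "D (x + y) = D x + D y"
    and D_mult: "D (x * y) = D x * y + x * D y"
    and D_base: "D (\<iota> c) \<in> range \<iota>"
begin

lemma D_zero: "D 0 = 0"
  using D_add[of 0 0] by simp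

lemma D_sum: "D (sum f A) = (\<Sum>i\<in>A. D (f i))"
  by (induction A rule: infinite_finite_induct) (auto simp: D_zero D_add)

lemma D_poly: "D (poly p x) = poly (map_poly D p) x + poly (pderiv p) x * D x"
proof (induction p)
  case (pCons a p)
  then show ?case
    by (simp add: D_add D_mult map_poly_pCons D_zero pderiv_pCons algebra_simps)
qed (simp add: D_zero)

text \<open>Differentiating an equation of least degree for \<open>x\<close> gives a linear equation
  for \<open>D x\<close> with leading coefficient \<open>poly (pderiv p) x\<close>. In
  characteristic 0 minimality makes this coefficient nonzero, so \<open>D x\<close> is a quotient of
  polynomials in \<open>x\<close>.\<close>

lemma fd_ring_deriv:
  assumes K: "fd_ring K" and x: "x \<in> K"
  shows "D x \<in> K"
proof -
  define P where "P = (\<lambda>p. p \<noteq> 0 \<and> (\<forall>i. coeff p i \<in> range \<iota>) \<and> poly p x = 0)"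
  obtain p where p: "P p" and min: "\<And>q. P q \<Longrightarrow> degree p \<le> degree q"
    using ex_has_least_nat[of P _ degree] fd_ring_algebraic[OF K x] unfolding P_def by blast
  have polyK: "poly q x \<in> K" if "\<And>i. coeff q i \<in> range \<iota>" for q
  proof -
    have "coeff q i \<in> K" for i using that[of i] fd_ring_emb[OF K] by auto
    then show ?thesis
      unfolding poly_altdef by (intro fd_ring_sum fd_ring_mult fd_ring_power K x)
  qed
  have p': "coeff (pderiv p) i \<in> range \<iota>" for i
  proof -
    obtain a where "coeff p (Suc i) = \<iota> a" using p unfolding P_def by blast
    then have "coeff (pderiv p) i = \<iota> (of_nat (Suc i) * a)"
      by (simp add: coeff_pderiv emb_mult emb_of_nat del: of_nat_Suc)
    then show ?thesis by simp
  qed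
  have deg: "degree p \<noteq> 0"
  proof
    assume "degree p = 0"
    then obtain c where "p = [:c:]" by (metis degree_eq_zeroE)
    then show False using p unfolding P_def by auto
  qed
  have "poly (pderiv p) x \<noteq> 0"
  proof
    assume "poly (pderiv p) x = 0"
    then have "P (pderiv p)" using p' deg unfolding P_def by (simp add: pderiv_eq_0_iff)
    then have "degree p \<le> degree (pderiv p)" by (rule min)
    then show False using deg by (simp add: degree_pderiv)
  qed
  moreover have "poly (map_poly D p) x + poly (pderiv p) x * D x = 0"
    using p D_poly[of p x] by (simp add: P_def D_zero)
  ultimately have "D x = - poly (map_poly D p) x / poly (pderiv p) x"
    by (simp add: field_simps eq_neg_iff_add_eq_0)
  moreover have "coeff (map_poly D p) i \<in> range \<iota>" for i
  proof -
    obtain a where "coeff p i = \<iota> a" using p unfolding P_def by blast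
    then show ?thesis using D_base by (simp add: coeff_map_poly D_zero)
  qed
  ultimately show ?thesis
    using K p' by (simp only:) (intro fd_ring_divide fd_ring_minus polyK)
qed

end

section \<open>Jacobi's formula for the derivative of a determinant\<close>

lemma deriv_prod:
  fixes d :: "'a::comm_ring_1 \<Rightarrow> 'a"
  assumes "\<And>x y. d (x * y) = d x * y + x * d y" and "finite A"
  shows "d (prod f A) = (\<Sum>i\<in>A. d (f i) * prod f (A - {i}))"
  using assms(2)
proof (induction A rule: finite_induct)
  case empty
  show ?case using assms(1)[of 1 1] by simp
next
  case (insert a A)
  have "prod f (insert a A - {i}) = f a * prod f (A - {i})" if "i \<in> A" for i
  proof -
    have "insert a A - {i} = insert a (A - {i})" using insert that by auto
    then show ?thesis using insert by simp
  qed
  then have "(\<Sum>i\<in>A. d (f i) * prod f (insert a A - {i})) = f a * (\<Sum>i\<in>A. d (f i) * prod f (A - {i}))"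
    by (simp add: sum_distrib_left algebra_simps)
  then show ?case using insert by (simp add: assms(1))
qed

text \<open>Apply the product rule to each term of the Leibniz expansion. The terms in which the
  factor from row \<open>i\<close> is differentiated form the determinant of \<open>R i\<close>, the
  matrix \<open>A\<close> with row \<open>i\<close> differentiated, and this is expanded along that
  row.\<close>

lemma jacobi_det:
  fixes A :: "'a::comm_ring_1 mat"
  assumes A: "A \<in> carrier_mat n n"
    and d_add: "\<And>x y. d (x + y) = d x + d y"
    and d_mult: "\<And>x y. d (x * y) = d x * y + x * d y"
  shows "d (Determinant.det A) = (\<Sum>i<n. \<Sum>j<n. d (A $$ (i,j)) * cofactor A i j)"
proof -
  have d0: "d 0 = 0" using d_add[of 0 0] by simp
  have d1: "d 1 = 0" using d_mult[of 1 1] by simp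
  have dm: "d (- x) = - d x" for x using d_add[of x "- x"] by (simp add: d0 eq_neg_iff_add_eq_0 add.commute)
  have dsum: "d (sum f S) = (\<Sum>i\<in>S. d (f i))" for f and S :: "'b set"
    by (induction S rule: infinite_finite_induct) (auto simp: d0 d_add)
  have dsign: "d (signof p * x) = signof p * d x" for p :: "nat \<Rightarrow> nat" and x
    by (simp add: sign_def dm)
  let ?P = "{p. p permutes {0..<n}}"
  define R where "R = (\<lambda>i. Matrix.mat n n (\<lambda>(k,j). if k = i then d (A $$ (i,j)) else A $$ (k,j)))"
  have R: "R i \<in> carrier_mat n n" for i by (simp add: R_def)
  have row: "(\<Sum>j<n. d (A $$ (i,j)) * cofactor A i j)
      = (\<Sum>p\<in>?P. signof p * (d (A $$ (i, p i)) * (\<Prod>k\<in>{0..<n}-{i}. A $$ (k, p k))))"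
    if i: "i < n" for i
  proof -
    \<comment> \<open>\<open>R i\<close> and \<open>A\<close> differ only in row \<open>i\<close>,
      hence have the same cofactors along it.\<close>
    have "mat_delete (R i) i j = mat_delete A i j" if "j < n" for j
      using A R[of i] that i by (intro eq_matI) (auto simp: mat_delete_def R_def)
    then have "(\<Sum>j<n. d (A $$ (i,j)) * cofactor A i j) = (\<Sum>j<n. R i $$ (i,j) * cofactor (R i) i j)"
      using i by (intro sum.cong) (auto simp: cofactor_def R_def)
    also have "\<dots> = Determinant.det (R i)" using laplace_expansion_row[OF R i] by simp
    also have "\<dots> = (\<Sum>p\<in>?P. signof p * (\<Prod>k = 0..<n. R i $$ (k, p k)))"
      by (rule det_def'[OF R])
    also have "\<dots> = (\<Sum>p\<in>?P. signof p * (d (A $$ (i, p i)) * (\<Prod>k\<in>{0..<n}-{i}. A $$ (k, p k))))"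
    proof (intro sum.cong refl arg_cong2[of _ _ _ _ "(*)"])
      fix p assume "p \<in> ?P"
      then have pk: "k < n \<Longrightarrow> p k < n" for k using permutes_in_image[of p "{0..<n}" k] by auto
      have "(\<Prod>k = 0..<n. R i $$ (k, p k)) = R i $$ (i, p i) * (\<Prod>k\<in>{0..<n}-{i}. R i $$ (k, p k))"
        using i by (intro prod.remove) auto
      also have "\<dots> = d (A $$ (i, p i)) * (\<Prod>k\<in>{0..<n}-{i}. A $$ (k, p k))"
        using pk i by (auto simp: R_def intro!: arg_cong2[of _ _ _ _ "(*)"] prod.cong)
      finally show "(\<Prod>k = 0..<n. R i $$ (k, p k)) = \<dots>" .
    qed
    finally show ?thesis .
  qed
  have "d (Determinant.det A) = (\<Sum>p\<in>?P. signof p * (\<Sum>i\<in>{0..<n}. d (A $$ (i, p i)) * (\<Prod>k\<in>{0..<n}-{i}. A $$ (k, p k))))"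
    unfolding det_def'[OF A] dsum dsign
    by (intro sum.cong refl) (simp add: deriv_prod[OF d_mult])
  also have "\<dots> = (\<Sum>i\<in>{0..<n}. \<Sum>p\<in>?P. signof p * (d (A $$ (i, p i)) * (\<Prod>k\<in>{0..<n}-{i}. A $$ (k, p k))))"
    unfolding sum_distrib_left by (rule sum.swap)
  also have "\<dots> = (\<Sum>i<n. \<Sum>j<n. d (A $$ (i,j)) * cofactor A i j)"
    unfolding atLeast0LessThan by (intro sum.cong refl) (simp add: row atLeast0LessThan)
  finally show ?thesis .
qed

section \<open>The trace of a logarithmic derivative\<close>

context field_extension_deriv
begin

text \<open>\<open>T\<close> is the trace of multiplication on \<open>K\<close>, and \<open>d\<close> is the norm of \<open>f\<close>.\<close>

theorem trace_log_deriv: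
  assumes K: "fd_ring K"
  obtains T :: "'k \<Rightarrow> 'l" and M :: nat where
    "M > 0" "T 1 = of_nat M"
    "\<And>x y. x \<in> K \<Longrightarrow> y \<in> K \<Longrightarrow> T (x + y) = T x + T y"
    "\<And>c x. x \<in> K \<Longrightarrow> T (\<iota> c * x) = c * T x"
    "\<And>f. f \<in> K \<Longrightarrow> f \<noteq> 0 \<Longrightarrow> \<exists>d. d \<noteq> 0 \<and> \<iota> (T (D f / f)) = D (\<iota> d) / \<iota> d"
proof -
  obtain B where B: "finite B" "vs.independent B" "vs.span B = K" using fd_ring_basis[OF K] .
  define M where "M = card B"
  obtain b where b: "bij_betw b {..<M} B"
    using B(1) ex_bij_betw_nat_finite[of B] unfolding M_def atLeast0LessThan by blast
  have bK: "i < M \<Longrightarrow> b i \<in> K" for i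
    using b B(3) vs.span_base[of "b i" B] by (auto simp: bij_betw_def)
  define rep where "rep = (\<lambda>x j. vs.representation B x (b j))"
  have rep: "x = (\<Sum>j<M. \<iota> (rep x j) * b j)" if "x \<in> K" for x
  proof -
    have "x = (\<Sum>w\<in>B. \<iota> (vs.representation B x w) * w)"
      by (rule vs.sum_representation_eq[OF B(2) _ B(1) order_refl, of x, symmetric]) (use that B(3) in blast)
    also have "\<dots> = (\<Sum>j<M. \<iota> (rep x j) * b j)"
      unfolding rep_def by (rule sum.reindex_bij_betw[OF b, symmetric])
    finally show ?thesis .
  qed
  have uniq: "c j = e j" if eq: "(\<Sum>j<M. \<iota> (c j) * b j) = (\<Sum>j<M. \<iota> (e j) * b j)" and j: "j < M" for c e j
  proof -
    define u where "u = (\<lambda>w. c (inv_into {..<M} b w) - e (inv_into {..<M} b w))"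
    have ub: "u (b j) = c j - e j" if "j < M" for j
      using that b by (simp add: u_def bij_betw_def inv_into_f_f)
    have "(\<Sum>w\<in>B. \<iota> (u w) * w) = (\<Sum>j<M. \<iota> (u (b j)) * b j)"
      using sum.reindex_bij_betw[OF b, of "\<lambda>w. \<iota> (u w) * w"] by simp
    also have "\<dots> = (\<Sum>j<M. \<iota> (c j) * b j - \<iota> (e j) * b j)"
      by (intro sum.cong) (auto simp: ub vs.scale_left_diff_distrib)
    also have "\<dots> = 0" using eq by (simp add: sum_subtractf)
    finally have "u (b j) = 0"
      using vs.independentD[OF B(2) B(1) order_refl] b j by (auto simp: bij_betw_def)
    then show ?thesis using ub[OF j] by simp
  qed
  \<comment> \<open>The matrix of multiplication by \<open>x\<close> in the basis \<open>b\<close>;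
    row \<open>i\<close> holds the coordinates of \<open>x * b i\<close>.\<close>
  define mc where "mc = (\<lambda>x i j. rep (x * b i) j)"
  have mc: "x * b i = (\<Sum>j<M. \<iota> (mc x i j) * b j)" if "x \<in> K" "i < M" for x i
    unfolding mc_def using rep fd_ring_mult[OF K that(1) bK[OF that(2)]] .
  have mcI: "mc x i j = c i j" if "x \<in> K" "i < M" "j < M" "x * b i = (\<Sum>j<M. \<iota> (c i j) * b j)" for x i j c
    using uniq[of "mc x i" "c i" j] mc[OF that(1,2)] that by simp
  have mc_add: "mc (x + y) i j = mc x i j + mc y i j" if "x \<in> K" "y \<in> K" "i < M" "j < M" for x y i j
  proof (rule mcI[OF fd_ring_add[OF K that(1,2)] that(3,4)])
    show "(x + y) * b i = (\<Sum>j<M. \<iota> (mc x i j + mc y i j) * b j)"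
      unfolding distrib_right mc[OF that(1,3)] mc[OF that(2,3)] emb_add sum.distrib ..
  qed
  have mc_scale: "mc (\<iota> c * x) i j = c * mc x i j" if "x \<in> K" "i < M" "j < M" for c x i j
  proof (rule mcI[OF fd_ring_mult[OF K fd_ring_emb[OF K] that(1)] that(2,3)])
    show "\<iota> c * x * b i = (\<Sum>j<M. \<iota> (c * mc x i j) * b j)"
      unfolding mult.assoc mc[OF that(1,2)] sum_distrib_left emb_mult ..
  qed
  have mc_mult: "mc (x * y) i j = (\<Sum>k<M. mc x i k * mc y k j)" if "x \<in> K" "y \<in> K" "i < M" "j < M" for x y i j
  proof (rule mcI[OF fd_ring_mult[OF K that(1,2)] that(3,4)])
    have "x * y * b i = y * (x * b i)" by simp
    also have "\<dots> = (\<Sum>k<M. \<iota> (mc x i k) * (y * b k))"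
      unfolding mc[OF that(1,3)] by (simp add: sum_distrib_left algebra_simps)
    also have "\<dots> = (\<Sum>k<M. \<iota> (mc x i k) * (\<Sum>j<M. \<iota> (mc y k j) * b j))"
      by (rule sum.cong[OF refl]) (simp only: mc[OF that(2)] lessThan_iff)
    also have "\<dots> = (\<Sum>j<M. \<iota> (\<Sum>k<M. mc x i k * mc y k j) * b j)"
      unfolding sum_distrib_left emb_sum sum_distrib_right
      by (subst sum.swap) (simp only: emb_mult mult.assoc)
    finally show "x * y * b i = \<dots>" .
  qed
  have mc_one: "mc 1 i j = (if i = j then 1 else 0)" if "i < M" "j < M" for i j
  proof (rule mcI[OF fd_ring_one[OF K] that])
    have "(\<Sum>j<M. \<iota> (if i = j then 1 else 0) * b j) = (\<Sum>j<M. if i = j then b j else 0)"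
      by (intro sum.cong) (auto simp: emb_one emb_zero)
    then show "1 * b i = (\<Sum>j<M. \<iota> (if i = j then 1 else 0) * b j)" using that by simp
  qed
  define T where "T = (\<lambda>x. \<Sum>i<M. mc x i i)"
  \<comment> \<open>\<open>D\<close> preserves the image of the small field and so induces a
    derivation \<open>d\<close> of that field.\<close>
  have "\<forall>c. \<exists>c'. D (\<iota> c) = \<iota> c'" using D_base by blast
  then obtain d where d: "\<And>c. D (\<iota> c) = \<iota> (d c)" by metis
  have d_add: "d (x + y) = d x + d y" for x y
    by (rule iffD1[OF emb_inj]) (simp add: d[symmetric] emb_add D_add)
  have d_mult: "d (x * y) = d x * y + x * d y" for x y
    by (rule iffD1[OF emb_inj]) (simp add: d[symmetric] emb_add emb_mult D_mult)
  have main: "\<exists>d. d \<noteq> 0 \<and> \<iota> (T (D f / f)) = D (\<iota> d) / \<iota> d" if f: "f \<in> K" "f \<noteq> 0" for f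
  proof -
    \<comment> \<open>\<open>A\<close> is the matrix of \<open>f\<close>, \<open>G\<close> its
      inverse, and \<open>C\<close> records the derivatives of the basis vectors, like a connection
      matrix.\<close>
    define A where "A = mc f"
    define G where "G = mc (inverse f)"
    define C where "C = (\<lambda>i. rep (D (b i)))"
    have C: "D (b i) = (\<Sum>j<M. \<iota> (C i j) * b j)" if "i < M" for i
      unfolding C_def using rep[OF fd_ring_deriv[OF K bK[OF that]]] .
    have fi: "inverse f \<in> K" using fd_ring_inverse[OF K f(1)] .
    have AG: "(\<Sum>k<M. A i k * G k j) = (if i = j then 1 else 0)" if "i < M" "j < M" for i j
      using mc_mult[OF f(1) fi that] mc_one[OF that] f(2) by (simp add: A_def G_def)
    have GA: "(\<Sum>k<M. G i k * A k j) = (if i = j then 1 else 0)" if "i < M" "j < M" for i j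
      using mc_mult[OF fi f(1) that] mc_one[OF that] f(2) by (simp add: A_def G_def)
    have Df: "D f \<in> K" using fd_ring_deriv[OF K f(1)] .
    \<comment> \<open>The product rule gives the matrix dA + AC - CA for \<open>D f\<close>. After
      multiplication by \<open>G\<close>, the last two terms both have the trace of
      \<open>C\<close>, so that only the trace of dA G remains.\<close>
    have mcD: "mc (D f) i j = d (A i j) + (\<Sum>k<M. A i k * C k j) - (\<Sum>k<M. C i k * A k j)"
      if ij: "i < M" "j < M" for i j
    proof (rule mcI[OF Df ij])
      have "D f * b i = D (f * b i) - f * D (b i)" by (simp add: D_mult)
      also have "D (f * b i) = (\<Sum>j<M. \<iota> (d (A i j)) * b j) + (\<Sum>k<M. \<iota> (A i k) * D (b k))"
        unfolding mc[OF f(1) ij(1)] D_sum D_mult d sum.distrib A_def ..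
      also have "(\<Sum>k<M. \<iota> (A i k) * D (b k)) = (\<Sum>k<M. \<iota> (A i k) * (\<Sum>j<M. \<iota> (C k j) * b j))"
        by (rule sum.cong[OF refl]) (simp only: C lessThan_iff)
      also have "\<dots> = (\<Sum>j<M. \<iota> (\<Sum>k<M. A i k * C k j) * b j)"
        unfolding sum_distrib_left emb_sum sum_distrib_right
        by (subst sum.swap) (simp only: emb_mult mult.assoc)
      also have "f * D (b i) = (\<Sum>k<M. \<iota> (C i k) * (f * b k))"
        unfolding C[OF ij(1)] by (simp add: sum_distrib_left algebra_simps)
      also have "\<dots> = (\<Sum>k<M. \<iota> (C i k) * (\<Sum>j<M. \<iota> (A k j) * b j))"
        unfolding A_def by (rule sum.cong[OF refl]) (simp only: mc[OF f(1)] lessThan_iff)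
      also have "\<dots> = (\<Sum>j<M. \<iota> (\<Sum>k<M. C i k * A k j) * b j)"
        unfolding sum_distrib_left emb_sum sum_distrib_right
        by (subst sum.swap) (simp only: emb_mult mult.assoc)
      finally show "D f * b i
        = (\<Sum>j<M. \<iota> (d (A i j) + (\<Sum>k<M. A i k * C k j) - (\<Sum>k<M. C i k * A k j)) * b j)"
        by (simp only: emb_add vs.scale_left_diff_distrib distrib_right sum.distrib sum_subtractf)
    qed
    have "T (D f / f) = (\<Sum>i<M. \<Sum>j<M. mc (D f) i j * G j i)"
      unfolding T_def divide_inverse G_def using mc_mult[OF Df fi] by simp
    also have "\<dots> = (\<Sum>i<M. \<Sum>j<M. d (A i j) * G j i) + (\<Sum>i<M. \<Sum>j<M. (\<Sum>k<M. A i k * C k j) * G j i)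
        - (\<Sum>i<M. \<Sum>j<M. (\<Sum>k<M. C i k * A k j) * G j i)"
      using mcD by (simp add: distrib_right left_diff_distrib sum.distrib sum_subtractf)
    finally have sum3: "T (D f / f) = (\<Sum>i<M. \<Sum>j<M. d (A i j) * G j i)
        + (\<Sum>i<M. \<Sum>j<M. (\<Sum>k<M. A i k * C k j) * G j i)
        - (\<Sum>i<M. \<Sum>j<M. (\<Sum>k<M. C i k * A k j) * G j i)" .
    have third: "(\<Sum>i<M. \<Sum>j<M. (\<Sum>k<M. C i k * A k j) * G j i) = (\<Sum>i<M. C i i)"
    proof (intro sum.cong refl)
      fix i assume i: "i \<in> {..<M}"
      have "(\<Sum>j<M. (\<Sum>k<M. C i k * A k j) * G j i) = (\<Sum>k<M. C i k * (\<Sum>j<M. A k j * G j i))"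
        unfolding sum_distrib_left sum_distrib_right by (subst sum.swap) (simp add: mult.assoc)
      also have "\<dots> = (\<Sum>k<M. if k = i then C i k else 0)" using i AG by (intro sum.cong) auto
      finally show "(\<Sum>j<M. (\<Sum>k<M. C i k * A k j) * G j i) = C i i" using i by simp
    qed
    have "(\<Sum>i<M. \<Sum>j<M. (\<Sum>k<M. A i k * C k j) * G j i)
        = (\<Sum>i<M. \<Sum>j<M. \<Sum>k<M. G j i * A i k * C k j)"
      unfolding sum_distrib_right by (simp only: ac_simps)
    also have "\<dots> = (\<Sum>j<M. \<Sum>i<M. \<Sum>k<M. G j i * A i k * C k j)" by (rule sum.swap)
    also have "\<dots> = (\<Sum>j<M. \<Sum>k<M. (\<Sum>i<M. G j i * A i k) * C k j)"
      unfolding sum_distrib_right by (intro sum.cong refl sum.swap)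
    also have "\<dots> = (\<Sum>j<M. C j j)"
    proof (intro sum.cong refl)
      fix j assume j: "j \<in> {..<M}"
      have "(\<Sum>k<M. (\<Sum>i<M. G j i * A i k) * C k j) = (\<Sum>k<M. if j = k then C k j else 0)"
        using j GA by (intro sum.cong) auto
      then show "(\<Sum>k<M. (\<Sum>i<M. G j i * A i k) * C k j) = C j j" using j by simp
    qed
    finally have tr: "T (D f / f) = (\<Sum>i<M. \<Sum>j<M. d (A i j) * G j i)"
      unfolding sum3 third by simp
    define Am where "Am = Matrix.mat M M (\<lambda>(i,j). A i j)"
    define Gm where "Gm = Matrix.mat M M (\<lambda>(i,j). G i j)"
    have Am: "Am \<in> carrier_mat M M" and Gm: "Gm \<in> carrier_mat M M" by (simp_all add: Am_def Gm_def)
    have AmGm: "Am * Gm = 1\<^sub>m M"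
      using AG by (intro eq_matI) (auto simp: Am_def Gm_def scalar_prod_def atLeast0LessThan)
    have "Determinant.det Am * Determinant.det Gm = 1" using det_mult[OF Am Gm] AmGm by simp
    then have nz: "Determinant.det Am \<noteq> 0" by auto
    \<comment> \<open>The adjugate is the determinant times the inverse \<open>Gm\<close>; Jacobi's
      formula then reads d(det A) = det A tr(dA G).\<close>
    have "adj_mat Am = adj_mat Am * (Am * Gm)"
      unfolding AmGm using adj_mat(1)[OF Am] by simp
    also have "\<dots> = (Determinant.det Am \<cdot>\<^sub>m 1\<^sub>m M) * Gm"
      using adj_mat(1,3)[OF Am] Am Gm by (metis assoc_mult_mat)
    also have "\<dots> = Determinant.det Am \<cdot>\<^sub>m Gm"
      using Gm by (simp add: mult_smult_assoc_mat[OF one_carrier_mat Gm])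
    finally have adj: "adj_mat Am = Determinant.det Am \<cdot>\<^sub>m Gm" .
    have cof: "cofactor Am i j = Determinant.det Am * G j i" if "i < M" "j < M" for i j
    proof -
      have "cofactor Am i j = adj_mat Am $$ (j, i)" using that Am by (simp add: adj_mat_def)
      then show ?thesis using that Gm unfolding adj by (simp add: Gm_def)
    qed
    have "d (Determinant.det Am) = (\<Sum>i<M. \<Sum>j<M. d (Am $$ (i,j)) * cofactor Am i j)"
      by (rule jacobi_det[OF Am d_add d_mult])
    also have "\<dots> = (\<Sum>i<M. \<Sum>j<M. d (A i j) * (Determinant.det Am * G j i))"
      using cof by (intro sum.cong refl) (auto simp: Am_def)
    also have "\<dots> = Determinant.det Am * T (D f / f)"
      unfolding tr sum_distrib_left by (simp add: algebra_simps)
    finally have "T (D f / f) = d (Determinant.det Am) / Determinant.det Am" using nz by simp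
    then show ?thesis using nz by (intro exI[of _ "Determinant.det Am"]) (simp add: emb_divide d)
  qed
  show ?thesis
  proof (rule that[of M T])
    have "B \<noteq> {}" using B(3) fd_ring_one[OF K] by auto
    then show "M > 0" using B(1) by (simp add: M_def card_gt_0_iff)
    show "T 1 = of_nat M" using mc_one by (simp add: T_def)
    show "T (x + y) = T x + T y" if "x \<in> K" "y \<in> K" for x y
      using that mc_add by (simp add: T_def sum.distrib)
    show "T (\<iota> c * x) = c * T x" if "x \<in> K" for c x
      using that mc_scale by (simp add: T_def sum_distrib_left)
  qed (use main in blast)
qed

end

section \<open>Logarithmic relations between algebraic Laurent series\<close>

definition fls_ev :: "complex fls \<Rightarrow> complex poly \<Rightarrow> complex fls" where
  "fls_ev u p = poly (map_poly fls_const p) u"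

lemma fls_ev_0 [simp]: "fls_ev u 0 = 0"
  by (simp add: fls_ev_def)

lemma fls_ev_pCons: "fls_ev u (pCons a p) = fls_const a + u * fls_ev u p"
  by (simp add: fls_ev_def map_poly_pCons)

lemma fls_ev_1 [simp]: "fls_ev u 1 = 1"
  by (simp add: fls_ev_pCons one_pCons)

lemma fls_ev_add: "fls_ev u (p + q) = fls_ev u p + fls_ev u q"
  by (induction p q rule: poly_induct2)
    (simp_all add: fls_ev_pCons algebra_simps flip: fls_plus_const)

lemma fls_ev_smult: "fls_ev u (smult a p) = fls_const a * fls_ev u p"
  by (induction p) (simp_all add: fls_ev_pCons algebra_simps flip: fls_const_mult_const)

lemma fls_ev_mult: "fls_ev u (p * q) = fls_ev u p * fls_ev u q"
  by (induction p) (simp_all add: fls_ev_pCons fls_ev_add fls_ev_smult algebra_simps)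

lemma fls_ev_altdef:
  assumes "degree p \<le> d"
  shows "fls_ev u p = (\<Sum>i\<le>d. fls_const (coeff p i) * u ^ i)"
proof -
  have "fls_ev u p = (\<Sum>i\<le>degree p. fls_const (coeff p i) * u ^ i)"
    unfolding fls_ev_def poly_altdef
    by (subst degree_map_poly) (simp_all add: coeff_map_poly)
  also have "\<dots> = (\<Sum>i\<le>d. fls_const (coeff p i) * u ^ i)"
    using assms by (intro sum.mono_neutral_left) (auto simp: coeff_eq_0)
  finally show ?thesis .
qed

lemma fls_ev_deriv: "fls_deriv (fls_ev u p) = fls_ev u (pderiv p) * fls_deriv u"
  by (induction p) (simp_all add: fls_ev_pCons pderiv_pCons fls_ev_add algebra_simps)

text \<open>A relation p(u) = 0 can be differentiated to p'(u) u' = 0, of smaller degree, so a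
  series with nonzero derivative is transcendental over the constants. The condition
  \<open>fls_deriv u \<noteq> 0\<close> expresses throughout that \<open>u\<close> is not
  constant.\<close>

lemma fls_ev_nonzero:
  assumes u: "fls_deriv u \<noteq> 0" and p: "p \<noteq> 0"
  shows "fls_ev u p \<noteq> 0"
  using p
proof (induction "degree p" arbitrary: p rule: less_induct)
  case less
  show ?case
  proof
    assume 0: "fls_ev u p = 0"
    show False
    proof (cases "degree p = 0")
      case True
      then obtain a where "p = [:a:]" by (metis degree_eq_zeroE)
      then show False using 0 less.prems by (simp add: fls_ev_pCons)
    next
      case False
      have "fls_ev u (pderiv p) = 0" using fls_ev_deriv[of u p] 0 u by simp
      moreover have "pderiv p \<noteq> 0" using False by (simp add: pderiv_eq_0_iff)
      moreover have "degree (pderiv p) < degree p" using False by (simp add: degree_pderiv)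
      ultimately show False using less.hyps by blast
    qed
  qed
qed

text \<open>The embedding of C(u). A fraction is an equivalence class, so a representative is
  chosen; by \<open>ratfun_ev_Fract\<close> the value does not depend on it when \<open>u\<close> is
  not constant.\<close>

definition ratfun_ev :: "complex fls \<Rightarrow> complex poly fract \<Rightarrow> complex fls" where
  "ratfun_ev u x = (let pq = SOME pq. snd pq \<noteq> 0 \<and> x = Fract (fst pq) (snd pq)
                    in fls_ev u (fst pq) / fls_ev u (snd pq))"

lemma ratfun_ev_Fract:
  assumes u: "fls_deriv u \<noteq> 0" and q: "q \<noteq> 0"
  shows "ratfun_ev u (Fract p q) = fls_ev u p / fls_ev u q"
proof -
  define pq where "pq = (SOME pq. snd pq \<noteq> 0 \<and> Fract p q = Fract (fst pq) (snd pq))"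
  have "snd pq \<noteq> 0 \<and> Fract p q = Fract (fst pq) (snd pq)"
    unfolding pq_def by (rule someI[of _ "(p,q)"]) (simp add: q)
  then have "p * snd pq = fst pq * q" and s: "snd pq \<noteq> 0" using q by (auto simp: eq_fract)
  then have "fls_ev u p * fls_ev u (snd pq) = fls_ev u (fst pq) * fls_ev u q"
    by (metis fls_ev_mult)
  then show ?thesis
    using fls_ev_nonzero[OF u] q s
    by (simp add: ratfun_ev_def Let_def frac_eq_eq flip: pq_def)
qed

lemma field_extension_ratfun_ev:
  assumes u: "fls_deriv u \<noteq> 0"
  shows "field_extension (ratfun_ev u)"
proof
  show "ratfun_ev u 1 = 1" by (simp add: One_fract_def ratfun_ev_Fract u)
next
  fix a b :: "complex poly fract"
  obtain p q where a: "a = Fract p q" "q \<noteq> 0" by (cases a) auto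
  obtain r s where b: "b = Fract r s" "s \<noteq> 0" by (cases b) auto
  show "ratfun_ev u (a + b) = ratfun_ev u a + ratfun_ev u b"
    using a b fls_ev_nonzero[OF u]
    by (simp add: ratfun_ev_Fract u fls_ev_add fls_ev_mult field_simps)
  show "ratfun_ev u (a * b) = ratfun_ev u a * ratfun_ev u b"
    using a b fls_ev_nonzero[OF u] by (simp add: ratfun_ev_Fract u fls_ev_mult)
qed

lemma fls_deriv_divide:
  fixes x y :: "complex fls"
  assumes "y \<noteq> 0"
  shows "fls_deriv (x / y) = (fls_deriv x * y - x * fls_deriv y) / y\<^sup>2"
proof -
  have "fls_deriv x = fls_deriv ((x / y) * y)" using assms by simp
  also have "\<dots> = fls_deriv (x / y) * y + (x / y) * fls_deriv y"
    unfolding fls_deriv_mult by simp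
  finally show ?thesis using assms by (simp add: field_simps power2_eq_square)
qed

lemma fls_deriv_ratfun_ev:
  assumes u: "fls_deriv u \<noteq> 0" and q: "q \<noteq> 0"
  shows "fls_deriv (ratfun_ev u (Fract p q))
    = ratfun_ev u (Fract (pderiv p * q - p * pderiv q) (q\<^sup>2)) * fls_deriv u"
proof -
  have m: "fls_ev u (- p) = - fls_ev u p" for p using fls_ev_smult[of u "-1" p] by simp
  have d: "fls_ev u (p - q) = fls_ev u p - fls_ev u q" for p q
    using fls_ev_add[of u p "- q"] by (simp add: m)
  show ?thesis
    using q fls_ev_nonzero[OF u q]
    by (simp add: ratfun_ev_Fract u fls_deriv_divide fls_ev_deriv d fls_ev_mult power2_eq_square field_simps)
qed

text \<open>Division by \<open>fls_deriv u\<close> turns the derivative into d/du, which maps C(u)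
  into itself.\<close>

lemma field_extension_deriv_ratfun_ev:
  assumes u: "fls_deriv u \<noteq> 0"
  shows "field_extension_deriv (ratfun_ev u) (\<lambda>x. fls_deriv x / fls_deriv u)"
proof -
  interpret field_extension "ratfun_ev u" by (rule field_extension_ratfun_ev[OF u])
  show ?thesis
  proof
    fix c :: "complex poly fract"
    obtain p q where c: "c = Fract p q" "q \<noteq> 0" by (cases c) auto
    show "fls_deriv (ratfun_ev u c) / fls_deriv u \<in> range (ratfun_ev u)"
      using u by (simp add: c fls_deriv_ratfun_ev)
  qed (simp_all add: add_divide_distrib field_simps)
qed

text \<open>The identity t = d'/d holds after substitution of \<open>u\<close>, hence, by
  injectivity, between rational functions, hence after substitution of \<open>fls_X\<close>. There
  the residue of a logarithmic derivative is an order of vanishing. This is how the residue at u = 0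
  is taken.\<close>

lemma log_deriv_residue:
  assumes u: "fls_deriv u \<noteq> 0" and d: "d \<noteq> 0"
    and t: "ratfun_ev u t = fls_deriv (ratfun_ev u d) / fls_deriv u / ratfun_ev u d"
  shows "fls_residue (ratfun_ev fls_X t) = of_int (fls_subdegree (ratfun_ev fls_X d))"
proof -
  obtain p q where d': "d = Fract p q" "q \<noteq> 0" by (cases d) auto
  interpret A: field_extension "ratfun_ev u" by (rule field_extension_ratfun_ev[OF u])
  interpret X: field_extension "ratfun_ev fls_X" by (rule field_extension_ratfun_ev) simp
  define e where "e = Fract (pderiv p * q - p * pderiv q) (q\<^sup>2)"
  have "ratfun_ev u t = ratfun_ev u (e / d)"
    using u d'(2) unfolding t A.emb_divide unfolding d'(1) fls_deriv_ratfun_ev[OF u d'(2)] e_def by simp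
  then have "t = e / d" by (simp add: A.emb_inj)
  moreover have "fls_deriv (ratfun_ev fls_X d) = ratfun_ev fls_X e"
    using d'(2) by (simp add: d'(1) fls_deriv_ratfun_ev e_def)
  ultimately have "ratfun_ev fls_X t = fls_deriv (ratfun_ev fls_X d) / ratfun_ev fls_X d"
    by (simp add: X.emb_divide)
  then show ?thesis
    using d fls_residue_deriv_times_inverse_eq_subdegree[of "ratfun_ev fls_X d"]
    by (simp add: divide_inverse X.emb_eq_0_iff)
qed

section \<open>Algebraic dependence of two Laurent series\<close>

definition alg_dep :: "complex fls \<Rightarrow> complex fls \<Rightarrow> bool" where
  "alg_dep x y \<longleftrightarrow> (\<exists>Q :: complex poly poly. Q \<noteq> 0 \<and> poly (map_poly (fls_ev x) Q) y = 0)"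

text \<open>A nonzero polynomial in two variables treats both series alike; \<open>R\<close>
  transposes the double array of coefficients of \<open>Q\<close>. This lets X become algebraic over
  C(u) once \<open>u\<close> is algebraic over C(X).\<close>

lemma alg_dep_swap:
  assumes "alg_dep x y"
  shows "alg_dep y x"
proof -
  obtain Q :: "complex poly poly" where Q: "Q \<noteq> 0" "poly (map_poly (fls_ev x) Q) y = 0"
    using assms unfolding alg_dep_def by blast
  define e where "e = degree Q"
  define d where "d = Max ((\<lambda>j. degree (coeff Q j)) ` {..e})"
  have d: "degree (coeff Q j) \<le> d" if "j \<le> e" for j unfolding d_def using that by auto
  define R where "R = (\<Sum>i\<le>d. monom (\<Sum>j\<le>e. monom (coeff (coeff Q j) i) j) i)"
  have R: "coeff R i = (if i \<le> d then \<Sum>j\<le>e. monom (coeff (coeff Q j) i) j else 0)" for i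
    unfolding R_def by (simp add: coeff_sum)
  have Rij: "coeff (coeff R i) j = coeff (coeff Q j) i" if "i \<le> d" "j \<le> e" for i j
    using that by (simp add: R coeff_sum)
  have degR: "degree (coeff R i) \<le> e" for i
    unfolding R by (auto intro!: degree_sum_le simp: degree_monom_le order_trans[OF degree_monom_le])
  have degR': "degree R \<le> d" by (intro degree_le) (simp add: R)
  have "R \<noteq> 0"
  proof
    assume "R = 0"
    then have "coeff (lead_coeff Q) i = 0" if "i \<le> d" for i
      using Rij[of i e] that by (simp add: e_def)
    then have "lead_coeff (lead_coeff Q) = 0" using d[of e] by (simp add: e_def)
    then show False using Q(1) by simp
  qed
  have "poly (map_poly (fls_ev y) R) x = (\<Sum>i\<le>d. fls_ev y (coeff R i) * x ^ i)"
    unfolding poly_altdef using degR'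
    by (intro sum.mono_neutral_cong_left)
      (auto simp: coeff_map_poly order_trans[OF map_poly_degree_leq] intro!: le_degree)
  also have "\<dots> = (\<Sum>i\<le>d. \<Sum>j\<le>e. fls_const (coeff (coeff Q j) i) * y ^ j * x ^ i)"
    using Rij by (intro sum.cong refl) (simp add: fls_ev_altdef[OF degR] sum_distrib_right)
  also have "\<dots> = (\<Sum>j\<le>e. \<Sum>i\<le>d. fls_const (coeff (coeff Q j) i) * x ^ i * y ^ j)"
    by (subst sum.swap) (simp add: algebra_simps)
  also have "\<dots> = (\<Sum>j\<le>e. fls_ev x (coeff Q j) * y ^ j)"
    by (intro sum.cong refl) (simp add: fls_ev_altdef[OF d] sum_distrib_right)
  also have "\<dots> = poly (map_poly (fls_ev x) Q) y"
    unfolding poly_altdef e_def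
    by (intro sum.mono_neutral_cong_right)
      (auto simp: coeff_map_poly order_trans[OF map_poly_degree_leq] intro!: le_degree)
  finally show ?thesis using Q(2) \<open>R \<noteq> 0\<close> unfolding alg_dep_def by auto
qed

lemma ratfun_ev_const:
  assumes "fls_deriv u \<noteq> 0"
  shows "ratfun_ev u (Fract [:c:] 1) = fls_const c"
  by (simp add: ratfun_ev_Fract assms fls_ev_pCons)

lemma ratfun_ev_var:
  assumes "fls_deriv u \<noteq> 0"
  shows "ratfun_ev u (Fract [:0, 1:] 1) = u"
  by (simp add: ratfun_ev_Fract assms fls_ev_pCons)

lemma fd_ring_fls_ev:
  assumes u: "fls_deriv u \<noteq> 0" and K: "field_extension.fd_ring (ratfun_ev u) K" and t: "t \<in> K"
  shows "fls_ev t p \<in> K"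
proof -
  interpret A: field_extension "ratfun_ev u" by (rule field_extension_ratfun_ev[OF u])
  have "fls_const c \<in> K" for c using A.fd_ring_emb[OF K] ratfun_ev_const[OF u] by metis
  then show ?thesis unfolding fls_ev_altdef[OF order_refl]
    by (intro A.fd_ring_sum A.fd_ring_mult A.fd_ring_power K t)
qed

text \<open>Multiplying an equation of \<open>x\<close> over C(u) by the product \<open>w\<close> of
  all denominators gives coefficients that are polynomials in \<open>u\<close>.\<close>

lemma fd_ring_alg_dep:
  assumes u: "fls_deriv u \<noteq> 0" and K: "field_extension.fd_ring (ratfun_ev u) K" and x: "x \<in> K"
  shows "alg_dep u x"
proof -
  interpret A: field_extension "ratfun_ev u" by (rule field_extension_ratfun_ev[OF u])
  obtain p where p: "p \<noteq> 0" "\<And>i. coeff p i \<in> range (ratfun_ev u)" "poly p x = 0"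
    using A.fd_ring_algebraic[OF K x] by blast
  have "\<exists>a b. b \<noteq> 0 \<and> coeff p i * fls_ev u b = fls_ev u a" for i
  proof -
    obtain c where c: "coeff p i = ratfun_ev u c" using p(2) by blast
    obtain a b where ab: "c = Fract a b" "b \<noteq> 0" by (cases c) auto
    then have "coeff p i * fls_ev u b = fls_ev u a"
      using c fls_ev_nonzero[OF u ab(2)] by (simp add: ratfun_ev_Fract u)
    then show ?thesis using ab(2) by blast
  qed
  then obtain a b where ab: "\<And>i. b i \<noteq> 0" "\<And>i. coeff p i * fls_ev u (b i) = fls_ev u (a i)" by metis
  define n where "n = degree p"
  define w where "w = (\<Prod>i\<le>n. b i)"
  define Q where "Q = (\<Sum>i\<le>n. monom (a i * (\<Prod>j\<in>{..n}-{i}. b j)) i)"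
  have w: "w \<noteq> 0" using ab(1) by (simp add: w_def)
  have "fls_ev u (coeff Q i) = fls_ev u w * coeff p i" for i
  proof (cases "i \<le> n")
    case True
    then have "coeff Q i = a i * (\<Prod>j\<in>{..n}-{i}. b j)" by (simp add: Q_def coeff_sum)
    moreover have "w = b i * (\<Prod>j\<in>{..n}-{i}. b j)" unfolding w_def using True by (intro prod.remove) auto
    ultimately show ?thesis by (simp add: fls_ev_mult ab(2)[symmetric])
  next
    case False
    then show ?thesis by (simp add: Q_def coeff_sum n_def coeff_eq_0)
  qed
  then have Q: "map_poly (fls_ev u) Q = smult (fls_ev u w) p"
    by (intro poly_eqI) (simp add: coeff_map_poly)
  then have "poly (map_poly (fls_ev u) Q) x = 0" using p(3) by simp
  moreover have "Q \<noteq> 0"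
  proof
    assume "Q = 0"
    then have "smult (fls_ev u w) p = 0" using Q by simp
    then show False using p(1) fls_ev_nonzero[OF u w] by simp
  qed
  ultimately show ?thesis unfolding alg_dep_def by blast
qed

text \<open>Here \<open>t\<close> may differ from the generator \<open>u\<close> of the base field:
  the equation of \<open>x\<close> over C(t) has its coefficients in \<open>K\<close>, and it stays
  nonzero because \<open>t\<close> is not constant.\<close>

lemma fd_ring_adjoin_alg_dep:
  assumes u: "fls_deriv u \<noteq> 0" and K: "field_extension.fd_ring (ratfun_ev u) K"
    and t: "t \<in> K" "fls_deriv t \<noteq> 0" and x: "alg_dep t x"
  shows "\<exists>K'. field_extension.fd_ring (ratfun_ev u) K' \<and> K \<subseteq> K' \<and> x \<in> K'"
proof -
  interpret A: field_extension "ratfun_ev u" by (rule field_extension_ratfun_ev[OF u])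
  obtain Q :: "complex poly poly" where Q: "Q \<noteq> 0" "poly (map_poly (fls_ev t) Q) x = 0"
    using x unfolding alg_dep_def by blast
  show ?thesis
  proof (rule A.fd_ring_adjoin[OF K])
    show "map_poly (fls_ev t) Q \<noteq> 0"
    proof
      assume "map_poly (fls_ev t) Q = 0"
      then have "fls_ev t (lead_coeff Q) = 0" by (metis coeff_0 coeff_map_poly fls_ev_0)
      then show False using fls_ev_nonzero[OF t(2), of "lead_coeff Q"] Q(1) by simp
    qed
    show "coeff (map_poly (fls_ev t) Q) i \<in> K" for i
      by (simp add: coeff_map_poly fd_ring_fls_ev[OF u K t(1)])
  qed (rule Q(2))
qed

lemma fd_ring_adjoin_finite:
  assumes u: "fls_deriv u \<noteq> 0" and K: "field_extension.fd_ring (ratfun_ev u) K"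
    and t: "t \<in> K" "fls_deriv t \<noteq> 0" and S: "finite S" "\<And>x. x \<in> S \<Longrightarrow> alg_dep t x"
  shows "\<exists>K'. field_extension.fd_ring (ratfun_ev u) K' \<and> K \<subseteq> K' \<and> S \<subseteq> K'"
  using S
proof (induction S rule: finite_induct)
  case empty then show ?case using K by blast
next
  case (insert x S)
  then obtain K' where K': "field_extension.fd_ring (ratfun_ev u) K'" "K \<subseteq> K'" "S \<subseteq> K'" by blast
  then obtain K'' where "field_extension.fd_ring (ratfun_ev u) K''" "K' \<subseteq> K''" "x \<in> K''"
    using fd_ring_adjoin_alg_dep[OF u K'(1) _ t(2), of x] t(1) insert.prems by blast
  then show ?case using K' by blast
qed

lemma alg_dep_X_fd_ring:
  assumes "finite S" "\<And>x. x \<in> S \<Longrightarrow> alg_dep fls_X x"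
  shows "\<exists>K. field_extension.fd_ring (ratfun_ev fls_X) K \<and> S \<subseteq> K"
proof -
  have X: "fls_deriv fls_X \<noteq> (0 :: complex fls)" by simp
  interpret A: field_extension "ratfun_ev fls_X" by (rule field_extension_ratfun_ev[OF X])
  have "fls_X \<in> range (ratfun_ev fls_X)" by (metis ratfun_ev_var[OF X] rangeI)
  then show ?thesis using fd_ring_adjoin_finite[OF X A.fd_ring_base _ X assms] by blast
qed

lemma fls_log_deriv_powi:
  fixes f :: "complex fls"
  assumes "f \<noteq> 0"
  shows "fls_deriv (f powi n) / (f powi n) = of_int n * (fls_deriv f / f)"
proof -
  have pw: "fls_deriv (f ^ k) / f ^ k = of_nat k * (fls_deriv f / f)" for k
  proof (induction k)
    case (Suc k)
    have "fls_deriv (f ^ Suc k) / f ^ Suc k = fls_deriv f / f + fls_deriv (f ^ k) / f ^ k"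
      using assms by (simp add: field_simps del: fls_deriv_power)
    then show ?case using Suc by (simp add: algebra_simps add_divide_distrib)
  qed simp
  show ?thesis
  proof (cases "n \<ge> 0")
    case True
    then show ?thesis using pw[of "nat n"] by (simp add: power_int_def)
  next
    case False
    define g where "g = f ^ nat (- n)"
    have g: "g \<noteq> 0" using assms by (simp add: g_def)
    have "fls_deriv (1 / g) / (1 / g) = - (fls_deriv g / g)"
      using g by (simp add: fls_deriv_divide power2_eq_square field_simps)
    also have "\<dots> = of_int n * (fls_deriv f / f)" unfolding g_def pw using False by simp
    finally show ?thesis using False by (simp add: power_int_def g_def field_simps)
  qed
qed

lemma fls_log_deriv_prod:
  fixes f :: "'i \<Rightarrow> complex fls"
  assumes "finite I" "\<And>i. i \<in> I \<Longrightarrow> f i \<noteq> 0"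
  shows "fls_deriv (\<Prod>i\<in>I. f i) / (\<Prod>i\<in>I. f i) = (\<Sum>i\<in>I. fls_deriv (f i) / f i)"
  using assms
proof (induction I rule: finite_induct)
  case (insert a I)
  then have "(\<Prod>i\<in>I. f i) \<noteq> 0" "f a \<noteq> 0" by auto
  then show ?case using insert by (simp add: field_simps)
qed simp

text \<open>The condition on \<open>p\<close> is all that the power series see of the rational
  functional: \<open>p\<close> annihilates every integer vector that \<open>c\<close> annihilates.
  If the product were not constant, the orders of the norms of the \<open>f i\<close> would form
  such a vector on which \<open>p\<close> is positive.\<close>

theorem log_relation_integer:
  fixes f :: "'i \<Rightarrow> complex fls" and c :: "'i \<Rightarrow> real" and p :: "'i \<Rightarrow> int"
  assumes I: "finite I" and f0: "\<And>i. i \<in> I \<Longrightarrow> f i \<noteq> 0" and alg: "\<And>i. i \<in> I \<Longrightarrow> alg_dep fls_X (f i)"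
    and rel: "(\<Sum>i\<in>I. fls_const (of_real (c i)) * (fls_deriv (f i) / f i)) = 0"
    and p: "\<And>k :: 'i \<Rightarrow> int. (\<Sum>i\<in>I. c i * of_int (k i)) = 0 \<Longrightarrow> (\<Sum>i\<in>I. p i * k i) = 0"
  shows "fls_deriv (\<Prod>i\<in>I. f i powi p i) = 0"
proof (rule ccontr)
  define u where "u = (\<Prod>i\<in>I. f i powi p i)"
  assume "fls_deriv (\<Prod>i\<in>I. f i powi p i) \<noteq> 0"
  then have u: "fls_deriv u \<noteq> 0" by (simp add: u_def)
  then have u0: "u \<noteq> 0" by auto
  have X: "fls_deriv fls_X \<noteq> (0 :: complex fls)" by simp
  interpret A: field_extension_deriv "ratfun_ev u" "\<lambda>x. fls_deriv x / fls_deriv u"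
    by (rule field_extension_deriv_ratfun_ev[OF u])
  interpret X: field_extension "ratfun_ev fls_X" by (rule field_extension_ratfun_ev[OF X])
  \<comment> \<open>All \<open>f i\<close>, hence \<open>u\<close>, are algebraic over C(X). As
    \<open>u\<close> is not constant, X is algebraic over C(u) in turn, and one finite extension
    \<open>K\<close> of C(u) contains all the \<open>f i\<close>.\<close>
  obtain K0 where K0: "X.fd_ring K0" "f ` I \<subseteq> K0"
    using alg_dep_X_fd_ring[of "f ` I"] I alg by blast
  have "f i powi p i \<in> K0" if "i \<in> I" for i
    using K0 that by (auto simp: power_int_def intro!: X.fd_ring_power X.fd_ring_inverse)
  then have "u \<in> K0" unfolding u_def by (intro X.fd_ring_prod[OF K0(1)])
  then have uX: "alg_dep u fls_X" using fd_ring_alg_dep[OF X K0(1)] alg_dep_swap by blast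
  have "u \<in> range (ratfun_ev u)" by (metis ratfun_ev_var[OF u] rangeI)
  then obtain K1 where K1: "A.fd_ring K1" "fls_X \<in> K1" "u \<in> K1"
    using fd_ring_adjoin_alg_dep[OF u A.fd_ring_base _ u uX] by blast
  obtain K where K: "A.fd_ring K" "f ` I \<subseteq> K" "u \<in> K"
    using fd_ring_adjoin_finite[OF u K1(1,2) X, of "f ` I"] I alg K1(3) by blast
  obtain T M where T: "M > 0" "T 1 = of_nat M"
    and T_add: "\<And>x y. x \<in> K \<Longrightarrow> y \<in> K \<Longrightarrow> T (x + y) = T x + T y"
    and T_scale: "\<And>c x. x \<in> K \<Longrightarrow> T (ratfun_ev u c * x) = c * T x"
    and T_log: "\<And>f. f \<in> K \<Longrightarrow> f \<noteq> 0 \<Longrightarrow> \<exists>d. d \<noteq> 0 \<and>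
       ratfun_ev u (T (fls_deriv f / fls_deriv u / f)) = fls_deriv (ratfun_ev u d) / fls_deriv u / ratfun_ev u d"
    by (rule A.trace_log_deriv[OF K(1)]) blast
  have T0: "T 0 = 0" using T_scale[OF A.fd_ring_one[OF K(1)], of 0] by (simp add: A.emb_zero)
  define g where "g = (\<lambda>i. fls_deriv (f i) / fls_deriv u / f i)"
  have gK: "g i \<in> K" if "i \<in> I" for i
    unfolding g_def using that K by (intro A.fd_ring_divide A.fd_ring_deriv) auto
  have T_sum: "T (\<Sum>i\<in>J. ratfun_ev u (e i) * g i) = (\<Sum>i\<in>J. e i * T (g i))" if "finite J" "J \<subseteq> I" for J e
    using that
  proof (induction J rule: finite_induct)
    case (insert a J)
    have "(\<Sum>i\<in>J. ratfun_ev u (e i) * g i) \<in> K" "ratfun_ev u (e a) * g a \<in> K"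
      using insert.prems gK K(1)
      by (auto intro!: A.fd_ring_sum A.fd_ring_mult A.fd_ring_emb)
    then show ?case using insert gK by (simp add: T_add T_scale)
  qed (simp add: T0)
  have "\<forall>i\<in>I. \<exists>d. d \<noteq> 0 \<and> ratfun_ev u (T (g i)) = fls_deriv (ratfun_ev u d) / fls_deriv u / ratfun_ev u d"
    unfolding g_def using T_log f0 K(2) by blast
  then obtain d where d: "\<And>i. i \<in> I \<Longrightarrow> d i \<noteq> 0"
    "\<And>i. i \<in> I \<Longrightarrow> ratfun_ev u (T (g i)) = fls_deriv (ratfun_ev u (d i)) / fls_deriv u / ratfun_ev u (d i)"
    by metis
  \<comment> \<open>The order at u = 0 of \<open>d i\<close>, which plays the part of the norm of
    \<open>f i\<close>.\<close>
  define k where "k = (\<lambda>i. fls_subdegree (ratfun_ev fls_X (d i)))"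
  have res: "fls_residue (ratfun_ev fls_X (T (g i))) = of_int (k i)" if "i \<in> I" for i
    unfolding k_def using log_deriv_residue[OF u d(1)[OF that] d(2)[OF that]] .
  have res_sum: "fls_residue (ratfun_ev fls_X (\<Sum>i\<in>I. Fract [:e i:] 1 * T (g i))) = (\<Sum>i\<in>I. e i * of_int (k i))" for e
  proof -
    have rs: "fls_residue (\<Sum>i\<in>J. h i) = (\<Sum>i\<in>J. fls_residue (h i))" for h :: "'i \<Rightarrow> complex fls" and J
      by (induction J rule: infinite_finite_induct) (auto simp: fls_residue_add)
    show ?thesis
      unfolding X.emb_sum X.emb_mult ratfun_ev_const[OF X] rs
      by (intro sum.cong refl) (simp only: fls_residue_fls_const_times res)
  qed
  \<comment> \<open>Divided by \<open>fls_deriv u\<close>, the relation is linear in the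
    \<open>g i\<close> with constant coefficients; trace and residue turn it into sum c_i k_i =
    0.\<close>
  have "(\<Sum>i\<in>I. ratfun_ev u (Fract [:of_real (c i):] 1) * g i)
      = (\<Sum>i\<in>I. fls_const (of_real (c i)) * (fls_deriv (f i) / f i)) / fls_deriv u"
    unfolding ratfun_ev_const[OF u] g_def sum_divide_distrib by (intro sum.cong refl) (simp add: field_simps)
  also have "\<dots> = 0" unfolding rel by simp
  finally have "(\<Sum>i\<in>I. Fract [:of_real (c i):] 1 * T (g i)) = 0" using T_sum[OF I order_refl] T0 by metis
  then have "(\<Sum>i\<in>I. of_real (c i) * of_int (k i) :: complex) = 0"
    using res_sum[of "\<lambda>i. of_real (c i)"] by (simp add: X.emb_zero)
  then have "of_real (\<Sum>i\<in>I. c i * of_int (k i)) = (0::complex)" by simp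
  then have "(\<Sum>i\<in>I. c i * of_int (k i)) = 0" unfolding of_real_eq_0_iff .
  then have pk: "(\<Sum>i\<in>I. p i * k i) = 0" by (rule p)
  \<comment> \<open>The combination of the \<open>g i\<close> with coefficients \<open>p i\<close>
    is the logarithmic derivative of \<open>u\<close> with respect to \<open>u\<close>, that is,
    1/u. Its trace is M/u, with residue \<open>M\<close>.\<close>
  have "fls_deriv u / u = (\<Sum>i\<in>I. of_int (p i) * (fls_deriv (f i) / f i))"
    unfolding u_def using f0 by (subst fls_log_deriv_prod[OF I]) (auto simp: fls_log_deriv_powi intro!: sum.cong)
  then have "fls_deriv u / u / fls_deriv u = (\<Sum>i\<in>I. ratfun_ev u (Fract [:of_int (p i):] 1) * g i)"
    unfolding ratfun_ev_const[OF u] g_def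
    by (simp add: sum_divide_distrib fls_of_int field_simps)
  then have "(\<Sum>i\<in>I. ratfun_ev u (Fract [:of_int (p i):] 1) * g i) = inverse u"
    using u by (simp add: field_simps)
  also have "\<dots> = ratfun_ev u (Fract 1 [:0,1:]) * 1"
    using u0 by (simp add: ratfun_ev_Fract u fls_ev_pCons inverse_eq_divide)
  finally have "T (\<Sum>i\<in>I. ratfun_ev u (Fract [:of_int (p i):] 1) * g i) = Fract 1 [:0,1:] * of_nat M"
    using T_scale[OF A.fd_ring_one[OF K(1)]] T(2) by simp
  then have "(\<Sum>i\<in>I. Fract [:of_int (p i):] 1 * T (g i)) = Fract 1 [:0,1:] * of_nat M"
    using T_sum[OF I order_refl] by metis
  then have "fls_residue (ratfun_ev fls_X (Fract 1 [:0,1:] * of_nat M)) = of_int (\<Sum>i\<in>I. p i * k i)"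
    using res_sum[of "\<lambda>i. of_int (p i)"] by simp
  also have "ratfun_ev fls_X (Fract 1 [:0,1:] * of_nat M) = of_nat M * fls_X_inv"
    by (simp add: X.emb_mult X.emb_of_nat ratfun_ev_Fract fls_ev_pCons fls_inverse_X divide_inverse)
  also have "fls_residue (of_nat M * fls_X_inv :: complex fls) = of_nat M"
    by (simp add: fls_of_nat fls_residue_fls_const_times)
  finally show False using pk T(1) by simp
qed

text \<open>Both series lie in one finite extension of C(X), a ring all of whose elements are
  algebraic.\<close>

lemma alg_dep_X_closed:
  assumes "alg_dep fls_X x" "alg_dep fls_X y"
  shows "alg_dep fls_X (x + y)" "alg_dep fls_X (x * y)"
proof -
  have X: "fls_deriv fls_X \<noteq> (0 :: complex fls)" by simp
  interpret A: field_extension "ratfun_ev fls_X" by (rule field_extension_ratfun_ev[OF X])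
  obtain K where K: "A.fd_ring K" "{x, y} \<subseteq> K"
    using alg_dep_X_fd_ring[of "{x, y}"] assms by blast
  show "alg_dep fls_X (x + y)" "alg_dep fls_X (x * y)"
    using K by (auto intro!: fd_ring_alg_dep[OF X K(1)] A.fd_ring_add A.fd_ring_mult)
qed

text \<open>Several indices may carry the same pair of exponents, so nonzero coefficients could
  cancel in \<open>Q\<close>. A nonzero value at the point with first coordinate 1 and second
  coordinate \<open>w\<close> certifies that \<open>Q\<close> is nonzero.\<close>

lemma alg_dep_relation:
  assumes "(\<Sum>a\<in>A. fls_const (co a) * x ^ d a * y ^ e a) = 0"
    and "(\<Sum>a\<in>A. co a * w ^ e a) \<noteq> 0"
  shows "alg_dep x y"
proof -
  define Q where "Q = (\<Sum>a\<in>A. monom (monom (co a) (d a)) (e a))"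
  have "poly (poly Q [:w:]) 1 = (\<Sum>a\<in>A. co a * w ^ e a)"
    unfolding Q_def by (simp add: poly_sum poly_monom poly_power)
  then have "Q \<noteq> 0" using assms(2) by auto
  have fls_ev_monom: "fls_ev x (monom c k) = fls_const c * x ^ k" for c k
    unfolding fls_ev_def by (simp add: map_poly_monom poly_monom)
  have "map_poly (fls_ev x) Q = (\<Sum>a\<in>A. monom (fls_const (co a) * x ^ d a) (e a))"
  proof (rule poly_eqI)
    fix k
    have sum: "fls_ev x (sum f A) = (\<Sum>a\<in>A. fls_ev x (f a))" for f
      by (induction A rule: infinite_finite_induct) (simp_all add: fls_ev_add)
    show "coeff (map_poly (fls_ev x) Q) k = coeff (\<Sum>a\<in>A. monom (fls_const (co a) * x ^ d a) (e a)) k"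
      by (simp add: coeff_map_poly Q_def coeff_sum sum coeff_monom if_distrib fls_ev_monom cong: if_cong)
  qed
  then have "poly (map_poly (fls_ev x) Q) y = (\<Sum>a\<in>A. fls_const (co a) * x ^ d a * y ^ e a)"
    by (simp add: poly_sum poly_monom)
  then show ?thesis using assms(1) \<open>Q \<noteq> 0\<close> unfolding alg_dep_def by auto
qed

lemma alg_dep_X_const: "alg_dep fls_X (fls_const c)"
  by (rule alg_dep_relation[where A = "{False,True}" and co = "\<lambda>b. if b then 1 else - c" and d = "\<lambda>_. 0"
      and e = "\<lambda>b. if b then 1 else 0" and w = "c + 1"])
    simp_all

lemma alg_dep_X_X: "alg_dep fls_X fls_X"
  by (rule alg_dep_relation[where A = "{False,True}" and co = "\<lambda>b. if b then 1 else - 1" and d = "\<lambda>b. if b then 0 else 1"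
      and e = "\<lambda>b. if b then 1 else 0" and w = 2])
    simp_all

lemma alg_dep_X_sum: "(\<And>i. i \<in> A \<Longrightarrow> alg_dep fls_X (f i)) \<Longrightarrow> alg_dep fls_X (sum f A)"
  using alg_dep_X_const[of 0]
  by (induction A rule: infinite_finite_induct) (auto intro: alg_dep_X_closed)

lemma alg_dep_X_power: "alg_dep fls_X x \<Longrightarrow> alg_dep fls_X (x ^ k)"
  using alg_dep_X_const[of 1] by (induction k) (auto intro: alg_dep_X_closed)

section \<open>Unique factorization of multivariate polynomials\<close>

definition polys_over :: "'a::zero set \<Rightarrow> 'a poly set" where
  "polys_over S = {P. \<forall>i. coeff P i \<in> S}"

text \<open>The induction on the number of variables takes place inside one type, hence a subset
  \<open>S\<close> as ring of coefficients. Closure under divisors lets units and factorizations be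
  those of the ambient ring, and the additive size \<open>\<mu>\<close> makes factorizations
  stop.\<close>

locale factorial_subring =
  fixes S :: "'a::idom set" and \<mu> :: "'a \<Rightarrow> nat"
  assumes one: "1 \<in> S"
    and diff: "a \<in> S \<Longrightarrow> b \<in> S \<Longrightarrow> a - b \<in> S"
    and mult: "a \<in> S \<Longrightarrow> b \<in> S \<Longrightarrow> a * b \<in> S"
    and divisor: "a * b \<in> S \<Longrightarrow> a * b \<noteq> 0 \<Longrightarrow> a \<in> S"
    and size_mult: "a * b \<noteq> 0 \<Longrightarrow> \<mu> (a * b) = \<mu> a + \<mu> b"
    and size_0: "a \<in> S \<Longrightarrow> a \<noteq> 0 \<Longrightarrow> \<mu> a = 0 \<Longrightarrow> a dvd 1"
    and irreducible_prime: "\<pi> \<in> S \<Longrightarrow> irreducible \<pi> \<Longrightarrow> a \<in> S \<Longrightarrow> b \<in> S \<Longrightarrow> \<pi> dvd a * b \<Longrightarrow> \<pi> dvd a \<or> \<pi> dvd b"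
begin

lemma zero: "0 \<in> S"
  using diff[OF one one] by simp

lemma add: "a \<in> S \<Longrightarrow> b \<in> S \<Longrightarrow> a + b \<in> S"
  using diff[of a "0 - b"] diff[OF zero, of b] by simp

lemma sum_mem: "(\<And>i. i \<in> A \<Longrightarrow> f i \<in> S) \<Longrightarrow> sum f A \<in> S"
  by (induction A rule: infinite_finite_induct) (auto intro: zero add)

lemma divisor': "a * b \<in> S \<Longrightarrow> a * b \<noteq> 0 \<Longrightarrow> b \<in> S"
  using divisor[of b a] by (simp add: mult.commute)

abbreviation "PS \<equiv> polys_over S"

lemma PS_coeff: "P \<in> PS \<Longrightarrow> coeff P i \<in> S"
  by (simp add: polys_over_def)

lemma PS_0: "0 \<in> PS"
  by (simp add: polys_over_def zero)

lemma PS_1: "1 \<in> PS"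
  by (simp add: polys_over_def zero one)

lemma PS_add: "P \<in> PS \<Longrightarrow> Q \<in> PS \<Longrightarrow> P + Q \<in> PS"
  by (simp add: polys_over_def add)

lemma PS_diff: "P \<in> PS \<Longrightarrow> Q \<in> PS \<Longrightarrow> P - Q \<in> PS"
  by (simp add: polys_over_def diff)

lemma PS_mult: "P \<in> PS \<Longrightarrow> Q \<in> PS \<Longrightarrow> P * Q \<in> PS"
  by (auto simp: polys_over_def coeff_mult intro!: sum_mem mult)

lemma PS_smult: "c \<in> S \<Longrightarrow> P \<in> PS \<Longrightarrow> smult c P \<in> PS"
  by (simp add: polys_over_def mult)

lemma PS_monom: "c \<in> S \<Longrightarrow> monom c k \<in> PS"
  by (simp add: polys_over_def zero)

lemma PS_smult_cancel:
  assumes "smult c P \<in> PS" "c \<noteq> 0"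
  shows "P \<in> PS"
proof -
  have "coeff P i \<in> S" for i
    using assms divisor'[of c "coeff P i"] zero by (cases "coeff P i = 0") (auto simp: polys_over_def)
  then show ?thesis by (simp add: polys_over_def)
qed

lemma unit_inverse:
  assumes "a dvd 1"
  obtains b where "b \<in> S" "a * b = 1"
proof -
  obtain b where "1 = a * b" using assms by (auto elim: dvdE)
  then show ?thesis using that[of b] divisor'[of a b] one by simp
qed

lemma exists_irreducible_divisor:
  assumes "a \<in> S" "a \<noteq> 0" "\<not> a dvd 1"
  shows "\<exists>\<pi> b. \<pi> \<in> S \<and> b \<in> S \<and> irreducible \<pi> \<and> a = \<pi> * b"
  using assms
proof (induction "\<mu> a" arbitrary: a rule: less_induct)
  case less
  show ?case
  proof (cases "irreducible a")
    case True
    then show ?thesis using less.prems one by (intro exI[of _ a] exI[of _ 1]) auto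
  next
    case False
    then obtain b c where bc: "a = b * c" "\<not> b dvd 1" "\<not> c dvd 1"
      using less.prems by (auto simp: irreducible_def)
    have S: "b \<in> S" "c \<in> S" using divisor[of b c] divisor'[of b c] bc less.prems by auto
    have "\<mu> c \<noteq> 0" using size_0[OF S(2)] bc less.prems by auto
    then have "\<mu> b < \<mu> a" using size_mult[of b c] bc less.prems by simp
    then obtain \<pi> d where "\<pi> \<in> S" "d \<in> S" "irreducible \<pi>" "b = \<pi> * d"
      using less.hyps[of b] S bc less.prems by auto
    then show ?thesis using bc(1) S(2)
      by (intro exI[of _ \<pi>] exI[of _ "d * c"]) (auto intro: mult simp: mult.assoc)
  qed
qed

text \<open>Gauss's lemma: let \<open>i\<close> and \<open>j\<close> be the lowest coefficients of
  \<open>P\<close> and \<open>Q\<close> not divisible by \<open>\<pi>\<close>. In coefficient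
  \<open>i + j\<close> of the product, every term but one is divisible by
  \<open>\<pi>\<close>.\<close>

lemma gauss_irreducible:
  assumes \<pi>: "\<pi> \<in> S" "irreducible \<pi>" and PQ: "P \<in> PS" "Q \<in> PS" and dvd: "[:\<pi>:] dvd P * Q"
  shows "[:\<pi>:] dvd P \<or> [:\<pi>:] dvd Q"
proof (rule ccontr)
  assume "\<not> ?thesis"
  then have ex: "\<exists>i. \<not> \<pi> dvd coeff P i" "\<exists>i. \<not> \<pi> dvd coeff Q i" by (auto simp: const_poly_dvd_iff)
  define i where "i = (LEAST i. \<not> \<pi> dvd coeff P i)"
  define j where "j = (LEAST i. \<not> \<pi> dvd coeff Q i)"
  have i: "\<not> \<pi> dvd coeff P i" and i': "\<And>k. k < i \<Longrightarrow> \<pi> dvd coeff P k"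
    unfolding i_def using LeastI_ex[OF ex(1)] not_less_Least by blast+
  have j: "\<not> \<pi> dvd coeff Q j" and j': "\<And>k. k < j \<Longrightarrow> \<pi> dvd coeff Q k"
    unfolding j_def using LeastI_ex[OF ex(2)] not_less_Least by blast+
  have "coeff (P * Q) (i + j) = (\<Sum>k\<le>i + j. coeff P k * coeff Q (i + j - k))" by (simp add: coeff_mult)
  also have "\<dots> = coeff P i * coeff Q j + (\<Sum>k\<in>{..i + j} - {i}. coeff P k * coeff Q (i + j - k))"
    by (subst sum.remove[of _ i]) auto
  finally have "coeff P i * coeff Q j
    = coeff (P * Q) (i + j) - (\<Sum>k\<in>{..i + j} - {i}. coeff P k * coeff Q (i + j - k))" by simp
  moreover have "\<pi> dvd coeff (P * Q) (i + j)" using dvd by (simp add: const_poly_dvd_iff)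
  moreover have "\<pi> dvd (\<Sum>k\<in>{..i + j} - {i}. coeff P k * coeff Q (i + j - k))"
  proof (rule dvd_sum)
    fix k assume "k \<in> {..i + j} - {i}"
    then consider "k < i" | "i + j - k < j" by force
    then show "\<pi> dvd coeff P k * coeff Q (i + j - k)" using i' j' by cases auto
  qed
  ultimately have "\<pi> dvd coeff P i * coeff Q j" by simp
  then show False using irreducible_prime[OF \<pi>] PQ PS_coeff i j by blast
qed

definition primitive :: "'a poly \<Rightarrow> bool" where
  "primitive P \<longleftrightarrow> (\<forall>\<pi>\<in>S. irreducible \<pi> \<longrightarrow> \<not> [:\<pi>:] dvd P)"

lemma const_dvd_smult:
  assumes "P \<in> PS" "[:c:] dvd P" "c \<noteq> 0"
  obtains Q where "Q \<in> PS" "P = smult c Q"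
proof -
  obtain Q where "P = smult c Q" using assms(2) by (auto elim: dvdE)
  then show ?thesis using that PS_smult_cancel assms by blast
qed

text \<open>The irreducible factors of \<open>c\<close> are cancelled one at a time: each divides
  \<open>H * B\<close>, hence \<open>B\<close>, since \<open>H\<close> is primitive.\<close>

lemma primitive_cancel:
  assumes H: "H \<in> PS" "primitive H" and c: "c \<in> S" "c \<noteq> 0"
    and AB: "A \<in> PS" "B \<in> PS" and eq: "smult c A = H * B"
  shows "\<exists>B'\<in>PS. A = H * B'"
  using c AB eq
proof (induction "\<mu> c" arbitrary: c B rule: less_induct)
  case less
  show ?case
  proof (cases "c dvd 1")
    case True
    then obtain d where d: "d \<in> S" "c * d = 1" by (rule unit_inverse)
    have "A = smult d (smult c A)" using d(2) by (simp add: mult.commute)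
    also have "\<dots> = H * smult d B" unfolding less.prems by simp
    finally show ?thesis using PS_smult[OF d(1) less.prems(4)] by blast
  next
    case False
    then obtain \<pi> e where e: "\<pi> \<in> S" "e \<in> S" "irreducible \<pi>" "c = \<pi> * e"
      using exists_irreducible_divisor less.prems by blast
    then have \<pi>0: "\<pi> \<noteq> 0" "e \<noteq> 0" using less.prems by auto
    have "smult \<pi> (smult e A) = H * B" using less.prems(5) by (simp add: e(4))
    then have "H * B = [:\<pi>:] * smult e A" by (simp add: mult.commute)
    then have "[:\<pi>:] dvd H * B" by (rule dvdI)
    then have "[:\<pi>:] dvd B" using gauss_irreducible[OF e(1,3) H(1) less.prems(4)] H(2) e unfolding primitive_def by blast
    then obtain B1 where B1: "B1 \<in> PS" "B = smult \<pi> B1"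
      using const_dvd_smult[OF less.prems(4) _ \<pi>0(1)] by blast
    have "smult \<pi> (smult e A) = smult \<pi> (H * B1)"
      using less.prems(5) by (simp add: e(4) B1(2))
    then have "smult e A = H * B1" using \<pi>0(1) by (metis smult_cancel)
    moreover have "\<mu> \<pi> \<noteq> 0" using size_0[OF e(1) \<pi>0(1)] e(3) by (auto simp: irreducible_def)
    then have "\<mu> e < \<mu> c" using size_mult[of \<pi> e] \<pi>0 e(4) by simp
    ultimately show ?thesis using less.hyps[of e B1] e \<pi>0 B1(1) less.prems(3) by blast
  qed
qed

text \<open>Each irreducible constant split off lowers the size of the leading coefficient.\<close>

lemma primitive_part:
  assumes "D \<in> PS" "D \<noteq> 0"
  shows "\<exists>e D0. e \<in> S \<and> e \<noteq> 0 \<and> D0 \<in> PS \<and> primitive D0 \<and> D = smult e D0"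
  using assms
proof (induction "\<mu> (lead_coeff D)" arbitrary: D rule: less_induct)
  case less
  show ?case
  proof (cases "primitive D")
    case True
    then show ?thesis using less.prems one by (intro exI[of _ 1] exI[of _ D]) auto
  next
    case False
    then obtain \<pi> where \<pi>: "\<pi> \<in> S" "irreducible \<pi>" "[:\<pi>:] dvd D" unfolding primitive_def by blast
    then have \<pi>0: "\<pi> \<noteq> 0" by auto
    obtain D1 where D1: "D1 \<in> PS" "D = smult \<pi> D1" using const_dvd_smult[OF less.prems(1) \<pi>(3) \<pi>0] .
    have "D1 \<noteq> 0" using D1 less.prems(2) by auto
    have "\<mu> \<pi> \<noteq> 0" using size_0[OF \<pi>(1) \<pi>0] \<pi>(2) by (auto simp: irreducible_def)
    then have "\<mu> (lead_coeff D1) < \<mu> (lead_coeff D)"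
      using size_mult[of \<pi> "lead_coeff D1"] \<pi>0 \<open>D1 \<noteq> 0\<close> by (simp add: D1(2))
    then obtain e D0 where "e \<in> S" "e \<noteq> 0" "D0 \<in> PS" "primitive D0" "D1 = smult e D0"
      using less.hyps D1(1) \<open>D1 \<noteq> 0\<close> by blast
    then show ?thesis using D1(2) \<pi> \<pi>0
      by (intro exI[of _ "\<pi> * e"] exI[of _ D0]) (auto intro: mult)
  qed
qed

text \<open>Ordinary division, except that each step first multiplies by the leading coefficient of
  \<open>D\<close>, so that no fractions arise.\<close>

lemma pseudo_division:
  assumes "E \<in> PS" "D \<in> PS" "D \<noteq> 0"
  shows "\<exists>c Q. c \<in> S \<and> c \<noteq> 0 \<and> Q \<in> PS \<and>
    (smult c E - D * Q = 0 \<or> degree (smult c E - D * Q) < degree D)"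
  using assms(1)
proof (induction "degree E" arbitrary: E rule: less_induct)
  case less
  show ?case
  proof (cases "degree E < degree D \<or> E = 0")
    case True
    then show ?thesis using one PS_0 by (intro exI[of _ 1] exI[of _ 0]) auto
  next
    case False
    define M where "M = monom (lead_coeff E) (degree E - degree D)"
    define E' where "E' = smult (lead_coeff D) E - D * M"
    have MPS: "M \<in> PS" unfolding M_def using less.prems by (intro PS_monom PS_coeff)
    have E': "E' \<in> PS" unfolding E'_def using MPS less.prems assms by (intro PS_diff PS_smult PS_mult PS_coeff)
    have l: "lead_coeff D \<in> S" "lead_coeff D \<noteq> 0" using assms PS_coeff by auto
    show ?thesis
    proof (cases "E' = 0")
      case True
      then show ?thesis using l MPS unfolding E'_def by blast
    next
      case nz: False
      have M: "degree M = degree E - degree D" "lead_coeff M = lead_coeff E" "M \<noteq> 0"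
        using False unfolding M_def by (simp_all add: degree_monom_eq)
      have "degree (D * M) = degree E"
        using False M assms(3) by (simp add: degree_mult_eq)
      moreover have "lead_coeff (D * M) = lead_coeff D * lead_coeff E"
        by (simp only: lead_coeff_mult M(2))
      ultimately have c0: "coeff E' (degree E) = 0" unfolding E'_def by simp
      have "degree E' \<le> degree E"
        unfolding E'_def using \<open>degree (D * M) = degree E\<close> by (intro degree_diff_le) auto
      then have "degree E' < degree E"
        using c0 nz by (metis le_neq_implies_less leading_coeff_0_iff)
      then obtain c Q where c: "c \<in> S" "c \<noteq> 0" "Q \<in> PS"
        "smult c E' - D * Q = 0 \<or> degree (smult c E' - D * Q) < degree D"
        using less.hyps E' by blast
      have eq: "smult c E' - D * Q = smult (c * lead_coeff D) E - D * (smult c M + Q)"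
        by (simp add: E'_def smult_diff_right algebra_simps)
      show ?thesis
        using c l MPS eq
        by (intro exI[of _ "c * lead_coeff D"] exI[of _ "smult c M + Q"])
          (auto intro: mult PS_add PS_smult)
    qed
  qed
qed

text \<open>No fraction field is needed: an element of minimal degree in the ideal generated by \<open>H\<close> and
  \<open>F\<close> has a primitive part that divides both.\<close>

theorem irreducible_prime_polys_over:
  assumes H: "H \<in> PS" "degree H > 0"
    and irr: "\<And>A B. A \<in> PS \<Longrightarrow> B \<in> PS \<Longrightarrow> H = A * B \<Longrightarrow> A dvd 1 \<or> B dvd 1"
    and FGY: "F \<in> PS" "G \<in> PS" "Y \<in> PS" and eq: "F * G = H * Y"
  shows "H dvd F \<or> H dvd G"
proof -
  have Hprim: "primitive H" unfolding primitive_def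
  proof (intro ballI impI notI)
    fix \<pi> assume \<pi>: "\<pi> \<in> S" "irreducible \<pi>" "[:\<pi>:] dvd H"
    then have \<pi>0: "\<pi> \<noteq> 0" by auto
    obtain A where A: "A \<in> PS" "H = smult \<pi> A" using const_dvd_smult[OF H(1) \<pi>(3) \<pi>0] .
    have "[:\<pi>:] \<in> PS" using PS_smult[OF \<pi>(1) PS_1] by simp
    moreover have "H = [:\<pi>:] * A" using A(2) by simp
    ultimately consider "[:\<pi>:] dvd 1" | "A dvd 1" using irr A(1) by blast
    then show False
    proof cases
      case 1
      then show False using \<pi>(2) by (simp add: irreducible_def is_unit_const_poly_iff)
    next
      case 2
      then have "degree A = 0" by (auto simp: is_unit_poly_iff)
      then have "degree H \<le> 0" unfolding A(2) using degree_smult_le[of \<pi> A] by (metis order_trans order_refl)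
      then show False using H(2) by simp
    qed
  qed
  define I where "I = {A * H + B * F | A B. A \<in> PS \<and> B \<in> PS}"
  have IPS: "I \<subseteq> PS" unfolding I_def using H FGY by (auto intro: PS_add PS_mult)
  have HI: "H \<in> I" unfolding I_def using PS_0 PS_1 by (intro CollectI exI[of _ 1] exI[of _ 0]) simp
  have FI: "F \<in> I" unfolding I_def using PS_0 PS_1 by (intro CollectI exI[of _ 0] exI[of _ 1]) simp
  have "H \<noteq> 0" using H(2) by auto
  then obtain D where D: "D \<in> I" "D \<noteq> 0" and min: "\<And>E. E \<in> I \<Longrightarrow> E \<noteq> 0 \<Longrightarrow> degree D \<le> degree E"
    using ex_has_least_nat[of "\<lambda>D. D \<in> I \<and> D \<noteq> 0" H degree] HI by blast
  have DPS: "D \<in> PS" using D IPS by blast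
  obtain A B where AB: "A \<in> PS" "B \<in> PS" "D = A * H + B * F" using D unfolding I_def by blast
  \<comment> \<open>A pseudo-remainder of an element of \<open>I\<close> lies in \<open>I\<close>
    and has smaller degree than \<open>D\<close>, so it is 0. Thus \<open>D\<close> divides every
    element up to a constant factor, and its primitive part divides it outright.\<close>
  have div: "\<exists>c Q. c \<in> S \<and> c \<noteq> 0 \<and> Q \<in> PS \<and> smult c E = D * Q" if E: "E \<in> I" for E
  proof -
    have EPS: "E \<in> PS" using E IPS by (rule subsetD[rotated])
    from pseudo_division[OF EPS DPS D(2)] obtain c Q where c: "c \<in> S" "c \<noteq> 0" "Q \<in> PS"
      "smult c E - D * Q = 0 \<or> degree (smult c E - D * Q) < degree D"
      by (elim exE conjE)
    obtain A' B' where E': "A' \<in> PS" "B' \<in> PS" "E = A' * H + B' * F" using E unfolding I_def by blast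
    have "smult c E - D * Q = (smult c A' - A * Q) * H + (smult c B' - B * Q) * F"
      by (simp add: E'(3) AB(3) algebra_simps smult_add_right)
    moreover have "smult c A' - A * Q \<in> PS" "smult c B' - B * Q \<in> PS"
      using c E' AB by (auto intro: PS_diff PS_mult PS_smult)
    ultimately have "smult c E - D * Q \<in> I" unfolding I_def by blast
    then have "smult c E - D * Q = 0" using c(4) min[of "smult c E - D * Q"] by linarith
    then show ?thesis using c by auto
  qed
  obtain e D0 where e: "e \<in> S" "e \<noteq> 0" "D0 \<in> PS" "primitive D0" "D = smult e D0"
    using primitive_part[OF DPS D(2)] by blast
  have div0: "\<exists>Q\<in>PS. E = D0 * Q" if E: "E \<in> I" for E
  proof -
    obtain c Q where c: "c \<in> S" "c \<noteq> 0" "Q \<in> PS" "smult c E = D * Q" using div[OF E] by blast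
    have "smult c E = D0 * smult e Q" using c(4) e(5) by simp
    then show ?thesis using primitive_cancel[OF e(3,4) c(1,2)] E IPS PS_smult[OF e(1) c(3)] by blast
  qed
  obtain Q1 where Q1: "Q1 \<in> PS" "H = D0 * Q1" using div0[OF HI] by blast
  obtain Q2 where Q2: "Q2 \<in> PS" "F = D0 * Q2" using div0[OF FI] by blast
  \<comment> \<open>If \<open>Q1\<close> is a unit, \<open>H\<close> divides \<open>D0\<close> and
    hence \<open>F\<close>. If \<open>D0\<close> is a unit, multiply
    \<open>D = A * H + B * F\<close> by \<open>G\<close>: both terms on the right are multiples of
    \<open>H\<close>, and cancelling the constant \<open>e\<close> shows that \<open>H\<close>
    divides \<open>G\<close>.\<close>
  from irr[OF e(3) Q1] show ?thesis
  proof
    assume "Q1 dvd 1"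
    then obtain R where R: "1 = Q1 * R" by (rule dvdE)
    have "D0 = D0 * (Q1 * R)" by (simp only: R[symmetric] mult_1_right)
    also have "\<dots> = H * R" by (simp only: Q1(2) mult.assoc)
    finally have "H dvd D0" by (rule dvdI)
    then show ?thesis unfolding Q2(2) by (intro disjI1 dvd_mult2)
  next
    assume unit: "D0 dvd 1"
    have "smult e (D0 * G) = H * (A * G + B * Y)"
    proof -
      have "smult e (D0 * G) = D * G" by (simp add: e(5))
      also have "\<dots> = A * H * G + B * (F * G)" unfolding AB(3) by (simp add: algebra_simps)
      also have "\<dots> = H * (A * G + B * Y)" unfolding eq by (simp add: algebra_simps)
      finally show ?thesis .
    qed
    then have "H dvd D0 * G"
      using primitive_cancel[OF H(1) Hprim e(1,2)] AB FGY e(3) by (metis PS_add PS_mult dvdI)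
    moreover obtain R where R: "1 = D0 * R" using unit by (rule dvdE)
    moreover have "G = D0 * G * R"
      by (simp only: mult.commute[of D0 G] mult.assoc R[symmetric] mult_1_right)
    ultimately show ?thesis by (metis dvd_mult2)
  qed
qed

end

section \<open>Evaluation of multivariate polynomials\<close>

definition mono_eval :: "(nat \<Rightarrow>\<^sub>0 nat) \<Rightarrow> (nat \<Rightarrow> complex) \<Rightarrow> complex" where
  "mono_eval a x = (\<Prod>i\<in>Poly_Mapping.keys a. x i ^ Poly_Mapping.lookup a i)"

lemma mono_eval_superset:
  assumes "finite A" "Poly_Mapping.keys a \<subseteq> A"
  shows "mono_eval a x = (\<Prod>i\<in>A. x i ^ Poly_Mapping.lookup a i)"
  unfolding mono_eval_def using assms by (intro prod.mono_neutral_left) (auto simp: in_keys_iff)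

lemma mono_eval_0 [simp]: "mono_eval 0 x = 1"
  by (simp add: mono_eval_def)

lemma mono_eval_add: "mono_eval (a + b) x = mono_eval a x * mono_eval b x"
proof -
  let ?A = "Poly_Mapping.keys a \<union> Poly_Mapping.keys b"
  have "mono_eval (a + b) x = (\<Prod>i\<in>?A. x i ^ Poly_Mapping.lookup (a + b) i)"
    by (rule mono_eval_superset) (simp_all add: Poly_Mapping.keys_add)
  also have "\<dots> = mono_eval a x * mono_eval b x"
    by (simp add: mono_eval_superset[of ?A] lookup_add power_add prod.distrib)
  finally show ?thesis .
qed

lemma mono_eval_single: "mono_eval (Poly_Mapping.single i k) x = x i ^ k"
  by (simp add: mono_eval_def)

lemma peval_superset:
  assumes "finite A" "Poly_Mapping.keys p \<subseteq> A"
  shows "peval p x = (\<Sum>a\<in>A. Poly_Mapping.lookup p a * mono_eval a x)"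
  unfolding peval_def mono_eval_def[symmetric]
  using assms by (intro sum.mono_neutral_left) (auto simp: in_keys_iff)

lemma peval_0 [simp]: "peval 0 x = 0"
  by (simp add: peval_def)

lemma peval_add: "peval (p + q) x = peval p x + peval q x"
proof -
  let ?A = "Poly_Mapping.keys p \<union> Poly_Mapping.keys q"
  have "peval (p + q) x = (\<Sum>a\<in>?A. Poly_Mapping.lookup (p + q) a * mono_eval a x)"
    by (rule peval_superset) (simp_all add: Poly_Mapping.keys_add)
  also have "\<dots> = peval p x + peval q x"
    by (simp add: peval_superset[of ?A] lookup_add distrib_right sum.distrib)
  finally show ?thesis .
qed

lemma peval_sum: "peval (sum f A) x = (\<Sum>i\<in>A. peval (f i) x)"
  by (induction A rule: infinite_finite_induct) (auto simp: peval_add)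

lemma peval_single: "peval (Poly_Mapping.single a c) x = c * mono_eval a x"
  by (simp add: peval_superset[of "{a}"])

lemma mpoly_sum_singles:
  "p = (\<Sum>a\<in>Poly_Mapping.keys p. Poly_Mapping.single a (Poly_Mapping.lookup p a))"
  by (rule poly_mapping_eqI) (simp add: lookup_sum lookup_single when_def in_keys_iff)

lemma mpoly_mult_singles:
  "p * q = (\<Sum>a\<in>Poly_Mapping.keys p. \<Sum>b\<in>Poly_Mapping.keys q.
     Poly_Mapping.single (a + b) (Poly_Mapping.lookup p a * Poly_Mapping.lookup q b))" for p q :: mpoly
proof -
  have "p * q = (\<Sum>a\<in>Poly_Mapping.keys p. Poly_Mapping.single a (Poly_Mapping.lookup p a))
      * (\<Sum>a\<in>Poly_Mapping.keys q. Poly_Mapping.single a (Poly_Mapping.lookup q a))"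
    using mpoly_sum_singles[of p] mpoly_sum_singles[of q] by metis
  then show ?thesis by (simp only: sum_product mult_single)
qed

lemma peval_mult: "peval (p * q) x = peval p x * peval q x"
proof -
  have "peval (p * q) x = (\<Sum>a\<in>Poly_Mapping.keys p. \<Sum>b\<in>Poly_Mapping.keys q.
      (Poly_Mapping.lookup p a * mono_eval a x) * (Poly_Mapping.lookup q b * mono_eval b x))"
    unfolding mpoly_mult_singles[of p q] peval_sum peval_single mono_eval_add
    by (intro sum.cong refl) (simp only: ac_simps)
  also have "\<dots> = peval p x * peval q x"
    unfolding peval_def mono_eval_def[symmetric] sum_product ..
  finally show ?thesis .
qed

abbreviation mconst :: "complex \<Rightarrow> mpoly" where "mconst c \<equiv> Poly_Mapping.single 0 c"

abbreviation mvar :: "nat \<Rightarrow> mpoly" where "mvar i \<equiv> Poly_Mapping.single (Poly_Mapping.single i (Suc 0)) 1"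

lemma peval_mconst [simp]: "peval (mconst c) x = c"
  by (simp add: peval_single)

lemma peval_mvar [simp]: "peval (mvar i) x = x i"
  by (simp add: peval_single mono_eval_single)

lemma peval_1 [simp]: "peval 1 x = 1"
  using peval_mconst[of 1] by simp

lemma peval_uminus: "peval (- p) x = - peval p x"
  using peval_add[of p "- p" x] by (simp add: eq_neg_iff_add_eq_0 add.commute)

lemma peval_diff: "peval (p - q) x = peval p x - peval q x"
  using peval_add[of p "- q" x] by (simp add: peval_uminus)

lemma peval_power: "peval (p ^ k) x = peval p x ^ k"
  by (induction k) (simp_all add: peval_mult)

lemma peval_prod: "peval (prod f A) x = (\<Prod>i\<in>A. peval (f i) x)"
  by (induction A rule: infinite_finite_induct) (auto simp: peval_mult)

lemma peval_cong:
  assumes "\<And>i. i \<in> pvars p \<Longrightarrow> x i = y i"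
  shows "peval p x = peval p y"
  unfolding peval_def
proof (intro sum.cong prod.cong arg_cong2[of _ _ _ _ "(*)"] refl)
  fix a i assume "a \<in> Poly_Mapping.keys p" "i \<in> Poly_Mapping.keys a"
  then have "x i = y i" by (intro assms) (auto simp: pvars_def)
  then show "x i ^ Poly_Mapping.lookup a i = y i ^ Poly_Mapping.lookup a i" by simp
qed

section \<open>Polynomials in the first variables\<close>

definition mpolys :: "nat \<Rightarrow> mpoly set" where
  "mpolys n = {p. pvars p \<subseteq> {..<n}}"

definition free_of :: "nat \<Rightarrow> mpoly set" where
  "free_of i = {p. i \<notin> pvars p}"

lemma free_of_alt: "p \<in> free_of i \<longleftrightarrow> (\<forall>a\<in>Poly_Mapping.keys p. Poly_Mapping.lookup a i = 0)"
  by (auto simp: free_of_def pvars_def in_keys_iff)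

lemma mpolys_alt: "p \<in> mpolys n \<longleftrightarrow> (\<forall>i\<ge>n. p \<in> free_of i)"
  by (auto simp: mpolys_def free_of_def lessThan_def not_le)

lemma free_of_add: "p \<in> free_of i \<Longrightarrow> q \<in> free_of i \<Longrightarrow> p + q \<in> free_of i"
  unfolding free_of_alt using Poly_Mapping.keys_add[of p q] by blast

lemma free_of_mult: "p \<in> free_of i \<Longrightarrow> q \<in> free_of i \<Longrightarrow> p * q \<in> free_of i"
  unfolding free_of_alt using keys_mult[of p q] by (fastforce simp: lookup_add)

lemma free_of_uminus: "p \<in> free_of i \<Longrightarrow> - p \<in> free_of i"
  unfolding free_of_alt by simp

lemma free_of_diff: "p \<in> free_of i \<Longrightarrow> q \<in> free_of i \<Longrightarrow> p - q \<in> free_of i"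
  using free_of_add[of p i "- q"] free_of_uminus[of q i] by simp

lemma free_of_mconst: "mconst c \<in> free_of i"
  by (simp add: free_of_alt)

lemma free_of_0: "0 \<in> free_of i"
  by (simp add: free_of_alt)

lemma free_of_1: "1 \<in> free_of i"
  using free_of_mconst[of 1 i] by simp

lemma free_of_mvar: "i \<noteq> j \<Longrightarrow> mvar i \<in> free_of j"
  by (simp add: free_of_alt lookup_single when_def)

lemma free_of_sum: "(\<And>j. j \<in> A \<Longrightarrow> f j \<in> free_of i) \<Longrightarrow> sum f A \<in> free_of i"
  by (induction A rule: infinite_finite_induct) (auto intro: free_of_0 free_of_add)

lemma mpolys_closed:
  "0 \<in> mpolys n" "1 \<in> mpolys n" "mconst c \<in> mpolys n"
  "p \<in> mpolys n \<Longrightarrow> q \<in> mpolys n \<Longrightarrow> p + q \<in> mpolys n"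
  "p \<in> mpolys n \<Longrightarrow> q \<in> mpolys n \<Longrightarrow> p - q \<in> mpolys n"
  "p \<in> mpolys n \<Longrightarrow> q \<in> mpolys n \<Longrightarrow> p * q \<in> mpolys n"
  unfolding mpolys_alt
  by (auto intro: free_of_0 free_of_1 free_of_mconst free_of_add free_of_diff free_of_mult)

lemma mpolys_sum: "(\<And>j. j \<in> A \<Longrightarrow> f j \<in> mpolys n) \<Longrightarrow> sum f A \<in> mpolys n"
  by (induction A rule: infinite_finite_induct) (auto intro: mpolys_closed)

lemma mpolys_prod: "(\<And>j. j \<in> A \<Longrightarrow> f j \<in> mpolys n) \<Longrightarrow> prod f A \<in> mpolys n"
  by (induction A rule: infinite_finite_induct) (auto intro: mpolys_closed)

lemma mpolys_power: "p \<in> mpolys n \<Longrightarrow> p ^ k \<in> mpolys n"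
  by (induction k) (auto intro: mpolys_closed)

lemma mpolys_0_const:
  assumes "p \<in> mpolys 0"
  shows "p = mconst (Poly_Mapping.lookup p 0)"
proof -
  have keys: "a = 0" if "a \<in> Poly_Mapping.keys p" for a
  proof (rule poly_mapping_eqI)
    fix k
    have "k \<notin> Poly_Mapping.keys a" using assms that by (auto simp: mpolys_def pvars_def)
    then show "Poly_Mapping.lookup a k = Poly_Mapping.lookup 0 k" by (simp add: in_keys_iff)
  qed
  show ?thesis
  proof (rule poly_mapping_eqI)
    fix a
    show "Poly_Mapping.lookup p a = Poly_Mapping.lookup (mconst (Poly_Mapping.lookup p 0)) a"
    proof (cases "a = 0")
      case True
      then show ?thesis by (simp only: lookup_single_eq)
    next
      case False
      then have "Poly_Mapping.lookup p a = 0" using keys[of a] by (metis in_keys_iff)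
      then show ?thesis using False by (simp only: lookup_single_not_eq[OF False[symmetric]])
    qed
  qed
qed

lemma mvar_power: "mvar i ^ k = Poly_Mapping.single (Poly_Mapping.single i k) 1"
proof (induction k)
  case (Suc k)
  then show ?case by (simp add: mult_single flip: single_add)
qed simp

text \<open>A monomial is uniquely a power of X_i times a monomial without X_i; this separates the
  coefficients of different powers of X_i.\<close>

lemma lookup_free_times_mvar_power:
  assumes c: "c \<in> free_of i" and b: "Poly_Mapping.lookup b i = 0"
  shows "Poly_Mapping.lookup (c * mvar i ^ k) (b + Poly_Mapping.single i j)
    = (if j = k then Poly_Mapping.lookup c b else 0)"
proof -
  have eq: "a + Poly_Mapping.single i k = b + Poly_Mapping.single i j \<longleftrightarrow> j = k \<and> a = b"
    if "a \<in> Poly_Mapping.keys c" for a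
  proof
    assume *: "a + Poly_Mapping.single i k = b + Poly_Mapping.single i j"
    have "Poly_Mapping.lookup a i = 0" using that c by (simp add: free_of_alt)
    moreover have "Poly_Mapping.lookup (a + Poly_Mapping.single i k) i = Poly_Mapping.lookup (b + Poly_Mapping.single i j) i"
      by (rule arg_cong[OF *])
    ultimately have jk: "j = k" using b by (simp add: lookup_add)
    then have "a = b" using * by (metis add_right_cancel)
    with jk show "j = k \<and> a = b" ..
  next
    assume "j = k \<and> a = b"
    then show "a + Poly_Mapping.single i k = b + Poly_Mapping.single i j" by blast
  qed
  have "c * mvar i ^ k = (\<Sum>a\<in>Poly_Mapping.keys c. Poly_Mapping.single a (Poly_Mapping.lookup c a)) * mvar i ^ k"
    using mpoly_sum_singles[of c] by simp
  also have "\<dots> = (\<Sum>a\<in>Poly_Mapping.keys c. Poly_Mapping.single (a + Poly_Mapping.single i k) (Poly_Mapping.lookup c a))"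
    unfolding mvar_power sum_distrib_right mult_single by simp
  finally have "Poly_Mapping.lookup (c * mvar i ^ k) (b + Poly_Mapping.single i j)
    = (\<Sum>a\<in>Poly_Mapping.keys c. if j = k \<and> a = b then Poly_Mapping.lookup c a else 0)"
    by (simp add: lookup_sum lookup_single when_def eq cong: sum.cong)
  also have "\<dots> = (if j = k then Poly_Mapping.lookup c b else 0)"
    by (auto simp: in_keys_iff)
  finally show ?thesis .
qed

section \<open>A polynomial as a univariate polynomial in one of its variables\<close>

definition join :: "nat \<Rightarrow> mpoly poly \<Rightarrow> mpoly" where
  "join i P = poly P (mvar i)"

lemma lookup_join:
  assumes P: "P \<in> polys_over (free_of i)" and b: "Poly_Mapping.lookup b i = 0"
  shows "Poly_Mapping.lookup (join i P) (b + Poly_Mapping.single i j) = Poly_Mapping.lookup (coeff P j) b"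
proof -
  have "Poly_Mapping.lookup (join i P) (b + Poly_Mapping.single i j)
      = (\<Sum>k\<le>degree P. if j = k then Poly_Mapping.lookup (coeff P k) b else 0)"
    unfolding join_def poly_altdef lookup_sum
    using P by (intro sum.cong refl lookup_free_times_mvar_power b) (auto simp: polys_over_def)
  also have "\<dots> = Poly_Mapping.lookup (coeff P j) b"
    by (simp add: coeff_eq_0)
  finally show ?thesis .
qed

lemma join_inj:
  assumes P: "P \<in> polys_over (free_of i)" and Q: "Q \<in> polys_over (free_of i)" and eq: "join i P = join i Q"
  shows "P = Q"
proof (intro poly_eqI poly_mapping_eqI)
  fix k b
  show "Poly_Mapping.lookup (coeff P k) b = Poly_Mapping.lookup (coeff Q k) b"
  proof (cases "Poly_Mapping.lookup b i = 0")
    case True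
    then show ?thesis using lookup_join[OF P True, of k] lookup_join[OF Q True, of k] eq by simp
  next
    case False
    then have "b \<notin> Poly_Mapping.keys (coeff P k)" "b \<notin> Poly_Mapping.keys (coeff Q k)"
      using P Q by (auto simp: polys_over_def free_of_alt)
    then show ?thesis by (simp add: in_keys_iff)
  qed
qed

lemma join_simps:
  "join i (P + Q) = join i P + join i Q" "join i (P * Q) = join i P * join i Q"
  "join i 0 = 0" "join i 1 = 1" "join i [:c:] = c"
  by (simp_all add: join_def)

lemma polys_over_free_of_closed:
  "P \<in> polys_over (free_of i) \<Longrightarrow> Q \<in> polys_over (free_of i) \<Longrightarrow> P + Q \<in> polys_over (free_of i)"
  "P \<in> polys_over (free_of i) \<Longrightarrow> Q \<in> polys_over (free_of i) \<Longrightarrow> P * Q \<in> polys_over (free_of i)"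
  "c \<in> free_of i \<Longrightarrow> [:c:] \<in> polys_over (free_of i)"
  "0 \<in> polys_over (free_of i)"
  by (auto simp: polys_over_def coeff_mult coeff_pCons split: nat.split
      intro!: free_of_add free_of_sum free_of_mult free_of_0)

text \<open>By additivity a single monomial is enough; \<open>b\<close> is \<open>a\<close> with its
  power of X_i removed.\<close>

lemma join_surj: "\<exists>P. P \<in> polys_over (free_of i) \<and> join i P = p"
proof -
  have single: "\<exists>P. P \<in> polys_over (free_of i) \<and> join i P = Poly_Mapping.single a c" for a c
  proof -
    define b where "b = a - Poly_Mapping.single i (Poly_Mapping.lookup a i)"
    have ab: "a = b + Poly_Mapping.single i (Poly_Mapping.lookup a i)"
      by (rule poly_mapping_eqI) (auto simp: b_def lookup_add lookup_minus lookup_single when_def)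
    have "Poly_Mapping.single b c \<in> free_of i"
      by (auto simp: free_of_alt b_def lookup_minus split: if_splits)
    then have "monom (Poly_Mapping.single b c) (Poly_Mapping.lookup a i) \<in> polys_over (free_of i)"
      by (simp add: polys_over_def free_of_0)
    moreover have "join i (monom (Poly_Mapping.single b c) (Poly_Mapping.lookup a i)) = Poly_Mapping.single a c"
      unfolding join_def poly_monom mvar_power mult_single using ab by simp
    ultimately show ?thesis by blast
  qed
  have "\<exists>P. P \<in> polys_over (free_of i) \<and> join i P = (\<Sum>a\<in>A. Poly_Mapping.single a (Poly_Mapping.lookup p a))" for A
  proof (induction A rule: infinite_finite_induct)
    case (insert a A)
    then obtain P where "P \<in> polys_over (free_of i)" "join i P = (\<Sum>a\<in>A. Poly_Mapping.single a (Poly_Mapping.lookup p a))" by blast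
    moreover obtain Q where "Q \<in> polys_over (free_of i)" "join i Q = Poly_Mapping.single a (Poly_Mapping.lookup p a)"
      using single by blast
    ultimately show ?case using insert
      by (intro exI[of _ "Q + P"]) (simp add: join_simps polys_over_free_of_closed)
  qed (auto intro!: exI[of _ 0] simp: join_simps polys_over_free_of_closed)
  then show ?thesis using mpoly_sum_singles[of p] by metis
qed

definition split_var :: "nat \<Rightarrow> mpoly \<Rightarrow> mpoly poly" where
  "split_var i p = (THE P. P \<in> polys_over (free_of i) \<and> join i P = p)"

lemma split_var: "split_var i p \<in> polys_over (free_of i)" "join i (split_var i p) = p"
proof -
  have "\<exists>!P. P \<in> polys_over (free_of i) \<and> join i P = p"
    using join_surj join_inj by metis
  from theI'[OF this] show "split_var i p \<in> polys_over (free_of i)" "join i (split_var i p) = p"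
    unfolding split_var_def by blast+
qed

lemma split_var_unique: "P \<in> polys_over (free_of i) \<Longrightarrow> split_var i (join i P) = P"
  using split_var join_inj by metis

lemma split_var_mult: "split_var i (p * q) = split_var i p * split_var i q"
  using split_var_unique[of "split_var i p * split_var i q" i] split_var
  by (simp add: join_simps polys_over_free_of_closed)

lemma split_var_0: "split_var i 0 = 0"
  using split_var_unique[of 0 i] by (simp add: join_simps polys_over_free_of_closed)

lemma split_var_eq_0_iff: "split_var i p = 0 \<longleftrightarrow> p = 0"
  by (metis split_var(2) split_var_0 join_simps(3))

lemma split_var_free: "p \<in> free_of i \<Longrightarrow> split_var i p = [:p:]"
  using split_var_unique[of "[:p:]" i] by (simp add: join_simps polys_over_free_of_closed)

definition degree_in :: "nat \<Rightarrow> mpoly \<Rightarrow> nat" where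
  "degree_in i p = degree (split_var i p)"

lemma degree_in_mult: "p * q \<noteq> 0 \<Longrightarrow> degree_in i (p * q) = degree_in i p + degree_in i q"
  unfolding degree_in_def split_var_mult by (subst degree_mult_eq) (auto simp: split_var_eq_0_iff)

lemma degree_in_eq_0_iff: "degree_in i p = 0 \<longleftrightarrow> p \<in> free_of i"
proof
  assume "degree_in i p = 0"
  then obtain c where c: "split_var i p = [:c:]" unfolding degree_in_def by (metis degree_eq_zeroE)
  then have "p = c" using split_var(2)[of i p] by (simp add: join_simps)
  moreover have "c \<in> free_of i" using split_var(1)[of i p] unfolding c polys_over_def
    by (metis (mono_tags, lifting) coeff_pCons_0 mem_Collect_eq)
  ultimately show "p \<in> free_of i" by simp
qed (simp add: degree_in_def split_var_free)

lemma split_var_mpolys: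
  assumes "p \<in> mpolys m"
  shows "coeff (split_var i p) k \<in> mpolys m"
proof -
  have "j < m" if b: "b \<in> Poly_Mapping.keys (coeff (split_var i p) k)" and j: "j \<in> Poly_Mapping.keys b" for b j
  proof -
    have bi: "Poly_Mapping.lookup b i = 0"
      using b split_var(1)[of i p] by (auto simp: polys_over_def free_of_alt)
    then have "j \<noteq> i" using j by (auto simp: in_keys_iff)
    have "Poly_Mapping.lookup p (b + Poly_Mapping.single i k) \<noteq> 0"
      using lookup_join[OF split_var(1) bi, of p k] b by (simp add: split_var(2) in_keys_iff)
    moreover have "j \<in> Poly_Mapping.keys (b + Poly_Mapping.single i k)"
      using j by (simp add: in_keys_iff lookup_add)
    ultimately have "j \<in> pvars p" unfolding pvars_def by (metis UN_I in_keys_iff)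
    then show "j < m" using assms unfolding mpolys_def by blast
  qed
  then show ?thesis by (auto simp: mpolys_def pvars_def)
qed

lemma split_var_mpolys_Suc:
  assumes "p \<in> mpolys (Suc n)"
  shows "split_var n p \<in> polys_over (mpolys n)"
proof -
  have "coeff (split_var n p) k \<in> free_of i" if "i \<ge> n" for i k
  proof (cases "i = n")
    case True
    then show ?thesis using split_var(1)[of n p] by (simp add: polys_over_def)
  next
    case False
    then have "Suc n \<le> i" using that by simp
    then show ?thesis using split_var_mpolys[OF assms, of n k] unfolding mpolys_alt by blast
  qed
  then show ?thesis by (simp add: polys_over_def mpolys_alt)
qed

lemma polys_over_mpolys_free: "polys_over (mpolys n) \<subseteq> polys_over (free_of n)"
  by (auto simp: polys_over_def mpolys_alt)

text \<open>At a point where the leading coefficient in the last variable does not vanish,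
  \<open>p\<close> becomes a nonzero polynomial in that variable.\<close>

lemma exists_peval_nonzero:
  assumes "p \<in> mpolys n" "p \<noteq> 0"
  shows "\<exists>x. peval p x \<noteq> 0"
  using assms
proof (induction n arbitrary: p)
  case 0
  then have "p = mconst (Poly_Mapping.lookup p 0)" by (intro mpolys_0_const)
  then show ?case using 0(2) by (metis peval_mconst single_zero)
next
  case (Suc n)
  define P where "P = split_var n p"
  have P: "P \<in> polys_over (mpolys n)" unfolding P_def by (rule split_var_mpolys_Suc[OF Suc.prems(1)])
  have "lead_coeff P \<noteq> 0" using Suc.prems(2) by (simp add: P_def split_var_eq_0_iff)
  then obtain x where x: "peval (lead_coeff P) x \<noteq> 0"
    using Suc.IH[of "lead_coeff P"] P unfolding polys_over_def by blast
  define Q where "Q = map_poly (\<lambda>c. peval c x) P"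
  have "coeff Q (degree P) \<noteq> 0" using x by (simp add: Q_def coeff_map_poly)
  then have "Q \<noteq> 0" by auto
  then obtain t where t: "poly Q t \<noteq> 0" by (metis poly_all_0_iff_0)
  have ev: "peval (coeff P k) (x(n := t)) = peval (coeff P k) x" for k
    using P by (intro peval_cong) (auto simp: polys_over_def mpolys_def)
  have "peval p (x(n := t)) = peval (join n P) (x(n := t))" by (simp add: P_def split_var)
  also have "\<dots> = (\<Sum>k\<le>degree P. peval (coeff P k) x * t ^ k)"
    unfolding join_def poly_altdef by (simp add: peval_sum peval_mult peval_power ev)
  also have "\<dots> = poly Q t"
    unfolding Q_def poly_altdef
    by (rule sum.mono_neutral_cong_right) (auto simp: coeff_map_poly map_poly_degree_leq intro!: le_degree)
  finally show ?case using t by metis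
qed

text \<open>Degrees in each variable add up, so a variable absent from a nonzero product is absent
  from its factors.\<close>

lemma mpolys_divisor:
  assumes "p * q \<in> mpolys n" "p * q \<noteq> 0"
  shows "p \<in> mpolys n"
proof -
  have "p \<in> free_of i" if "i \<ge> n" for i
    using assms that degree_in_mult[OF assms(2), of i] degree_in_eq_0_iff unfolding mpolys_alt
    by (metis add_eq_0_iff_both_eq_0)
  then show ?thesis by (simp add: mpolys_alt)
qed

lemma mconst_dvd_1: "c \<noteq> 0 \<Longrightarrow> mconst c dvd 1"
  by (rule dvdI[of _ _ "mconst (inverse c)"]) (simp add: mult_single)

lemma dvd_1_mconst:
  assumes "p dvd (1 :: mpoly)"
  shows "\<exists>c. c \<noteq> 0 \<and> p = mconst c"
proof -
  obtain q where q: "1 = p * q" using assms by (auto elim: dvdE)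
  have "p \<in> mpolys 0" using mpolys_divisor[of p q 0] q mpolys_closed(2) by simp
  then have "p = mconst (Poly_Mapping.lookup p 0)" by (rule mpolys_0_const)
  moreover have "p \<noteq> 0" using q by auto
  ultimately show ?thesis by (metis single_zero)
qed

lemma mpolys_size_0:
  assumes "p \<in> mpolys n" "p \<noteq> 0" "(\<Sum>i<n. degree_in i p) = 0"
  shows "p dvd 1"
proof -
  have "p \<in> free_of i" for i
    using assms(1,3) degree_in_eq_0_iff[of i p] by (cases "i < n") (auto simp: mpolys_alt)
  then have "p = mconst (Poly_Mapping.lookup p 0)" by (intro mpolys_0_const) (simp add: mpolys_alt)
  then show ?thesis using assms(2) mconst_dvd_1 by (metis single_zero)
qed

text \<open>X_n is adjoined to the coefficients \<open>mpolys n\<close>, which are factorial by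
  induction. Gauss's lemma settles an \<open>h\<close> without X_n,
  \<open>irreducible_prime_polys_over\<close> an \<open>h\<close> that involves it.\<close>

lemma irreducible_prime_mpolys:
  assumes "irreducible h" "h \<in> mpolys n" "f \<in> mpolys n" "g \<in> mpolys n" "h dvd f * g"
  shows "h dvd f \<or> h dvd g"
  using assms
proof (induction n arbitrary: h f g)
  case 0
  then have "h = mconst (Poly_Mapping.lookup h 0)" "h \<noteq> 0" by (auto intro: mpolys_0_const)
  then have "h dvd 1" using mconst_dvd_1 by (metis single_zero)
  then show ?case using 0(1) by (simp add: irreducible_def)
next
  case (Suc n)
  interpret S: factorial_subring "mpolys n" "\<lambda>p. \<Sum>i<n. degree_in i p"
  proof
    show "a \<in> mpolys n" if "a * b \<in> mpolys n" "a * b \<noteq> 0" for a b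
      using mpolys_divisor that .
    show "(\<Sum>i<n. degree_in i (a * b)) = (\<Sum>i<n. degree_in i a) + (\<Sum>i<n. degree_in i b)"
      if "a * b \<noteq> 0" for a b
      using degree_in_mult[OF that] by (simp add: sum.distrib)
  qed (use Suc.IH mpolys_size_0 in \<open>auto intro: mpolys_closed\<close>)
  show ?case
  proof (cases "f * g = 0")
    case True
    then show ?thesis by auto
  next
    case False
    obtain y where y: "f * g = h * y" using Suc.prems(5) by (auto elim: dvdE)
    have yR: "y \<in> mpolys (Suc n)"
      using mpolys_divisor[of y h] y False Suc.prems by (metis mpolys_closed(6) mult.commute)
    define H F G Y where "H = split_var n h" and "F = split_var n f" and "G = split_var n g"
      and "Y = split_var n y"
    have mem: "H \<in> S.PS" "F \<in> S.PS" "G \<in> S.PS" "Y \<in> S.PS"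
      unfolding H_def F_def G_def Y_def using Suc.prems yR split_var_mpolys_Suc by auto
    have eq: "F * G = H * Y" unfolding H_def F_def G_def Y_def split_var_mult[symmetric] y ..
    have join: "join n H = h" "join n F = f" "join n G = g" by (simp_all add: H_def F_def G_def split_var)
    have dvd: "H dvd F \<or> H dvd G"
    proof (cases "degree H = 0")
      case True
      then have hfree: "h \<in> free_of n" using degree_in_eq_0_iff by (simp add: degree_in_def H_def)
      have "h \<in> mpolys n" unfolding mpolys_alt
      proof (intro allI impI)
        fix i assume "n \<le> i"
        then show "h \<in> free_of i" using hfree Suc.prems(2) by (cases "i = n") (auto simp: mpolys_alt)
      qed
      moreover have "H = [:h:]" unfolding H_def using split_var_free[OF hfree] .
      ultimately show ?thesis
        using S.gauss_irreducible[of h F G] Suc.prems(1) mem eq by (metis dvdI)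
    next
      case False
      show ?thesis
      proof (rule S.irreducible_prime_polys_over[OF mem(1) _ _ mem(2,3,4) eq])
        fix A B assume AB: "A \<in> S.PS" "B \<in> S.PS" "H = A * B"
        then have "h = join n A * join n B" using join(1) by (simp add: join_simps)
        then have "join n A dvd 1 \<or> join n B dvd 1" using Suc.prems(1) by (simp add: irreducible_def)
        \<comment> \<open>The units of both rings are the nonzero constants, so irreducibility
          passes from \<open>h\<close> to \<open>H\<close>.\<close>
        moreover have "P dvd 1" if P: "P \<in> S.PS" "join n P dvd 1" for P
        proof -
          obtain c where c: "c \<noteq> 0" "join n P = mconst c" using dvd_1_mconst[OF P(2)] by blast
          have "P = [:mconst c:]"
            using P(1) c(2) polys_over_mpolys_free
            by (intro join_inj[of _ n]) (auto simp: join_simps intro!: polys_over_free_of_closed free_of_mconst)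
          then show ?thesis using mconst_dvd_1[OF c(1)] by (simp add: is_unit_const_poly_iff)
        qed
        ultimately show "A dvd 1 \<or> B dvd 1" using AB by blast
      qed (use False in simp)
    qed
    have "h dvd join n P" if "H dvd P" for P
      using that join(1) by (metis dvdE dvdI join_simps(2))
    then show ?thesis using dvd join by blast
  qed
qed

text \<open>As \<open>h\<close> is prime, one factor \<open>h\<close> at a time can be cancelled
  from \<open>T\<close> or from \<open>W\<close>, until a unit is left.\<close>

theorem factor_of_irreducible_power:
  assumes h: "irreducible h" "h \<in> mpolys n" and TW: "T \<in> mpolys n" "W \<in> mpolys n"
    and c: "c \<noteq> 0" and eq: "T * W = mconst c * h ^ p"
  shows "\<exists>d k. d \<noteq> 0 \<and> T = mconst d * h ^ k"
  using TW c eq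
proof (induction p arbitrary: T W)
  case 0
  then have "T * W dvd 1" using mconst_dvd_1 by simp
  then have "T dvd 1" by (metis dvd_mult_left)
  then show ?case using dvd_1_mconst by (metis power_0 mult_1_right)
next
  case (Suc p)
  have h0: "h \<noteq> 0" using h(1) by auto
  have "mconst c \<noteq> 0" using Suc.prems(3) by (metis lookup_single_eq lookup_zero)
  then have nz: "T * W \<noteq> 0" unfolding Suc.prems(4) using h0 by simp
  have "h dvd T * W" unfolding Suc.prems(4) by simp
  then consider "h dvd T" | "h dvd W" using irreducible_prime_mpolys[OF h Suc.prems(1,2)] by blast
  then show ?case
  proof cases
    case 1
    then obtain T' where T': "T = T' * h" by (metis dvdE mult.commute)
    have "T' \<in> mpolys n" using mpolys_divisor[of T' h n] T' nz Suc.prems(1) by auto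
    moreover have "h * (T' * W) = h * (mconst c * h ^ p)" using Suc.prems(4) T' by (simp add: ac_simps)
    then have "T' * W = mconst c * h ^ p" using h0 by simp
    ultimately obtain d k where "d \<noteq> 0" "T' = mconst d * h ^ k" using Suc.IH Suc.prems by blast
    then show ?thesis using T' by (intro exI[of _ d] exI[of _ "Suc k"]) (simp add: ac_simps)
  next
    case 2
    then obtain W' where W': "W = W' * h" by (metis dvdE mult.commute)
    have "W' \<in> mpolys n" using mpolys_divisor[of W' h n] W' nz Suc.prems(2) by auto
    moreover have "h * (T * W') = h * (mconst c * h ^ p)" using Suc.prems(4) W' by (simp add: ac_simps)
    then have "T * W' = mconst c * h ^ p" using h0 by simp
    ultimately show ?thesis using Suc.IH Suc.prems by blast
  qed
qed

section \<open>Polarization\<close>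

definition cline :: "(nat \<Rightarrow> complex) \<Rightarrow> (nat \<Rightarrow> complex) \<Rightarrow> complex \<Rightarrow> (nat \<Rightarrow> complex)" where
  "cline \<alpha> \<beta> t = (\<lambda>i. \<alpha> i + t * \<beta> i)"

lemma cline_cvec: "\<alpha> \<in> cvec n \<Longrightarrow> \<beta> \<in> cvec n \<Longrightarrow> cline \<alpha> \<beta> t \<in> cvec n"
  by (simp add: cline_def cvec_def)

lemma cconj_cline: "cconj (cline \<alpha> \<beta> t) = cline (cconj \<alpha>) (cconj \<beta>) (cnj t)"
  by (simp add: cline_def cconj_def)

lemma cconj_cconj [simp]: "cconj (cconj z) = z"
  by (simp add: cconj_def)

lemma cconj_cvec [simp]: "cconj z \<in> cvec n \<longleftrightarrow> z \<in> cvec n"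
  by (simp add: cvec_def cconj_def)

lemma cnorm_cconj [simp]: "cnorm n (cconj z) = cnorm n z"
  by (simp add: cnorm_def cconj_def)

lemma cconj_cball0 [simp]: "cconj z \<in> cball0 n \<rho> \<longleftrightarrow> z \<in> cball0 n \<rho>"
  by (simp add: cball0_def)

lemma cnorm_L2_set: "cnorm n z = L2_set (\<lambda>i. cmod (z i)) {..<n}"
  by (simp add: cnorm_def L2_set_def)

lemma cnorm_nonneg: "cnorm n z \<ge> 0"
  by (simp add: cnorm_L2_set L2_set_nonneg)

lemma cnorm_add: "cnorm n (\<lambda>i. z i + w i) \<le> cnorm n z + cnorm n w"
  unfolding cnorm_L2_set
  by (rule order_trans[OF L2_set_mono L2_set_triangle_ineq]) (auto intro: norm_triangle_ineq)

lemma cnorm_scale: "cnorm n (\<lambda>i. t * z i) = cmod t * cnorm n z"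
  unfolding cnorm_L2_set norm_mult by (rule L2_set_right_distrib[symmetric]) simp

lemma continuous_on_cnorm_cline: "continuous_on A (\<lambda>t. cnorm n (cline \<alpha> \<beta> t))"
  unfolding cnorm_def cline_def by (intro continuous_intros)

lemma cball0_zero: "\<rho> > 0 \<Longrightarrow> (\<lambda>_. 0) \<in> cball0 n \<rho>"
  by (simp add: cball0_def cvec_def cnorm_def)

definition cslice :: "nat \<Rightarrow> real \<Rightarrow> (nat \<Rightarrow> complex) \<Rightarrow> (nat \<Rightarrow> complex) \<Rightarrow> complex set" where
  "cslice n \<rho> \<alpha> \<beta> = {t. cline \<alpha> \<beta> t \<in> cball0 n \<rho>}"

lemma cslice_alt:
  assumes "\<alpha> \<in> cvec n" "\<beta> \<in> cvec n"
  shows "cslice n \<rho> \<alpha> \<beta> = {t. cnorm n (cline \<alpha> \<beta> t) < \<rho>}"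
  using cline_cvec[OF assms] by (simp add: cslice_def cball0_def)

lemma open_cslice:
  assumes "\<alpha> \<in> cvec n" "\<beta> \<in> cvec n"
  shows "open (cslice n \<rho> \<alpha> \<beta>)"
  unfolding cslice_alt[OF assms] by (intro open_Collect_less continuous_on_cnorm_cline continuous_on_const)

lemma convex_cslice:
  assumes "\<alpha> \<in> cvec n" "\<beta> \<in> cvec n"
  shows "convex (cslice n \<rho> \<alpha> \<beta>)"
proof (rule convexI)
  fix x y and u v :: real
  assume xy: "x \<in> cslice n \<rho> \<alpha> \<beta>" "y \<in> cslice n \<rho> \<alpha> \<beta>" and uv: "u \<ge> 0" "v \<ge> 0" "u + v = 1"
  have v: "v = 1 - u" using uv by simp
  have "cline \<alpha> \<beta> (u *\<^sub>R x + v *\<^sub>R y) = (\<lambda>i. u * cline \<alpha> \<beta> x i + v * cline \<alpha> \<beta> y i)"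
    by (rule ext) (simp add: cline_def scaleR_conv_of_real v algebra_simps)
  then have "cnorm n (cline \<alpha> \<beta> (u *\<^sub>R x + v *\<^sub>R y)) \<le> u * cnorm n (cline \<alpha> \<beta> x) + v * cnorm n (cline \<alpha> \<beta> y)"
    using cnorm_add[of n "\<lambda>i. u * cline \<alpha> \<beta> x i" "\<lambda>i. v * cline \<alpha> \<beta> y i"] uv by (simp add: cnorm_scale)
  also have "\<dots> < \<rho>"
    using convex_bound_lt[of "cnorm n (cline \<alpha> \<beta> x)" \<rho> "cnorm n (cline \<alpha> \<beta> y)" u v] xy uv
    by (simp add: cslice_alt[OF assms])
  finally show "u *\<^sub>R x + v *\<^sub>R y \<in> cslice n \<rho> \<alpha> \<beta>" by (simp add: cslice_alt[OF assms])
qed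

lemma holo_on_cline:
  assumes f: "holo_on n (cball0 n \<rho>) f" and \<alpha>: "\<alpha> \<in> cvec n" and \<beta>: "\<beta> \<in> cvec n"
  shows "(\<lambda>t. f (cline \<alpha> \<beta> t)) holomorphic_on cslice n \<rho> \<alpha> \<beta>"
  unfolding holomorphic_on_def
proof
  fix t0 assume t0: "t0 \<in> cslice n \<rho> \<alpha> \<beta>"
  let ?g = "\<lambda>t. f (cline \<alpha> \<beta> t)"
  define z where "z = cline \<alpha> \<beta> t0"
  have z: "z \<in> cball0 n \<rho>" using t0 by (simp add: cslice_def z_def)
  obtain c where c: "\<forall>\<epsilon>>0. \<exists>\<delta>>0. \<forall>w\<in>cvec n. cnorm n w < \<delta> \<longrightarrow> (\<lambda>i. z i + w i) \<in> cball0 n \<rho> \<longrightarrow>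
      cmod (f ((\<lambda>i. z i + w i)) - f z - (\<Sum>i<n. c i * w i)) \<le> \<epsilon> * cnorm n w"
    using f z unfolding holo_on_def by blast
  define D where "D = (\<Sum>i<n. c i * \<beta> i)"
  \<comment> \<open>The added 1 keeps \<open>b\<close> positive when \<open>\<beta>\<close> is
    zero.\<close>
  define b where "b = cnorm n \<beta> + 1"
  have b: "b > 0" "cnorm n \<beta> \<le> b" using cnorm_nonneg[of n \<beta>] by (auto simp: b_def)
  have "(?g has_derivative (\<lambda>h. D * h)) (at t0 within cslice n \<rho> \<alpha> \<beta>)"
    unfolding has_derivative_within_alt
  proof (intro conjI allI impI)
    show "bounded_linear ((*) D)" by (rule bounded_linear_mult_right)
    fix e :: real assume e: "e > 0"
    then have eb: "e / b > 0" using b by simp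
    obtain \<delta> where \<delta>: "\<delta> > 0" "\<forall>w\<in>cvec n. cnorm n w < \<delta> \<longrightarrow> (\<lambda>i. z i + w i) \<in> cball0 n \<rho> \<longrightarrow>
      cmod (f ((\<lambda>i. z i + w i)) - f z - (\<Sum>i<n. c i * w i)) \<le> e / b * cnorm n w"
      using c[THEN spec, THEN mp, OF eb] by (elim exE conjE)
    show "\<exists>d>0. \<forall>y\<in>cslice n \<rho> \<alpha> \<beta>. norm (y - t0) < d \<longrightarrow> norm (?g y - ?g t0 - D * (y - t0)) \<le> e * norm (y - t0)"
    proof (intro exI[of _ "\<delta> / b"] conjI ballI impI)
      show "\<delta> / b > 0" using \<delta>(1) b by simp
      fix y assume y: "y \<in> cslice n \<rho> \<alpha> \<beta>" "norm (y - t0) < \<delta> / b"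
      define w where "w = (\<lambda>i. (y - t0) * \<beta> i)"
      have nw: "cnorm n w = norm (y - t0) * cnorm n \<beta>" by (simp add: w_def cnorm_scale)
      have le: "cnorm n w \<le> norm (y - t0) * b" unfolding nw using b by (intro mult_left_mono) auto
      also have "\<dots> < \<delta>" using y(2) b by (simp add: pos_less_divide_eq)
      finally have "cnorm n w < \<delta>" .
      moreover have zw: "(\<lambda>i. z i + w i) = cline \<alpha> \<beta> y"
        by (rule ext) (simp add: z_def w_def cline_def algebra_simps)
      moreover have "w \<in> cvec n" using \<beta> by (simp add: w_def cvec_def)
      moreover have "(\<Sum>i<n. c i * w i) = D * (y - t0)"
        by (simp add: D_def w_def sum_distrib_left sum_distrib_right algebra_simps)
      ultimately have "norm (?g y - ?g t0 - D * (y - t0)) \<le> e / b * cnorm n w"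
        using \<delta>(2)[THEN bspec, of w] y(1) by (simp add: cslice_def z_def)
      also have "\<dots> \<le> e / b * (norm (y - t0) * b)" using le e b by (intro mult_left_mono) auto
      also have "\<dots> = e * norm (y - t0)" using b by simp
      finally show "norm (?g y - ?g t0 - D * (y - t0)) \<le> e * norm (y - t0)" .
    qed
  qed
  then show "?g field_differentiable at t0 within cslice n \<rho> \<alpha> \<beta>"
    unfolding field_differentiable_def has_field_derivative_def by blast
qed

text \<open>The second argument of a kernel at the parameter \<open>t\<close> is the conjugate of
  the point of the line at \<open>cnj t\<close> (\<open>cconj_cline\<close>), so both parameters
  have to stay in the ball.\<close>

definition csym_slice :: "nat \<Rightarrow> real \<Rightarrow> (nat \<Rightarrow> complex) \<Rightarrow> (nat \<Rightarrow> complex) \<Rightarrow> complex set" where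
  "csym_slice n \<rho> \<alpha> \<beta> = cslice n \<rho> \<alpha> \<beta> \<inter> cnj -` cslice n \<rho> \<alpha> \<beta>"

lemma open_csym_slice:
  assumes "\<alpha> \<in> cvec n" "\<beta> \<in> cvec n"
  shows "open (csym_slice n \<rho> \<alpha> \<beta>)"
  unfolding csym_slice_def
  using open_cslice[OF assms] by (intro open_Int open_vimage) (auto intro: continuous_intros)

lemma convex_csym_slice:
  assumes "\<alpha> \<in> cvec n" "\<beta> \<in> cvec n"
  shows "convex (csym_slice n \<rho> \<alpha> \<beta>)"
  unfolding csym_slice_def using convex_cslice[OF assms]
  by (intro convex_Int convex_linear_vimage) (auto intro: bounded_linear.linear bounded_linear_cnj)

text \<open>For real \<open>t\<close> the pair lies on the set of points (z, conj z), and complex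
  \<open>t\<close> complexifies that real line. Holomorphy in the one variable \<open>t\<close>
  along these lines is what continuation uses, and it spares a theory of several variables.\<close>

definition sesqui_holo :: "nat \<Rightarrow> real \<Rightarrow> ((nat \<Rightarrow> complex) \<Rightarrow> (nat \<Rightarrow> complex) \<Rightarrow> complex) \<Rightarrow> bool" where
  "sesqui_holo n \<rho> \<Phi> \<longleftrightarrow> (\<forall>\<alpha>\<in>cvec n. \<forall>\<beta>\<in>cvec n.
     (\<lambda>t. \<Phi> (cline \<alpha> \<beta> t) (cline (cconj \<alpha>) (cconj \<beta>) t)) holomorphic_on csym_slice n \<rho> \<alpha> \<beta>)"

lemma sesqui_holo_const: "sesqui_holo n \<rho> (\<lambda>z \<xi>. c)"
  by (simp add: sesqui_holo_def)

lemma sesqui_holo_add: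
  "sesqui_holo n \<rho> \<Phi> \<Longrightarrow> sesqui_holo n \<rho> \<Psi> \<Longrightarrow> sesqui_holo n \<rho> (\<lambda>z \<xi>. \<Phi> z \<xi> + \<Psi> z \<xi>)"
  by (auto simp: sesqui_holo_def intro!: holomorphic_intros)

lemma sesqui_holo_diff:
  "sesqui_holo n \<rho> \<Phi> \<Longrightarrow> sesqui_holo n \<rho> \<Psi> \<Longrightarrow> sesqui_holo n \<rho> (\<lambda>z \<xi>. \<Phi> z \<xi> - \<Psi> z \<xi>)"
  by (auto simp: sesqui_holo_def intro!: holomorphic_intros)

lemma sesqui_holo_mult:
  "sesqui_holo n \<rho> \<Phi> \<Longrightarrow> sesqui_holo n \<rho> \<Psi> \<Longrightarrow> sesqui_holo n \<rho> (\<lambda>z \<xi>. \<Phi> z \<xi> * \<Psi> z \<xi>)"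
  by (auto simp: sesqui_holo_def intro!: holomorphic_intros)

lemma sesqui_holo_power:
  "sesqui_holo n \<rho> \<Phi> \<Longrightarrow> sesqui_holo n \<rho> (\<lambda>z \<xi>. \<Phi> z \<xi> ^ k)"
  by (auto simp: sesqui_holo_def intro!: holomorphic_intros)

lemma sesqui_holo_prod:
  "(\<And>i. i \<in> A \<Longrightarrow> sesqui_holo n \<rho> (\<Phi> i)) \<Longrightarrow> sesqui_holo n \<rho> (\<lambda>z \<xi>. \<Prod>i\<in>A. \<Phi> i z \<xi>)"
  by (auto simp: sesqui_holo_def intro!: holomorphic_intros)

lemma sesqui_holo_sum:
  "(\<And>i. i \<in> A \<Longrightarrow> sesqui_holo n \<rho> (\<Phi> i)) \<Longrightarrow> sesqui_holo n \<rho> (\<lambda>z \<xi>. \<Sum>i\<in>A. \<Phi> i z \<xi>)"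
  by (auto simp: sesqui_holo_def intro!: holomorphic_intros)

lemma sesqui_holo_left:
  assumes "holo_on n (cball0 n \<rho>) f"
  shows "sesqui_holo n \<rho> (\<lambda>z \<xi>. f z)"
  unfolding sesqui_holo_def
  using holo_on_cline[OF assms] by (auto simp: csym_slice_def intro: holomorphic_on_subset)

lemma sesqui_holo_right:
  assumes "holo_on n (cball0 n \<rho>) f"
  shows "sesqui_holo n \<rho> (\<lambda>z \<xi>. cnj (f (cconj \<xi>)))"
  unfolding sesqui_holo_def
proof (intro ballI)
  fix \<alpha> \<beta> assume \<alpha>\<beta>: "\<alpha> \<in> cvec n" "\<beta> \<in> cvec n"
  have "cnj ` csym_slice n \<rho> \<alpha> \<beta> \<subseteq> cslice n \<rho> \<alpha> \<beta>" by (auto simp: csym_slice_def)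
  then have "(\<lambda>t. f (cline \<alpha> \<beta> t)) holomorphic_on cnj ` csym_slice n \<rho> \<alpha> \<beta>"
    using holo_on_cline[OF assms \<alpha>\<beta>] holomorphic_on_subset by blast
  then have "cnj \<circ> (\<lambda>t. f (cline \<alpha> \<beta> t)) \<circ> cnj holomorphic_on csym_slice n \<rho> \<alpha> \<beta>"
    by (rule holomorphic_on_compose_cnj_cnj) (rule open_csym_slice[OF \<alpha>\<beta>])
  then show "(\<lambda>t. cnj (f (cconj (cline (cconj \<alpha>) (cconj \<beta>) t)))) holomorphic_on csym_slice n \<rho> \<alpha> \<beta>"
    by (simp add: o_def cconj_cline)
qed

lemma sesqui_holo_hdot:
  assumes "\<And>k. k < N \<Longrightarrow> holo_on n (cball0 n \<rho>) (\<lambda>z. F z k)"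
  shows "sesqui_holo n \<rho> (hdot N F)"
proof -
  have "sesqui_holo n \<rho> (\<lambda>z \<xi>. \<Sum>k<N. F z k * cnj (F (cconj \<xi>) k))"
    using assms by (intro sesqui_holo_sum sesqui_holo_mult sesqui_holo_left sesqui_holo_right) auto
  then show ?thesis by (simp add: hdot_def[abs_def])
qed

lemma peval_cline_poly: "\<exists>E :: complex poly. \<forall>t. poly E t = peval p (cline \<alpha> \<beta> t)"
proof
  let ?E = "\<Sum>a\<in>Poly_Mapping.keys p. smult (Poly_Mapping.lookup p a)
    (\<Prod>i\<in>Poly_Mapping.keys a. [:\<alpha> i, \<beta> i:] ^ Poly_Mapping.lookup a i)"
  show "\<forall>t. poly ?E t = peval p (cline \<alpha> \<beta> t)"
    by (simp add: peval_def poly_sum poly_prod poly_power cline_def)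
qed

lemma peval2_cline_poly:
  "\<exists>E :: complex poly. \<forall>t. poly E t = peval2 n h (cline \<alpha> \<beta> t) (cline \<alpha>' \<beta>' t)"
proof -
  have eq: "(\<lambda>i. if i < n then cline \<alpha> \<beta> t i else cline \<alpha>' \<beta>' t (i - n))
    = cline (\<lambda>i. if i < n then \<alpha> i else \<alpha>' (i - n)) (\<lambda>i. if i < n then \<beta> i else \<beta>' (i - n)) t" for t
    by (auto simp: cline_def)
  show ?thesis unfolding peval2_def eq by (rule peval_cline_poly)
qed

lemma sesqui_holo_peval2: "sesqui_holo n \<rho> (peval2 n h)"
  unfolding sesqui_holo_def
proof (intro ballI)
  fix \<alpha> \<beta>
  obtain E :: "complex poly" where E: "\<forall>t. poly E t = peval2 n h (cline \<alpha> \<beta> t) (cline (cconj \<alpha>) (cconj \<beta>) t)"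
    using peval2_cline_poly by blast
  have "poly E holomorphic_on csym_slice n \<rho> \<alpha> \<beta>" by (intro holomorphic_intros)
  then show "(\<lambda>t. peval2 n h (cline \<alpha> \<beta> t) (cline (cconj \<alpha>) (cconj \<beta>) t)) holomorphic_on csym_slice n \<rho> \<alpha> \<beta>"
    using E by (simp add: fun_eq_iff[symmetric] flip: E[rule_format])
qed

lemma zero_islimpt_real:
  assumes "open V" "(0::complex) \<in> V"
  shows "0 islimpt {t\<in>V. t \<in> \<real>}"
  unfolding islimpt_approachable
proof (intro allI impI)
  fix e :: real assume "e > 0"
  obtain d where d: "d > 0" "ball 0 d \<subseteq> V" using assms open_contains_ball by blast
  define x where "x = min d e / 2"
  have x: "x > 0" "x < d" "x < e" using d(1) \<open>e > 0\<close> by (auto simp: x_def)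
  have "of_real x \<in> ball (0::complex) d" using x by (simp add: dist_norm)
  then show "\<exists>x'\<in>{t\<in>V. t \<in> \<real>}. x' \<noteq> 0 \<and> dist x' 0 < e"
    using d(2) x by (intro bexI[of _ "of_real x"]) auto
qed

text \<open>The pair (z(t), conj z(t)), for t real, is continued to complex t along a line which at
  t = i and t = -i passes through the two given points.\<close>

lemma sesqui_holo_polarization:
  assumes hol: "sesqui_holo n \<rho> \<Phi>" and diag: "\<And>z. z \<in> cball0 n \<rho> \<Longrightarrow> \<Phi> z (cconj z) = 0"
    and z: "z \<in> cball0 n \<rho>" and \<xi>: "\<xi> \<in> cball0 n \<rho>"
  shows "\<Phi> z \<xi> = 0"
proof -
  define w where "w = cconj \<xi>"
  define \<alpha> where "\<alpha> = (\<lambda>i. (z i + w i) / 2)"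
  define \<beta> where "\<beta> = (\<lambda>i. (z i - w i) / (2 * \<i>))"
  have zw: "z \<in> cvec n" "w \<in> cvec n" "w \<in> cball0 n \<rho>" using z \<xi> by (auto simp: w_def cball0_def)
  have \<alpha>: "\<alpha> \<in> cvec n" and \<beta>: "\<beta> \<in> cvec n" using zw by (auto simp: \<alpha>_def \<beta>_def cvec_def)
  have li: "cline \<alpha> \<beta> \<i> = z"
    by (rule ext) (simp add: cline_def \<alpha>_def \<beta>_def field_simps)
  have lmi: "cline \<alpha> \<beta> (- \<i>) = w"
    by (rule ext) (simp add: cline_def \<alpha>_def \<beta>_def field_simps)
  define V where "V = csym_slice n \<rho> \<alpha> \<beta>"
  have iV: "\<i> \<in> V" "- \<i> \<in> V" using li lmi z zw(3) by (auto simp: V_def csym_slice_def cslice_def)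
  \<comment> \<open>0 is the midpoint of \<open>\<i>\<close> and \<open>- \<i>\<close>, so convexity
    puts it into \<open>V\<close>, together with the real parameters near it.\<close>
  have convex: "convex V" unfolding V_def by (rule convex_csym_slice[OF \<alpha> \<beta>])
  then have "(1/2) *\<^sub>R \<i> + (1/2) *\<^sub>R (- \<i>) \<in> V" using iV by (intro convexD) auto
  then have 0: "0 \<in> V" by simp
  have openV: "open V" unfolding V_def by (rule open_csym_slice[OF \<alpha> \<beta>])
  let ?g = "\<lambda>t. \<Phi> (cline \<alpha> \<beta> t) (cline (cconj \<alpha>) (cconj \<beta>) t)"
  have "?g \<i> = 0"
  proof (rule analytic_continuation[of ?g V "{t\<in>V. t \<in> \<real>}" 0])
    show "?g holomorphic_on V" using hol \<alpha> \<beta> by (simp add: sesqui_holo_def V_def)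
    show "connected V" using convex by (rule convex_connected)
    show "0 islimpt {t\<in>V. t \<in> \<real>}" by (rule zero_islimpt_real[OF openV 0])
    fix t assume "t \<in> {t\<in>V. t \<in> \<real>}"
    then have t: "t \<in> V" "cnj t = t" by (auto simp: Reals_cnj_iff)
    then have "cline (cconj \<alpha>) (cconj \<beta>) t = cconj (cline \<alpha> \<beta> t)" by (simp add: cconj_cline)
    moreover have "cline \<alpha> \<beta> t \<in> cball0 n \<rho>" using t by (auto simp: V_def csym_slice_def cslice_def)
    ultimately show "?g t = 0" using diag by simp
  qed (use openV 0 iV in auto)
  moreover have "cline (cconj \<alpha>) (cconj \<beta>) \<i> = \<xi>"
    using cconj_cline[of \<alpha> \<beta> "- \<i>"] lmi by (simp add: w_def)
  ultimately show ?thesis using li by simp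
qed

lemma sesqui_holo_eqI:
  assumes "sesqui_holo n \<rho> \<Phi>" "sesqui_holo n \<rho> \<Psi>"
    and "\<And>z. z \<in> cball0 n \<rho> \<Longrightarrow> \<Phi> z (cconj z) = \<Psi> z (cconj z)"
    and "z \<in> cball0 n \<rho>" "\<xi> \<in> cball0 n \<rho>"
  shows "\<Phi> z \<xi> = \<Psi> z \<xi>"
  using sesqui_holo_polarization[OF sesqui_holo_diff[OF assms(1,2)] _ assms(4,5)] assms(3) by simp

section \<open>Restriction to lines\<close>

lemma eventually_zero_laurent:
  assumes "f has_laurent_expansion F" "eventually (\<lambda>t. f t = 0) (at 0)"
  shows "F = 0"
proof -
  have "(\<lambda>_. 0) has_laurent_expansion F"
    using assms has_laurent_expansion_cong[OF assms(2) refl, of F] by simp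
  then show ?thesis by (rule zero_has_laurent_expansion_imp_eq_0)
qed

text \<open>The relation is turned into one between Laurent series at 0, where
  \<open>log_relation_integer\<close> makes the product constant; the identity theorem carries this
  constancy to the parameter 1.\<close>

lemma line_log_relation:
  fixes f :: "'i \<Rightarrow> complex \<Rightarrow> complex" and \<gamma> :: "'i \<Rightarrow> real" and p :: "'i \<Rightarrow> int"
  assumes V: "open V" "convex V" "0 \<in> V" "1 \<in> V" and I: "finite I"
    and hol: "\<And>i. i \<in> I \<Longrightarrow> f i holomorphic_on V"
    and pos: "\<And>i t. i \<in> I \<Longrightarrow> t \<in> V \<Longrightarrow> t \<in> \<real> \<Longrightarrow> f i t \<in> \<real> \<and> Re (f i t) > 0"
    and rel: "\<And>t. t \<in> V \<Longrightarrow> t \<in> \<real> \<Longrightarrow> (\<Sum>i\<in>I. \<gamma> i * ln (Re (f i t))) = 0"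
    and alg: "\<And>i \<phi>. i \<in> I \<Longrightarrow> f i has_laurent_expansion \<phi> \<Longrightarrow> alg_dep fls_X \<phi>"
    and p: "\<And>k :: 'i \<Rightarrow> int. (\<Sum>i\<in>I. \<gamma> i * of_int (k i)) = 0 \<Longrightarrow> (\<Sum>i\<in>I. p i * k i) = 0"
  shows "(\<Prod>i\<in>I. f i 1 powi p i) = (\<Prod>i\<in>I. f i 0 powi p i)"
proof -
  have f0: "Re (f i 0) > 0" if "i \<in> I" for i using pos[OF that V(3)] by auto
  have "open (V \<inter> (\<Inter>i\<in>I. {t\<in>V. Re (f i t) \<in> {0<..}}))"
  proof (intro open_Int open_INT I ballI V(1))
    fix i assume i: "i \<in> I"
    have "continuous_on V (\<lambda>t. Re (f i t))"
      using holomorphic_on_imp_continuous_on[OF hol[OF i]] by (intro continuous_intros)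
    then have "open (V \<inter> (\<lambda>t. Re (f i t)) -` {0<..})"
      by (rule continuous_open_preimage[OF _ V(1) open_greaterThan])
    also have "V \<inter> (\<lambda>t. Re (f i t)) -` {0<..} = {t\<in>V. Re (f i t) \<in> {0<..}}" by blast
    finally show "open {t\<in>V. Re (f i t) \<in> {0<..}}" .
  qed
  moreover have "0 \<in> V \<inter> (\<Inter>i\<in>I. {t\<in>V. Re (f i t) \<in> {0<..}})" using V f0 by auto
  ultimately obtain e where e: "e > 0" "ball 0 e \<subseteq> V \<inter> (\<Inter>i\<in>I. {t\<in>V. Re (f i t) \<in> {0<..}})"
    by (rule openE)
  \<comment> \<open>On this disc all \<open>f i\<close> have positive real part, so that
    \<open>Ln\<close> is holomorphic along them; the relation, given at real \<open>t\<close>,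
    extends to the disc and can be differentiated.\<close>
  define D where "D = ball (0::complex) e"
  have D: "open D" "connected D" "0 \<in> D" "D \<subseteq> V" using e by (auto simp: D_def)
  have Dpos: "Re (f i t) > 0" if "i \<in> I" "t \<in> D" for i t using e that by (auto simp: D_def)
  have Dnz: "f i t \<noteq> 0" if "i \<in> I" "t \<in> D" for i t using Dpos[OF that] by auto
  have holD: "f i holomorphic_on D" if "i \<in> I" for i
    using hol[OF that] D(4) holomorphic_on_subset by blast
  define S where "S = (\<lambda>t. \<Sum>i\<in>I. of_real (\<gamma> i) * Ln (f i t))"
  have nonpos: "f i t \<notin> \<real>\<^sub>\<le>\<^sub>0" if "i \<in> I" "t \<in> D" for i t
    using Dpos[OF that] by (auto simp: complex_nonpos_Reals_iff)
  have S0: "S t = 0" if t: "t \<in> D" for t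
  proof (rule analytic_continuation[of S D "{t\<in>D. t \<in> \<real>}" 0])
    show "S holomorphic_on D" unfolding S_def
      using holD nonpos by (intro holomorphic_intros) auto
    show "0 islimpt {t\<in>D. t \<in> \<real>}" by (rule zero_islimpt_real[OF D(1,3)])
    fix t assume "t \<in> {t\<in>D. t \<in> \<real>}"
    then have tD: "t \<in> D" "t \<in> V" "t \<in> \<real>" using D by auto
    have "Ln (f i t) = of_real (ln (Re (f i t)))" if i: "i \<in> I" for i
    proof -
      have "f i t = of_real (Re (f i t))" using pos[OF i tD(2,3)] by (simp add: complex_is_Real_iff complex_eq_iff)
      then show ?thesis using Ln_of_real[of "Re (f i t)"] Dpos[OF i tD(1)] by metis
    qed
    then have "S t = of_real (\<Sum>i\<in>I. \<gamma> i * ln (Re (f i t)))" by (simp add: S_def)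
    then show "S t = 0" using rel[OF tD(2,3)] by simp
  qed (use D t in auto)
  have deriv0: "(\<Sum>i\<in>I. of_real (\<gamma> i) * (deriv (f i) t / f i t)) = 0" if t: "t \<in> D" for t
  proof -
    have "(S has_field_derivative (\<Sum>i\<in>I. of_real (\<gamma> i) * (deriv (f i) t / f i t))) (at t)"
      unfolding S_def
    proof (intro DERIV_sum DERIV_cmult)
      fix i assume i: "i \<in> I"
      have "(f i has_field_derivative deriv (f i) t) (at t)"
        using holomorphic_derivI[OF holD[OF i] D(1) t] .
      then have "((\<lambda>t. Ln (f i t)) has_field_derivative inverse (f i t) * deriv (f i) t) (at t)"
        by (rule DERIV_chain2[where f = Ln and g = "f i", OF has_field_derivative_Ln[OF nonpos[OF i t]]])
      then show "((\<lambda>t. Ln (f i t)) has_field_derivative deriv (f i) t / f i t) (at t)"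
        by (simp add: divide_inverse mult.commute)
    qed
    moreover have "(S has_field_derivative 0) (at t)"
      by (rule has_field_derivative_transform_within_open[of "\<lambda>_. 0" 0 t D S]) (use D t S0 in auto)
    ultimately show ?thesis by (rule DERIV_unique)
  qed
  have evD: "eventually (\<lambda>t. t \<in> D) (at 0)" using D by (intro eventually_at_in_open') auto
  have "\<exists>\<phi>. f i has_laurent_expansion \<phi>" if i: "i \<in> I" for i
  proof -
    have "f i analytic_on {0}" using holD[OF i] D by (auto simp: analytic_at)
    then show ?thesis using analytic_at_imp_has_fps_expansion_0 has_laurent_expansion_fps by blast
  qed
  then obtain \<phi> where \<phi>: "\<And>i. i \<in> I \<Longrightarrow> f i has_laurent_expansion \<phi> i" by metis
  have \<phi>0: "\<phi> i \<noteq> 0" if i: "i \<in> I" for i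
  proof
    assume "\<phi> i = 0"
    then have "eventually (\<lambda>t. f i t = 0) (at 0)"
      using has_laurent_expansion_eventually_zero_iff[of "f i" 0 "\<phi> i"] \<phi>[OF i] by simp
    with evD have "eventually (\<lambda>t. False) (at (0::complex))"
      by eventually_elim (use Dnz[OF i] in auto)
    then show False by simp
  qed
  have "(\<lambda>t. \<Sum>i\<in>I. of_real (\<gamma> i) * (deriv (f i) t / f i t)) has_laurent_expansion
      (\<Sum>i\<in>I. fls_const (of_real (\<gamma> i)) * (fls_deriv (\<phi> i) / \<phi> i))"
    using \<phi> by (intro laurent_expansion_intros)
  then have relF: "(\<Sum>i\<in>I. fls_const (of_real (\<gamma> i)) * (fls_deriv (\<phi> i) / \<phi> i)) = 0"
    by (rule eventually_zero_laurent) (use evD deriv0 in \<open>auto elim: eventually_mono\<close>)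
  have "fls_deriv (\<Prod>i\<in>I. \<phi> i powi p i) = 0"
    using log_relation_integer[OF I \<phi>0 alg[OF _ \<phi>] relF p] .
  then obtain C where C: "(\<Prod>i\<in>I. \<phi> i powi p i) = fls_const C"
    using fls_deriv_eq_0_iff by blast
  have "(\<lambda>t. (\<Prod>i\<in>I. f i t powi p i) - C) has_laurent_expansion ((\<Prod>i\<in>I. \<phi> i powi p i) - fls_const C)"
    using \<phi> by (intro laurent_expansion_intros)
  then have evC: "eventually (\<lambda>t. (\<Prod>i\<in>I. f i t powi p i) - C = 0) (at 0)"
    using has_laurent_expansion_eventually_zero_iff[of "\<lambda>t. (\<Prod>i\<in>I. f i t powi p i) - C" 0] C by simp
  \<comment> \<open>Away from the disc, \<open>f i\<close> may have zeros at nonreal points of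
    \<open>V\<close>. Continuation is therefore applied to the difference of numerator and
    \<open>C\<close> times denominator, which has no poles.\<close>
  define A where "A = (\<lambda>t. \<Prod>i\<in>I. f i t ^ nat (p i))"
  define B where "B = (\<lambda>t. \<Prod>i\<in>I. f i t ^ nat (- p i))"
  have AB: "(\<Prod>i\<in>I. f i t powi p i) * B t = A t" if "\<And>i. i \<in> I \<Longrightarrow> f i t \<noteq> 0" for t
    unfolding A_def B_def prod.distrib[symmetric]
    using that by (intro prod.cong refl) (auto simp: power_int_def field_simps)
  have Bnz: "B t \<noteq> 0" if "\<And>i. i \<in> I \<Longrightarrow> f i t \<noteq> 0" for t
    unfolding B_def using I that by simp
  have evAB: "eventually (\<lambda>t. A t - C * B t = 0) (at 0)"
    using evC evD
  proof eventually_elim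
    case (elim t)
    then show ?case using AB[of t] Dnz by simp
  qed
  have ABV: "A t - C * B t = 0" if t: "t \<in> V" for t
  proof (rule analytic_continuation[of "\<lambda>t. A t - C * B t" V "{t\<in>V. A t - C * B t = 0}" 0])
    show "(\<lambda>t. A t - C * B t) holomorphic_on V"
      unfolding A_def B_def using hol by (intro holomorphic_intros)
    show "connected V" using V(2) by (rule convex_connected)
    have ev: "eventually (\<lambda>t. t \<in> V \<and> A t - C * B t = 0) (at 0)"
      using evAB evD D(4) by (auto elim: eventually_elim2)
    show "0 islimpt {t\<in>V. A t - C * B t = 0}"
      unfolding islimpt_iff_eventually
    proof
      assume "eventually (\<lambda>t. t \<notin> {t\<in>V. A t - C * B t = 0}) (at 0)"
      with ev
      have "eventually (\<lambda>t. False) (at (0::complex))" by eventually_elim blast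
      then show False by simp
    qed
  qed (use V t in auto)
  \<comment> \<open>At real parameters all \<open>f i\<close> are positive, and the denominator can
    be divided out again.\<close>
  have val: "(\<Prod>i\<in>I. f i t powi p i) = C" if t: "t \<in> V" "t \<in> \<real>" for t
  proof -
    have nz: "\<And>i. i \<in> I \<Longrightarrow> f i t \<noteq> 0" using pos t by force
    have "(\<Prod>i\<in>I. f i t powi p i) * B t = C * B t" using AB[OF nz] ABV[OF t(1)] by simp
    then show ?thesis using Bnz[OF nz] by simp
  qed
  show ?thesis using val[OF V(3)] val[OF V(4)] by simp
qed

lemma alg_dep_expansion:
  assumes g: "g has_laurent_expansion y"
    and rel: "eventually (\<lambda>t. (\<Sum>a\<in>A. co a * t ^ d a * g t ^ e a) = 0) (at 0)"
    and w: "(\<Sum>a\<in>A. co a * w ^ e a) \<noteq> 0"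
  shows "alg_dep fls_X y"
proof -
  have "(\<lambda>t. \<Sum>a\<in>A. co a * t ^ d a * g t ^ e a) has_laurent_expansion
     (\<Sum>a\<in>A. fls_const (co a) * fls_X ^ d a * y ^ e a)"
    using g by (intro laurent_expansion_intros) (simp add: has_laurent_expansion_fps_X)
  then have "(\<Sum>a\<in>A. fls_const (co a) * fls_X ^ d a * y ^ e a) = 0"
    using rel by (rule eventually_zero_laurent)
  then show ?thesis using w by (rule alg_dep_relation)
qed

text \<open>On a line through 0 every monomial is a constant times a power of \<open>t\<close> and a
  power of the last coordinate, the shape that \<open>alg_dep_expansion\<close> expects.\<close>

lemma peval_upd_split:
  assumes z: "z \<in> cvec n"
  shows "peval P ((cline (\<lambda>_. 0) z t)(n := w)) = (\<Sum>a\<in>Poly_Mapping.keys P.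
     (Poly_Mapping.lookup P a * (\<Prod>i\<in>Poly_Mapping.keys a - {n}. z i ^ Poly_Mapping.lookup a i))
     * t ^ (\<Sum>i\<in>Poly_Mapping.keys a - {n}. Poly_Mapping.lookup a i) * w ^ Poly_Mapping.lookup a n)"
  unfolding peval_def
proof (intro sum.cong refl)
  fix a
  let ?x = "(cline (\<lambda>_. 0) z t)(n := w)"
  have "(\<Prod>i\<in>Poly_Mapping.keys a. ?x i ^ Poly_Mapping.lookup a i)
      = (\<Prod>i\<in>insert n (Poly_Mapping.keys a). ?x i ^ Poly_Mapping.lookup a i)"
    by (rule prod.mono_neutral_left) (auto simp: in_keys_iff)
  also have "\<dots> = ?x n ^ Poly_Mapping.lookup a n * (\<Prod>i\<in>Poly_Mapping.keys a - {n}. ?x i ^ Poly_Mapping.lookup a i)"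
    by (subst prod.insert_remove) simp_all
  also have "(\<Prod>i\<in>Poly_Mapping.keys a - {n}. ?x i ^ Poly_Mapping.lookup a i)
      = (\<Prod>i\<in>Poly_Mapping.keys a - {n}. t ^ Poly_Mapping.lookup a i * z i ^ Poly_Mapping.lookup a i)"
    by (intro prod.cong refl) (auto simp: cline_def power_mult_distrib)
  also have "\<dots> = t ^ (\<Sum>i\<in>Poly_Mapping.keys a - {n}. Poly_Mapping.lookup a i)
      * (\<Prod>i\<in>Poly_Mapping.keys a - {n}. z i ^ Poly_Mapping.lookup a i)"
    by (simp add: prod.distrib power_sum)
  finally show "Poly_Mapping.lookup P a * (\<Prod>i\<in>Poly_Mapping.keys a. ?x i ^ Poly_Mapping.lookup a i)
      = (Poly_Mapping.lookup P a * (\<Prod>i\<in>Poly_Mapping.keys a - {n}. z i ^ Poly_Mapping.lookup a i))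
     * t ^ (\<Sum>i\<in>Poly_Mapping.keys a - {n}. Poly_Mapping.lookup a i) * w ^ Poly_Mapping.lookup a n"
    by (simp add: ac_simps)
qed

text \<open>By \<open>nz\<close> the equation is not identically zero in its last variable at the
  endpoint t = 1, so its restriction to the line is a nontrivial relation. Conjugating the
  coefficients gives one for the reflected function.\<close>

lemma algebraic_on_line:
  assumes z: "z \<in> cvec n" and V: "open V" "0 \<in> V" "\<And>t. t \<in> V \<Longrightarrow> peval P ((cline (\<lambda>_. 0) z t)(n := g t)) = 0"
    and nz: "peval P (z(n := w)) \<noteq> 0"
  shows "g has_laurent_expansion y \<Longrightarrow> alg_dep fls_X y"
    and "(\<lambda>t. cnj (g (cnj t))) has_laurent_expansion y \<Longrightarrow> alg_dep fls_X y"
proof -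
  define co where "co = (\<lambda>a. Poly_Mapping.lookup P a * (\<Prod>i\<in>Poly_Mapping.keys a - {n}. z i ^ Poly_Mapping.lookup a i))"
  define d where "d = (\<lambda>a::nat \<Rightarrow>\<^sub>0 nat. \<Sum>i\<in>Poly_Mapping.keys a - {n}. Poly_Mapping.lookup a i)"
  define e where "e = (\<lambda>a::nat \<Rightarrow>\<^sub>0 nat. Poly_Mapping.lookup a n)"
  let ?A = "Poly_Mapping.keys P"
  have pe: "peval P ((cline (\<lambda>_. 0) z t)(n := w)) = (\<Sum>a\<in>?A. co a * t ^ d a * w ^ e a)" for t w
    unfolding peval_upd_split[OF z] co_def d_def e_def ..
  have "cline (\<lambda>_. 0) z 1 = z" by (simp add: cline_def)
  then have w: "(\<Sum>a\<in>?A. co a * w ^ e a) \<noteq> 0" using nz pe[of 1 w] by simp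
  have rel: "eventually (\<lambda>t. (\<Sum>a\<in>?A. co a * t ^ d a * g t ^ e a) = 0) (at 0)"
    using eventually_at_in_open'[OF V(1,2)] by eventually_elim (use V(3) pe in auto)
  show "g has_laurent_expansion y \<Longrightarrow> alg_dep fls_X y"
    using alg_dep_expansion[OF _ rel w] .
  have openV': "open (cnj -` V)" using V(1) by (intro open_vimage) (auto intro: continuous_intros)
  have "eventually (\<lambda>t. t \<in> cnj -` V) (at 0)" by (rule eventually_at_in_open'[OF openV']) (use V in simp)
  then have rel': "eventually (\<lambda>t. (\<Sum>a\<in>?A. cnj (co a) * t ^ d a * (cnj (g (cnj t))) ^ e a) = 0) (at 0)"
  proof eventually_elim
    case (elim t)
    then have "(\<Sum>a\<in>?A. co a * cnj t ^ d a * g (cnj t) ^ e a) = 0" using V(3)[of "cnj t"] pe by simp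
    then have "cnj (\<Sum>a\<in>?A. co a * cnj t ^ d a * g (cnj t) ^ e a) = 0" by simp
    then show ?case by simp
  qed
  have "(\<Sum>a\<in>?A. cnj (co a) * (cnj w) ^ e a) = cnj (\<Sum>a\<in>?A. co a * w ^ e a)" by simp
  then have w': "(\<Sum>a\<in>?A. cnj (co a) * (cnj w) ^ e a) \<noteq> 0" using w by (metis complex_cnj_zero_iff)
  show "(\<lambda>t. cnj (g (cnj t))) has_laurent_expansion y \<Longrightarrow> alg_dep fls_X y"
    using alg_dep_expansion[OF _ rel' w'] .
qed

text \<open>\<open>R\<close> is the leading coefficient of \<open>P\<close> in its last variable.
  Its zeros are the endpoints for which the equation might degenerate.\<close>

lemma exists_generic_lead_coeff:
  assumes P: "P \<noteq> 0" "pvars P \<subseteq> {0..n}"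
  shows "\<exists>R\<in>mpolys n. R \<noteq> 0 \<and> (\<forall>z. peval R z \<noteq> 0 \<longrightarrow> (\<exists>w. peval P (z(n := w)) \<noteq> 0))"
proof -
  define S where "S = split_var n P"
  have Pm: "P \<in> mpolys (Suc n)" using P(2) by (auto simp: mpolys_def)
  have S: "S \<in> polys_over (mpolys n)" unfolding S_def by (rule split_var_mpolys_Suc[OF Pm])
  have "lead_coeff S \<noteq> 0" using P(1) by (simp add: S_def split_var_eq_0_iff)
  moreover have "\<exists>w. peval P (z(n := w)) \<noteq> 0" if z: "peval (lead_coeff S) z \<noteq> 0" for z
  proof -
    define Q where "Q = map_poly (\<lambda>c. peval c z) S"
    have "coeff Q (degree S) \<noteq> 0" using z by (simp add: Q_def coeff_map_poly)
    then have "Q \<noteq> 0" by auto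
    then obtain w where w: "poly Q w \<noteq> 0" by (metis poly_all_0_iff_0)
    have ev: "peval (coeff S k) (z(n := w)) = peval (coeff S k) z" for k
      using S by (intro peval_cong) (auto simp: polys_over_def mpolys_def)
    have "peval P (z(n := w)) = peval (join n S) (z(n := w))" by (simp add: S_def split_var)
    also have "\<dots> = (\<Sum>k\<le>degree S. peval (coeff S k) z * w ^ k)"
      unfolding join_def poly_altdef by (simp add: peval_sum peval_mult peval_power ev)
    also have "\<dots> = poly Q w"
      unfolding Q_def poly_altdef
      by (rule sum.mono_neutral_cong_right) (auto simp: coeff_map_poly map_poly_degree_leq intro!: le_degree)
    finally show ?thesis using w by metis
  qed
  ultimately show ?thesis using S by (intro bexI[of _ "lead_coeff S"]) (auto simp: polys_over_def)
qed

section \<open>The integer relation\<close>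

lemma common_denominator:
  assumes "finite S"
  shows "\<exists>D>0. \<forall>x\<in>S. \<exists>k::int. of_nat D * x = (of_int k :: rat)"
  using assms
proof (induction S rule: finite_induct)
  case (insert x S)
  then obtain D where D: "D > 0" "\<forall>x\<in>S. \<exists>k::int. of_nat D * x = (of_int k :: rat)" by blast
  obtain a b where ab: "quotient_of x = (a, b)" by fastforce
  then have b: "b > 0" "x = of_int a / of_int b" using quotient_of_denom_pos quotient_of_div by auto
  have "of_nat (D * nat b) * x = of_int (int D * a)" using b by simp
  moreover have "\<exists>k::int. of_nat (D * nat b) * y = (of_int k :: rat)" if y: "y \<in> S" for y
  proof -
    obtain k where "of_nat D * y = (of_int k :: rat)" using D(2) y by blast
    then have "of_nat (D * nat b) * y = of_int (b * k)" using b(1) by (simp add: algebra_simps)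
    then show ?thesis by blast
  qed
  ultimately have "\<forall>y\<in>insert x S. \<exists>k::int. of_nat (D * nat b) * y = (of_int k :: rat)" by blast
  moreover have "D * nat b > 0" using D(1) b(1) by simp
  ultimately show ?case by blast
qed (auto intro: exI[of _ 1])

lemma cconj_zero [simp]: "cconj (\<lambda>_. 0) = (\<lambda>_. 0)"
  by (simp add: cconj_def)

lemma hdot_diag: "hdot N F z (cconj z) = of_real (sqnorm N F z)"
  by (simp add: hdot_def sqnorm_def complex_norm_square[symmetric])

lemma sqnorm_nonneg: "sqnorm N F z \<ge> 0"
  by (simp add: sqnorm_def sum_nonneg)

text \<open>The maps F and G of the theorem form one family, the latter with exponents \<open>c i < 0\<close>.\<close>

locale kernel_relation =
  fixes n M :: nat and h :: mpoly and \<rho> r :: real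
    and N :: "nat \<Rightarrow> nat" and F :: "nat \<Rightarrow> (nat \<Rightarrow> complex) \<Rightarrow> nat \<Rightarrow> complex"
    and c :: "nat \<Rightarrow> real"
  assumes h_mem: "h \<in> mpolys (2 * n)"
    and h_irr: "irreducible h"
    and h_pos: "z \<in> cvec n \<Longrightarrow> Im (peval2 n h z (cconj z)) = 0 \<and> Re (peval2 n h z (cconj z)) > 0"
    and rho: "\<rho> > 0"
    and F_holo: "i < M \<Longrightarrow> k < N i \<Longrightarrow> holo_on n (cball0 n \<rho>) (\<lambda>z. F i z k)"
    and F_alg: "i < M \<Longrightarrow> k < N i \<Longrightarrow> \<exists>P::mpoly. P \<noteq> 0 \<and> pvars P \<subseteq> {0..n} \<and>
      (\<forall>z\<in>cball0 n \<rho>. peval P (z(n := F i z k)) = 0)"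
    and F_nonconst: "i < M \<Longrightarrow> nonconst_map_on (cball0 n \<rho>) (N i) (F i)"
    and indep: "\<forall>i<M. q i \<ge> 0 \<Longrightarrow> (\<Sum>i<M. of_rat (q i) * c i) = 0 \<Longrightarrow> \<forall>i<M. q i = 0"
    and eq: "z \<in> cball0 n \<rho> \<Longrightarrow> Re (peval2 n h z (cconj z)) powr r =
      (\<Prod>i<M. (1 + sqnorm (N i) (F i) z) powr c i)"
begin

abbreviation "B \<equiv> cball0 n \<rho>"
abbreviation "H \<equiv> peval2 n h"

definition K :: "nat \<Rightarrow> (nat \<Rightarrow> complex) \<Rightarrow> (nat \<Rightarrow> complex) \<Rightarrow> complex" where
  "K i z \<xi> = 1 + hdot (N i) (F i) z \<xi>"

lemma B_cvec: "z \<in> B \<Longrightarrow> z \<in> cvec n"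
  by (simp add: cball0_def)

lemma zero_B: "(\<lambda>_. 0) \<in> B"
  using cball0_zero[OF rho] .

lemma K_diag: "K i z (cconj z) = of_real (1 + sqnorm (N i) (F i) z)"
  by (simp add: K_def hdot_diag)

lemma K_diag_pos: "1 + sqnorm (N i) (F i) z > 0"
  using sqnorm_nonneg[of "N i" "F i" z] by linarith

lemma H_diag: "z \<in> cvec n \<Longrightarrow> H z (cconj z) = of_real (Re (H z (cconj z)))"
  using h_pos[of z] by (simp add: complex_eq_iff)

lemma sesqui_holo_K: "i < M \<Longrightarrow> sesqui_holo n \<rho> (K i)"
  unfolding K_def[abs_def] using F_holo by (intro sesqui_holo_add sesqui_holo_const sesqui_holo_hdot)

lemma eq_ln:
  assumes z: "z \<in> B"
  shows "r * ln (Re (H z (cconj z))) = (\<Sum>i<M. c i * ln (1 + sqnorm (N i) (F i) z))"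
proof -
  have nz: "(1 + sqnorm (N i) (F i) z) powr c i > 0" for i using K_diag_pos[of i z] by simp
  have "r * ln (Re (H z (cconj z))) = ln (Re (H z (cconj z)) powr r)"
    using h_pos[OF B_cvec[OF z]] by (simp add: ln_powr)
  also have "\<dots> = (\<Sum>i<M. ln ((1 + sqnorm (N i) (F i) z) powr c i))"
    unfolding eq[OF z] using nz by (intro ln_prod) auto
  also have "\<dots> = (\<Sum>i<M. c i * ln (1 + sqnorm (N i) (F i) z))"
    using K_diag_pos by (intro sum.cong refl ln_powr)
  finally show ?thesis .
qed

text \<open>On the line the kernel is 1 plus a sum of products of component functions and their
  reflections, all of them algebraic.\<close>

lemma line_expansion_alg_dep:
  assumes i: "i < M" and z: "z \<in> B"
    and gen: "\<And>k. k < N i \<Longrightarrow> \<exists>P w. (\<forall>z\<in>B. peval P (z(n := F i z k)) = 0) \<and> peval P (z(n := w)) \<noteq> 0"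
    and \<phi>: "(\<lambda>t. K i (cline (\<lambda>_. 0) z t) (cline (\<lambda>_. 0) (cconj z) t)) has_laurent_expansion \<phi>"
  shows "alg_dep fls_X \<phi>"
proof -
  let ?V = "cslice n \<rho> (\<lambda>_. 0) z"
  have 0: "(\<lambda>_. 0) \<in> cvec n" by (simp add: cvec_def)
  have V: "open ?V" using open_cslice[OF 0 B_cvec[OF z]] .
  have V0: "0 \<in> ?V" using zero_B by (simp add: cslice_def cline_def)
  define g where "g = (\<lambda>k t. F i (cline (\<lambda>_. 0) z t) k)"
  have ex: "\<exists>y y'. g k has_laurent_expansion y \<and> (\<lambda>t. cnj (g k (cnj t))) has_laurent_expansion y'
      \<and> alg_dep fls_X y \<and> alg_dep fls_X y'" if k: "k < N i" for k
  proof -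
    have hol: "g k holomorphic_on ?V"
      unfolding g_def by (rule holo_on_cline[OF F_holo[OF i k] 0 B_cvec[OF z]])
    then have "g k analytic_on {0}" using V V0 by (auto simp: analytic_at)
    then obtain y where y: "g k has_laurent_expansion y"
      using analytic_at_imp_has_fps_expansion_0 has_laurent_expansion_fps by blast
    have V': "open (cnj -` ?V)" using V by (intro open_vimage) (auto intro: continuous_intros)
    have "cnj ` (cnj -` ?V) \<subseteq> ?V" by auto
    then have "g k holomorphic_on cnj ` (cnj -` ?V)" using hol holomorphic_on_subset by blast
    then have "cnj \<circ> g k \<circ> cnj holomorphic_on (cnj -` ?V)"
      by (rule holomorphic_on_compose_cnj_cnj[OF _ V'])
    then have "(\<lambda>t. cnj (g k (cnj t))) holomorphic_on (cnj -` ?V)" by (simp add: o_def)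
    moreover have "0 \<in> cnj -` ?V" using V0 by simp
    ultimately have "(\<lambda>t. cnj (g k (cnj t))) analytic_on {0}" using V' by (auto simp: analytic_at)
    then obtain y' where y': "(\<lambda>t. cnj (g k (cnj t))) has_laurent_expansion y'"
      using analytic_at_imp_has_fps_expansion_0 has_laurent_expansion_fps by blast
    obtain P w where Pw: "\<forall>z\<in>B. peval P (z(n := F i z k)) = 0" "peval P (z(n := w)) \<noteq> 0"
      using gen[OF k] by blast
    have P0: "peval P ((cline (\<lambda>_. 0) z t)(n := g k t)) = 0" if "t \<in> ?V" for t
      using Pw(1) that by (simp add: g_def cslice_def)
    show ?thesis using y y' algebraic_on_line[OF B_cvec[OF z] V V0 P0 Pw(2)] by blast
  qed
  then obtain y y' where yy: "\<And>k. k < N i \<Longrightarrow> g k has_laurent_expansion y k"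
     "\<And>k. k < N i \<Longrightarrow> (\<lambda>t. cnj (g k (cnj t))) has_laurent_expansion y' k"
     "\<And>k. k < N i \<Longrightarrow> alg_dep fls_X (y k)" "\<And>k. k < N i \<Longrightarrow> alg_dep fls_X (y' k)"
    by metis
  have "(\<lambda>t. 1 + (\<Sum>k<N i. g k t * cnj (g k (cnj t)))) has_laurent_expansion (fls_const 1 + (\<Sum>k<N i. y k * y' k))"
    using yy(1,2) by (intro laurent_expansion_intros) auto
  moreover have "(\<lambda>t. 1 + (\<Sum>k<N i. g k t * cnj (g k (cnj t))))
      = (\<lambda>t. K i (cline (\<lambda>_. 0) z t) (cline (\<lambda>_. 0) (cconj z) t))"
    by (rule ext) (simp add: K_def hdot_def g_def cconj_cline)
  ultimately have "\<phi> = fls_const 1 + (\<Sum>k<N i. y k * y' k)"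
    using has_laurent_expansion_unique[OF \<phi>] by metis
  then show ?thesis
    using yy(3,4) by (auto intro!: alg_dep_X_closed alg_dep_X_sum simp: alg_dep_X_const simp del: fls_const_1)
qed

lemma H_line_expansion_alg_dep:
  assumes "(\<lambda>t. H (cline \<alpha> \<beta> t) (cline \<alpha>' \<beta>' t)) has_laurent_expansion \<phi>"
  shows "alg_dep fls_X \<phi>"
proof -
  obtain E :: "complex poly" where E: "\<forall>t. poly E t = H (cline \<alpha> \<beta> t) (cline \<alpha>' \<beta>' t)"
    using peval2_cline_poly by blast
  have "(\<lambda>t. \<Sum>i\<le>degree E. coeff E i * t ^ i) has_laurent_expansion
      (\<Sum>i\<le>degree E. fls_const (coeff E i) * fls_X ^ i)"
    by (intro laurent_expansion_intros)
  then have "(\<lambda>t. H (cline \<alpha> \<beta> t) (cline \<alpha>' \<beta>' t)) has_laurent_expansion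
      (\<Sum>i\<le>degree E. fls_const (coeff E i) * fls_X ^ i)"
    using E by (simp add: poly_altdef)
  then have "\<phi> = (\<Sum>i\<le>degree E. fls_const (coeff E i) * fls_X ^ i)"
    using has_laurent_expansion_unique[OF assms] by blast
  then show ?thesis
    by (auto intro!: alg_dep_X_sum alg_dep_X_closed alg_dep_X_power alg_dep_X_const alg_dep_X_X)
qed

text \<open>The line from 0 to \<open>z\<close> links the two sides. The integers \<open>p\<close>
  and \<open>q\<close> have to annihilate the integer relations between the \<open>c i\<close> and
  \<open>- r\<close>, as their images under the rational functional do.\<close>

lemma generic_relation:
  assumes z: "z \<in> B"
    and gen: "\<And>i k. i < M \<Longrightarrow> k < N i \<Longrightarrow>
       \<exists>P w. (\<forall>z\<in>B. peval P (z(n := F i z k)) = 0) \<and> peval P (z(n := w)) \<noteq> 0"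
    and p: "\<And>k :: nat \<Rightarrow> int. (\<Sum>i<M. c i * of_int (k i)) = r * of_int (k M) \<Longrightarrow>
      (\<Sum>i<M. p i * k i) + q * k M = 0"
  shows "(\<Prod>i<M. K i z (cconj z) powi p i) * H z (cconj z) powi q
    = (\<Prod>i<M. K i (\<lambda>_. 0) (\<lambda>_. 0) powi p i) * H (\<lambda>_. 0) (\<lambda>_. 0) powi q"
proof -
  have 0: "(\<lambda>_. 0) \<in> cvec n" by (simp add: cvec_def)
  define V where "V = csym_slice n \<rho> (\<lambda>_. 0) z"
  define f where "f = (\<lambda>i t. (if i < M then K i else H) (cline (\<lambda>_. 0) z t) (cline (\<lambda>_. 0) (cconj z) t))"
  \<comment> \<open>Index \<open>M\<close> stands for \<open>H\<close>, which is moved to the side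
    of the kernels and so has coefficient \<open>- r\<close>.\<close>
  define \<gamma> where "\<gamma> = (\<lambda>i. if i < M then c i else - r)"
  define p' where "p' = (\<lambda>i. if i < M then p i else q)"
  have split: "{..M} = insert M {..<M}" by auto
  have c1: "cline (\<lambda>_. 0) w 1 = w" "cline (\<lambda>_. 0) w 0 = (\<lambda>_. 0)" for w by (simp_all add: cline_def)
  have "(\<Prod>i\<in>{..M}. f i 1 powi p' i) = (\<Prod>i\<in>{..M}. f i 0 powi p' i)"
  proof (rule line_log_relation[where V = V and \<gamma> = \<gamma>])
    show "open V" "convex V"
      unfolding V_def using open_csym_slice[OF 0 B_cvec[OF z]] convex_csym_slice[OF 0 B_cvec[OF z]] by auto
    show "0 \<in> V" "1 \<in> V" using z zero_B by (simp_all add: V_def csym_slice_def cslice_def c1)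
    show "f i holomorphic_on V" if "i \<in> {..M}" for i
    proof -
      have "sesqui_holo n \<rho> (if i < M then K i else H)" using sesqui_holo_K sesqui_holo_peval2 by simp
      then show ?thesis unfolding f_def V_def sesqui_holo_def using 0 B_cvec[OF z] cconj_zero by metis
    qed
    have real: "cline (\<lambda>_. 0) z t \<in> B \<and> f i t = of_real (if i < M then 1 + sqnorm (N i) (F i) (cline (\<lambda>_. 0) z t)
        else Re (H (cline (\<lambda>_. 0) z t) (cconj (cline (\<lambda>_. 0) z t))))" if t: "t \<in> V" "t \<in> \<real>" for i t
    proof -
      have zt: "cline (\<lambda>_. 0) z t \<in> B" using t by (simp add: V_def csym_slice_def cslice_def)
      have "cnj t = t" using t(2) by (simp add: Reals_cnj_iff)
      then have "cline (\<lambda>_. 0) (cconj z) t = cconj (cline (\<lambda>_. 0) z t)"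
        by (simp add: cconj_cline)
      then show ?thesis using zt H_diag[OF B_cvec[OF zt]] K_diag by (simp add: f_def)
    qed
    show "f i t \<in> \<real> \<and> Re (f i t) > 0" if "t \<in> V" "t \<in> \<real>" for i t
      using real[OF that, of i] K_diag_pos h_pos B_cvec by auto
    show "(\<Sum>i\<in>{..M}. \<gamma> i * ln (Re (f i t))) = 0" if t: "t \<in> V" "t \<in> \<real>" for t
    proof -
      have "(\<Sum>i<M. \<gamma> i * ln (Re (f i t))) = r * ln (Re (f M t))"
        using eq_ln[of "cline (\<lambda>_. 0) z t"] real[OF t] by (simp add: \<gamma>_def)
      then show ?thesis unfolding split by (simp add: \<gamma>_def)
    qed
    show "alg_dep fls_X \<phi>" if "i \<in> {..M}" "f i has_laurent_expansion \<phi>" for i \<phi>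
    proof (cases "i < M")
      case True
      then show ?thesis using line_expansion_alg_dep[OF True z gen[OF True]] that(2) by (simp add: f_def)
    next
      case False
      then show ?thesis using H_line_expansion_alg_dep that(2) by (simp add: f_def)
    qed
    show "(\<Sum>i\<in>{..M}. p' i * k i) = 0" if "(\<Sum>i\<in>{..M}. \<gamma> i * real_of_int (k i)) = 0" for k :: "nat \<Rightarrow> int"
    proof -
      have "(\<Sum>i<M. c i * of_int (k i)) = r * of_int (k M)" using that unfolding split by (simp add: \<gamma>_def)
      then show ?thesis using p[of k] unfolding split by (simp add: p'_def)
    qed
  qed simp
  then show ?thesis unfolding split by (simp add: f_def p'_def c1 mult.commute)
qed

text \<open>The exponent of \<open>H\<close> is split into its negative part \<open>q1\<close> and
  its positive part \<open>q2\<close>, one of which is 0: off the diagonal \<open>H\<close> may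
  vanish, and only an identity without denominators can be continued there.\<close>

theorem integer_relation:
  "\<exists>p q1 q2 C. (\<forall>i<M. p i \<ge> (1::nat)) \<and> (q1 = (0::nat) \<or> q2 = (0::nat)) \<and> C > 0 \<and>
    (\<forall>z\<in>B. \<forall>\<xi>\<in>B. (\<Prod>i<M. K i z \<xi> ^ p i) * H z \<xi> ^ q2 = complex_of_real C * H z \<xi> ^ q1)"
proof -
  have "rat_real.subspace {0}" by (rule rat_real.subspace_single_0)
  moreover have "\<forall>i<M. q i = 0" if "\<forall>i<M. q i \<ge> 0" "(\<Sum>i<M. of_rat (q i) * c i) \<in> {0}" for q
    using indep[of q] that by simp
  ultimately obtain \<phi> where \<phi>: "rat_linear \<phi>" "\<forall>i<M. \<phi> (c i) > 0"
    using gordan_rat[of "{0}" M c] by blast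
  have scl: "\<phi> (of_rat a * y) = a * \<phi> y" for a y
    using rat_pair.linear_scale[OF \<phi>(1)] .
  obtain D where D: "D > 0" "\<forall>x\<in>insert (\<phi> r) ((\<phi> \<circ> c) ` {..<M}). \<exists>k::int. of_nat D * x = (of_int k :: rat)"
    using common_denominator[of "insert (\<phi> r) ((\<phi> \<circ> c) ` {..<M})"] by blast
  \<comment> \<open>The sign is reversed because \<open>H\<close> stands on the side of the
    kernels.\<close>
  then obtain q where q: "of_nat D * \<phi> r = of_int (- q)" by (metis insertI1 minus_minus)
  have "\<forall>i. \<exists>k. i < M \<longrightarrow> of_nat D * \<phi> (c i) = of_int k" using D(2) by auto
  then obtain p0 where p0: "\<And>i. i < M \<Longrightarrow> of_nat D * \<phi> (c i) = of_int (p0 i)" by metis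
  have p0pos: "p0 i > 0" if i: "i < M" for i
  proof -
    have "(0::rat) < of_int (p0 i)" unfolding p0[OF i, symmetric] using D(1) \<phi>(2) i by simp
    then show ?thesis by simp
  qed
  \<comment> \<open>\<open>\<phi>\<close> maps the relation between the real exponents to one
    between rationals; the common denominator \<open>D\<close> makes it integral.\<close>
  have ortho: "(\<Sum>i<M. p0 i * k i) + q * k M = 0"
    if k: "(\<Sum>i<M. c i * of_int (k i)) = r * of_int (k M)" for k :: "nat \<Rightarrow> int"
  proof -
    have "\<phi> (\<Sum>i<M. of_rat (of_int (k i)) * c i) = \<phi> (of_rat (of_int (k M)) * r)"
      using k by (simp add: mult.commute)
    then have "(\<Sum>i<M. of_int (k i) * \<phi> (c i)) = of_int (k M) * \<phi> r"
      by (simp only: rat_pair.linear_sum[OF \<phi>(1)] scl)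
    then have "of_nat D * (\<Sum>i<M. of_int (k i) * \<phi> (c i)) = of_nat D * (of_int (k M) * \<phi> r)" by simp
    then have "(\<Sum>i<M. of_int (k i) * (of_nat D * \<phi> (c i))) = of_int (k M) * (of_nat D * \<phi> r)"
      by (simp only: sum_distrib_left mult.left_commute)
    then have "(\<Sum>i<M. of_int (k i) * of_int (p0 i)) = (of_int (k M) * of_int (- q) :: rat)"
      using p0 q by simp
    then have "of_int (\<Sum>i<M. k i * p0 i) = (of_int (k M * - q) :: rat)" by simp
    then have "(\<Sum>i<M. k i * p0 i) = k M * - q" unfolding of_int_eq_iff .
    then show ?thesis by (simp add: mult.commute)
  qed
  define p where "p = (\<lambda>i. nat (p0 i))"
  define q1 where "q1 = nat (- q)"
  define q2 where "q2 = nat q"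
  have q12: "q = int q2 - int q1" "q1 = 0 \<or> q2 = 0" by (auto simp: q1_def q2_def)
  define Cc where "Cc = (\<Prod>i<M. K i (\<lambda>_. 0) (\<lambda>_. 0) powi p0 i) * H (\<lambda>_. 0) (\<lambda>_. 0) powi q"
  define C where "C = (\<Prod>i<M. (1 + sqnorm (N i) (F i) (\<lambda>_. 0)) powi p0 i) * Re (H (\<lambda>_. 0) (\<lambda>_. 0)) powi q"
  have 0: "(\<lambda>_. 0) \<in> cvec n" by (simp add: cvec_def)
  have Cc: "Cc = of_real C"
    unfolding Cc_def C_def using K_diag[of _ "\<lambda>_. 0"] H_diag[OF 0] by simp
  have C: "C > 0" unfolding C_def
    using K_diag_pos h_pos[OF 0] by (intro mult_pos_pos prod_pos) auto
  have powi: "K i z \<xi> powi p0 i = K i z \<xi> ^ p i" if "i < M" for i z \<xi>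
    using p0pos[OF that] by (simp add: power_int_def p_def)
  define \<Theta> where "\<Theta> = (\<lambda>z \<xi>. (\<Prod>i<M. K i z \<xi> ^ p i) * H z \<xi> ^ q2 - complex_of_real C * H z \<xi> ^ q1)"
  have sesq: "sesqui_holo n \<rho> \<Theta>" unfolding \<Theta>_def
    by (intro sesqui_holo_diff sesqui_holo_mult sesqui_holo_prod sesqui_holo_power sesqui_holo_K
        sesqui_holo_peval2 sesqui_holo_const) auto
  have "\<forall>i k. \<exists>P R. i < M \<longrightarrow> k < N i \<longrightarrow> R \<in> mpolys n \<and> R \<noteq> 0 \<and> (\<forall>z\<in>B. peval P (z(n := F i z k)) = 0)
      \<and> (\<forall>z. peval R z \<noteq> 0 \<longrightarrow> (\<exists>w. peval P (z(n := w)) \<noteq> 0))"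
    using F_alg exists_generic_lead_coeff by metis
  then obtain P R where R: "\<And>i k. i < M \<Longrightarrow> k < N i \<Longrightarrow> R i k \<in> mpolys n \<and> R i k \<noteq> 0
      \<and> (\<forall>z\<in>B. peval (P i k) (z(n := F i z k)) = 0)
      \<and> (\<forall>z. peval (R i k) z \<noteq> 0 \<longrightarrow> (\<exists>w. peval (P i k) (z(n := w)) \<noteq> 0))"
    by metis
  \<comment> \<open>The line to \<open>z\<close> is good when no \<open>R i k\<close> vanishes at
    \<open>z\<close>; the product collects these conditions into one.\<close>
  define RR where "RR = (\<Prod>i<M. \<Prod>k<N i. R i k)"
  have RR: "RR \<in> mpolys n" "RR \<noteq> 0"
    unfolding RR_def using R by (auto intro!: mpolys_prod)
  have generic: "\<Theta> z (cconj z) = 0" if z: "z \<in> B" and gen: "peval RR z \<noteq> 0" for z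
  proof -
    have "peval (R i k) z \<noteq> 0" if "i < M" "k < N i" for i k
      using gen that by (auto simp: RR_def peval_prod)
    then have "\<exists>P w. (\<forall>z\<in>B. peval P (z(n := F i z k)) = 0) \<and> peval P (z(n := w)) \<noteq> 0"
      if "i < M" "k < N i" for i k
      using R[OF that] that by blast
    then have "(\<Prod>i<M. K i z (cconj z) powi p0 i) * H z (cconj z) powi q = of_real C"
      unfolding Cc[symmetric] Cc_def using ortho by (rule generic_relation[OF z])
    moreover have "(\<Prod>i<M. K i z (cconj z) powi p0 i) = (\<Prod>i<M. K i z (cconj z) ^ p i)"
      using powi by simp
    moreover have "H z (cconj z) powi q = H z (cconj z) ^ q2 / H z (cconj z) ^ q1"
    proof -
      have "H z (cconj z) \<noteq> 0" using h_pos[OF B_cvec[OF z]] by auto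
      then show ?thesis unfolding q12(1) by (simp add: power_int_diff)
    qed
    moreover have "H z (cconj z) \<noteq> 0" using h_pos[OF B_cvec[OF z]] by auto
    ultimately show ?thesis by (simp add: \<Theta>_def field_simps)
  qed
  obtain b0 where b0: "peval RR b0 \<noteq> 0" using exists_peval_nonzero[OF RR] by blast
  define b where "b = (\<lambda>i. if i < n then b0 i else 0)"
  have b: "b \<in> cvec n" by (simp add: b_def cvec_def)
  have "peval RR b = peval RR b0"
    using RR(1) by (intro peval_cong) (auto simp: b_def mpolys_def)
  then have bRR: "peval RR b \<noteq> 0" using b0 by simp
  have diag: "\<Theta> z (cconj z) = 0" if z: "z \<in> B" for z
  proof -
    \<comment> \<open>\<open>RR\<close> is nonzero at \<open>b\<close>, so it has finitely many
      zeros on the line from \<open>z\<close> to \<open>b\<close>. The identity holds at the other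
      real parameters and is continued to \<open>z\<close>.\<close>
    define \<beta> where "\<beta> = (\<lambda>i. b i - z i)"
    have \<beta>: "\<beta> \<in> cvec n" using b B_cvec[OF z] by (simp add: \<beta>_def cvec_def)
    define V where "V = csym_slice n \<rho> z \<beta>"
    have c0: "cline z \<beta> 0 = z" "cline (cconj z) (cconj \<beta>) 0 = cconj z" by (simp_all add: cline_def)
    have V0: "0 \<in> V" using z by (simp add: V_def csym_slice_def cslice_def c0)
    have V: "open V" "connected V"
      unfolding V_def using open_csym_slice[OF B_cvec[OF z] \<beta>] convex_csym_slice[OF B_cvec[OF z] \<beta>]
      by (auto intro: convex_connected)
    obtain E :: "complex poly" where E: "\<forall>t. poly E t = peval RR (cline z \<beta> t)"
      using peval_cline_poly by blast
    have "cline z \<beta> 1 = b" by (simp add: cline_def \<beta>_def)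
    then have E0: "E \<noteq> 0" using E bRR by (metis poly_0)
    \<comment> \<open>0 is kept, although \<open>RR\<close> may vanish at \<open>z\<close>, so that
      it is still a limit point of good real parameters; it is taken out of the test set
      below.\<close>
    define V' where "V' = V - ({t. poly E t = 0} - {0})"
    have V': "open V'" "0 \<in> V'"
      using V(1) V0 poly_roots_finite[OF E0] by (auto simp: V'_def intro!: open_Diff finite_imp_closed)
    let ?g = "\<lambda>t. \<Theta> (cline z \<beta> t) (cline (cconj z) (cconj \<beta>) t)"
    have "?g 0 = 0"
    proof (rule analytic_continuation[of ?g V "{t\<in>V'. t \<in> \<real>} - {0}" 0])
      show "(\<lambda>t. \<Theta> (cline z \<beta> t) (cline (cconj z) (cconj \<beta>) t)) holomorphic_on V"
        using sesq B_cvec[OF z] \<beta> by (simp add: sesqui_holo_def V_def)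
      show "0 islimpt {t\<in>V'. t \<in> \<real>} - {0}"
        using zero_islimpt_real[OF V'] by (simp add: islimpt_def) blast
      fix t assume t: "t \<in> {t\<in>V'. t \<in> \<real>} - {0}"
      then have "cnj t = t" "t \<in> V" by (auto simp: Reals_cnj_iff V'_def)
      then have "cline (cconj z) (cconj \<beta>) t = cconj (cline z \<beta> t)" "cline z \<beta> t \<in> B"
        by (simp_all add: cconj_cline V_def csym_slice_def cslice_def)
      moreover have "peval RR (cline z \<beta> t) \<noteq> 0" using t E by (auto simp: V'_def)
      ultimately show "\<Theta> (cline z \<beta> t) (cline (cconj z) (cconj \<beta>) t) = 0" using generic by simp
    qed (use V V0 in \<open>auto simp: V'_def\<close>)
    then show ?thesis by (simp add: c0)
  qed
  have "\<Theta> z \<xi> = 0" if "z \<in> B" "\<xi> \<in> B" for z \<xi>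
    using sesqui_holo_polarization[OF sesq diag that] .
  then have fin: "\<forall>z\<in>B. \<forall>\<xi>\<in>B. (\<Prod>i<M. K i z \<xi> ^ p i) * H z \<xi> ^ q2 = complex_of_real C * H z \<xi> ^ q1"
    by (simp add: \<Theta>_def)
  have "p i \<ge> 1" if "i < M" for i using p0pos[OF that] by (simp add: p_def)
  then show ?thesis using fin q12(2) C by blast
qed

end

section \<open>Positive kernels of finite rank\<close>

interpretation complex_poly: vector_space "smult :: complex \<Rightarrow> complex poly \<Rightarrow> complex poly"
  by unfold_locales (simp_all add: smult_add_left smult_add_right)

text \<open>The Hermitian form of C^N. Vectors are coded as the coefficients of polynomials, which
  form one vector space for all \<open>N\<close>.\<close>

definition hip :: "nat \<Rightarrow> complex poly \<Rightarrow> complex poly \<Rightarrow> complex" where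
  "hip N x y = (\<Sum>j<N. coeff x j * cnj (coeff y j))"

lemma hip_simps:
  "hip N (x + y) z = hip N x z + hip N y z" "hip N (x - y) z = hip N x z - hip N y z"
  "hip N (smult c x) z = c * hip N x z" "hip N 0 z = 0"
  by (simp_all add: hip_def algebra_simps sum.distrib sum_subtractf sum_distrib_left)

lemma hip_cnj: "cnj (hip N x y) = hip N y x"
  by (simp add: hip_def mult.commute)

lemma hip_simps_right:
  "hip N z (x + y) = hip N z x + hip N z y" "hip N z (x - y) = hip N z x - hip N z y"
  "hip N z (smult c x) = cnj c * hip N z x" "hip N z 0 = 0"
  by (simp_all add: hip_def algebra_simps sum.distrib sum_subtractf sum_distrib_left)

lemma hip_sum_right: "hip N z (sum f A) = (\<Sum>a\<in>A. hip N z (f a))"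
  by (induction A rule: infinite_finite_induct) (auto simp: hip_simps_right)

text \<open>The form ignores coefficients from \<open>N\<close> on and is only semidefinite, so a
  null vector need not be 0; it is still orthogonal to everything.\<close>

lemma hip_self_zero:
  assumes "hip N x x = 0"
  shows "hip N x y = 0"
proof -
  have "hip N x x = of_real (\<Sum>j<N. (cmod (coeff x j))\<^sup>2)"
    by (simp add: hip_def complex_norm_square[symmetric])
  then have "(\<Sum>j<N. (cmod (coeff x j))\<^sup>2) = 0" using assms by (metis of_real_eq_0_iff)
  then have "\<forall>j<N. coeff x j = 0" by (simp add: sum_nonneg_eq_0_iff)
  then show ?thesis by (simp add: hip_def)
qed

text \<open>Gram-Schmidt: subtract the projections of \<open>c\<close> and of the new vector
  \<open>w\<close> to the old span, then remove from the first residual its component along the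
  second.\<close>

lemma hip_residual:
  assumes "finite W"
  shows "\<exists>d. \<forall>w\<in>W. hip N w (c - (\<Sum>u\<in>W. smult (d u) u)) = 0"
  using assms
proof (induction W arbitrary: c rule: finite_induct)
  case (insert w W)
  obtain a where a: "\<forall>u\<in>W. hip N u (c - (\<Sum>u\<in>W. smult (a u) u)) = 0" using insert.IH by blast
  obtain b where b: "\<forall>u\<in>W. hip N u (w - (\<Sum>u\<in>W. smult (b u) u)) = 0" using insert.IH by blast
  define c' where "c' = c - (\<Sum>u\<in>W. smult (a u) u)"
  define w' where "w' = w - (\<Sum>u\<in>W. smult (b u) u)"
  \<comment> \<open>If the new direction is null, it is orthogonal to everything and 0 serves as its
    coefficient.\<close>
  define t where "t = (if hip N w' w' = 0 then 0 else hip N c' w' / hip N w' w')"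
  define d where "d = (\<lambda>u. if u = w then t else a u - t * b u)"
  have "(\<Sum>u\<in>W. smult (d u) u) = (\<Sum>u\<in>W. smult (a u) u) - smult t (\<Sum>u\<in>W. smult (b u) u)"
  proof -
    have "(\<Sum>u\<in>W. smult (d u) u) = (\<Sum>u\<in>W. smult (a u) u - smult t (smult (b u) u))"
      using insert.hyps by (intro sum.cong refl) (auto simp: d_def smult_diff_left)
    then show ?thesis by (simp add: sum_subtractf complex_poly.scale_sum_right)
  qed
  then have res: "c - (\<Sum>u\<in>insert w W. smult (d u) u) = c' - smult t w'"
    using insert.hyps by (simp add: c'_def w'_def d_def smult_diff_right)
  have W: "hip N u (c' - smult t w') = 0" if "u \<in> W" for u
    using a b that by (simp add: hip_simps_right flip: c'_def w'_def)
  have "hip N w' (c' - smult t w') = 0"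
  proof (cases "hip N w' w' = 0")
    case True
    then show ?thesis by (rule hip_self_zero)
  next
    case False
    have "cnj t * hip N w' w' = cnj (t * hip N w' w')" by (simp add: hip_cnj)
    also have "\<dots> = hip N w' c'" using False by (simp add: t_def hip_cnj)
    finally show ?thesis by (simp add: hip_simps_right)
  qed
  moreover have "hip N (\<Sum>u\<in>W. smult (b u) u) (c' - smult t w') = (\<Sum>u\<in>W. b u * hip N u (c' - smult t w'))"
    for b using insert.hyps(1) by (induction W rule: finite_induct) (auto simp: hip_simps)
  ultimately have "hip N w (c' - smult t w') = 0"
  proof -
    assume 1: "hip N w' (c' - smult t w') = 0"
    assume "\<And>b. hip N (\<Sum>u\<in>W. smult (b u) u) (c' - smult t w') = (\<Sum>u\<in>W. b u * hip N u (c' - smult t w'))"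
    then have 2: "hip N (\<Sum>u\<in>W. smult (b u) u) (c' - smult t w') = 0" using W by simp
    have "w = w' + (\<Sum>u\<in>W. smult (b u) u)" by (simp add: w'_def)
    then show ?thesis using 1 2 by (metis hip_simps(1) add_0_left)
  qed
  then show ?case using W res by (intro exI[of _ d]) (metis insertE)
qed simp

lemma gram_reproduces:
  fixes v :: "nat \<Rightarrow> 'z \<Rightarrow> complex"
  shows "\<exists>W d. finite W \<and> W \<subseteq> B \<and>
    (\<forall>k<N. \<forall>z\<in>B. v k z = (\<Sum>w\<in>W. d k w * (\<Sum>j<N. v j z * cnj (v j w))))"
proof -
  define u where "u = (\<lambda>z. \<Sum>j<N. monom (v j z) j)"
  have cu: "coeff (u z) j = (if j < N then v j z else 0)" for z j
    by (simp add: u_def coeff_sum)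
  have K: "hip N (u z) (u w) = (\<Sum>j<N. v j z * cnj (v j w))" for z w
    by (simp add: hip_def cu)
  obtain U where U: "U \<subseteq> u ` B" "complex_poly.independent U" "u ` B \<subseteq> complex_poly.span U"
    using complex_poly.maximal_independent_subset by blast
  have uspan: "u z \<in> complex_poly.span ((\<lambda>j. monom 1 j) ` {..<N})" for z
    unfolding u_def
  proof (rule complex_poly.span_sum)
    fix j assume "j \<in> {..<N}"
    then have "smult (v j z) (monom 1 j) \<in> complex_poly.span ((\<lambda>j. monom 1 j) ` {..<N})"
      by (intro complex_poly.span_scale complex_poly.span_base) auto
    then show "monom (v j z) j \<in> complex_poly.span ((\<lambda>j. monom 1 j) ` {..<N})"
      by (simp add: smult_monom)
  qed
  have finU: "finite U"
    using complex_poly.independent_span_bound[OF _ U(2), of "(\<lambda>j. monom 1 j) ` {..<N}"] U(1) uspan by blast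
  have "\<forall>k. \<exists>d. \<forall>w\<in>U. hip N w (monom 1 k - (\<Sum>u\<in>U. smult (d u) u)) = 0"
    using hip_residual[OF finU] by blast
  then obtain d where d: "\<And>k w. w \<in> U \<Longrightarrow> hip N w (monom 1 k - (\<Sum>u\<in>U. smult (d k u) u)) = 0"
    by metis
  define c where "c = (\<lambda>k. monom 1 k - (\<Sum>u\<in>U. smult (d k u) u))"
  have c0: "hip N x (c k) = 0" if "x \<in> complex_poly.span U" for x k
    using that
  proof (induction rule: complex_poly.span_induct_alt)
    case (step a x y)
    then show ?case using d by (simp add: hip_simps c_def)
  qed (simp add: hip_simps)
  obtain W where W: "W \<subseteq> B" "inj_on u W" "U = u ` W" using U(1) by (meson subset_image_inj)
  have finW: "finite W" using finU W by (metis finite_imageD)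
  have "v k z = (\<Sum>w\<in>W. cnj (d k (u w)) * (\<Sum>j<N. v j z * cnj (v j w)))" if k: "k < N" and z: "z \<in> B" for k z
  proof -
    have "v k z = hip N (u z) (monom 1 k)"
      using k by (simp add: hip_def cu if_distrib cong: if_cong)
    also have "monom 1 k = (\<Sum>u\<in>U. smult (d k u) u) + c k" by (simp add: c_def)
    also have "hip N (u z) \<dots> = hip N (u z) (\<Sum>u\<in>U. smult (d k u) u)"
      using c0 U(3) z by (auto simp: hip_simps_right)
    also have "\<dots> = (\<Sum>x\<in>U. cnj (d k x) * hip N (u z) x)"
      by (simp add: hip_sum_right hip_simps_right)
    also have "\<dots> = (\<Sum>w\<in>W. cnj (d k (u w)) * hip N (u z) (u w))"
      unfolding W(3) by (simp add: sum.reindex[OF W(2)])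
    finally show ?thesis by (simp add: K)
  qed
  then show ?thesis using finW W(1) by (intro exI[of _ W] exI[of _ "\<lambda>k w. cnj (d k (u w))"]) blast
qed

section \<open>Polynomiality and factorization\<close>

text \<open>The functions are kept as a list so that, when kernels are multiplied, membership in its
  set tells which components survive.\<close>

definition sos :: "('z \<Rightarrow> complex) list \<Rightarrow> 'z \<Rightarrow> 'z \<Rightarrow> complex" where
  "sos fs z w = (\<Sum>f\<leftarrow>fs. f z * cnj (f w))"

lemma sos_append: "sos (fs @ gs) z w = sos fs z w + sos gs z w"
  by (simp add: sos_def)

lemma sos_products: "sos [\<lambda>z. f z * g z. f \<leftarrow> fs, g \<leftarrow> gs] z w = sos fs z w * sos gs z w"
proof (induction fs)
  case (Cons f fs)
  have "sos (map (\<lambda>g z. f z * g z) gs) z w = f z * cnj (f w) * sos gs z w"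
    by (induction gs) (simp_all add: sos_def algebra_simps)
  then show ?case using Cons by (simp add: sos_append) (simp add: sos_def algebra_simps)
qed (simp add: sos_def)

text \<open>(1 + a)(1 + b) = 1 + (a + b + ab): because of the summands 1, the product keeps all
  functions of both factors.\<close>

lemma sos_combine:
  "\<exists>hs. (\<forall>z w. (1 + sos fs z w) * (1 + sos gs z w) = 1 + sos hs z w) \<and> set fs \<union> set gs \<subseteq> set hs"
  by (rule exI[of _ "fs @ gs @ [\<lambda>z. f z * g z. f \<leftarrow> fs, g \<leftarrow> gs]"])
    (auto simp: sos_append sos_products algebra_simps)

lemma sos_power:
  assumes "p \<ge> (1::nat)"
  shows "\<exists>hs. (\<forall>z w. (1 + sos fs z w) ^ p = 1 + sos hs z w) \<and> set fs \<subseteq> set hs"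
  using assms
proof (induction p rule: nat_induct_at_least)
  case base then show ?case by auto
next
  case (Suc p)
  then obtain hs where hs: "\<forall>z w. (1 + sos fs z w) ^ p = 1 + sos hs z w" "set fs \<subseteq> set hs" by blast
  obtain hs' where hs': "\<forall>z w. (1 + sos fs z w) * (1 + sos hs z w) = 1 + sos hs' z w" "set fs \<union> set hs \<subseteq> set hs'"
    using sos_combine by blast
  then show ?case using hs by (intro exI[of _ hs']) auto
qed

lemma sos_prod_power:
  assumes "\<And>i. i < (m::nat) \<Longrightarrow> p i \<ge> (1::nat)"
  shows "\<exists>hs. (\<forall>z w. (\<Prod>i<m. (1 + sos (fs i) z w) ^ p i) = 1 + sos hs z w) \<and> (\<forall>i<m. set (fs i) \<subseteq> set hs)"
  using assms
proof (induction m)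
  case 0
  then show ?case by (intro exI[of _ "[]"]) (simp add: sos_def)
next
  case (Suc m)
  then obtain hs where hs: "\<forall>z w. (\<Prod>i<m. (1 + sos (fs i) z w) ^ p i) = 1 + sos hs z w"
    "\<forall>i<m. set (fs i) \<subseteq> set hs" by fastforce
  obtain gs where gs: "\<forall>z w. (1 + sos (fs m) z w) ^ p m = 1 + sos gs z w" "set (fs m) \<subseteq> set gs"
    using sos_power[OF Suc.prems[of m]] by blast
  obtain ks where ks: "\<forall>z w. (1 + sos hs z w) * (1 + sos gs z w) = 1 + sos ks z w" "set hs \<union> set gs \<subseteq> set ks"
    using sos_combine by blast
  have "(\<Prod>i<Suc m. (1 + sos (fs i) z w) ^ p i) = 1 + sos ks z w" for z w
    using hs(1) gs(1) ks(1) by simp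
  moreover have "set (fs i) \<subseteq> set ks" if "i < Suc m" for i
    using that hs(2) gs(2) ks(2) by (auto simp: less_Suc_eq)
  ultimately show ?case by blast
qed

text \<open>The sum of |f z - f w|^2 over the list expands into four kernel values, which cancel if
  the kernel is constant.\<close>

lemma sos_const_imp_const:
  assumes const: "\<And>z w. z \<in> B \<Longrightarrow> w \<in> B \<Longrightarrow> sos fs z w = C" and f: "f \<in> set fs"
    and zw: "z \<in> B" "w \<in> B"
  shows "f z = f w"
proof -
  have "of_real (\<Sum>f\<leftarrow>fs. (cmod (f z - f w))\<^sup>2) = sos fs z z - sos fs z w - sos fs w z + sos fs w w"
    unfolding sos_def
    by (induction fs) (simp_all add: complex_norm_square algebra_simps del: of_real_power)
  also have "\<dots> = 0" using const zw by simp
  finally have "(\<Sum>f\<leftarrow>fs. (cmod (f z - f w))\<^sup>2) = 0" unfolding of_real_eq_0_iff .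
  then have "\<forall>x\<in>set (map (\<lambda>f. (cmod (f z - f w))\<^sup>2) fs). x = 0"
    by (subst (asm) sum_list_nonneg_eq_0_iff) auto
  then show ?thesis using f by auto
qed

lemma sos_conv_sum: "sos fs z w = (\<Sum>j<length fs. (fs ! j) z * cnj ((fs ! j) w))"
  unfolding sos_def by (simp add: sum_list_sum_nth atLeast0LessThan)

section \<open>Substitution, conjugation and zeros of polynomials\<close>

definition msubst :: "(nat \<Rightarrow> mpoly) \<Rightarrow> mpoly \<Rightarrow> mpoly" where
  "msubst \<sigma> p = (\<Sum>a\<in>Poly_Mapping.keys p. mconst (Poly_Mapping.lookup p a) *
     (\<Prod>i\<in>Poly_Mapping.keys a. \<sigma> i ^ Poly_Mapping.lookup a i))"

lemma peval_msubst: "peval (msubst \<sigma> p) x = peval p (\<lambda>i. peval (\<sigma> i) x)"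
  unfolding msubst_def by (simp add: peval_sum peval_mult peval_prod peval_power) (simp add: peval_def)

lemma msubst_mpolys: "(\<And>i. i \<in> pvars p \<Longrightarrow> \<sigma> i \<in> mpolys n) \<Longrightarrow> msubst \<sigma> p \<in> mpolys n"
  unfolding msubst_def by (intro mpolys_sum mpolys_closed mpolys_prod mpolys_power) (auto simp: pvars_def)

definition mconj :: "mpoly \<Rightarrow> mpoly" where
  "mconj p = (\<Sum>a\<in>Poly_Mapping.keys p. Poly_Mapping.single a (cnj (Poly_Mapping.lookup p a)))"

lemma peval_mconj: "peval (mconj p) x = cnj (peval p (cconj x))"
  unfolding mconj_def by (simp add: peval_sum peval_single) (simp add: peval_def mono_eval_def cconj_def)

lemma mconj_mpolys:
  assumes "p \<in> mpolys n"
  shows "mconj p \<in> mpolys n"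
proof -
  have "Poly_Mapping.single a c \<in> mpolys n" if "a \<in> Poly_Mapping.keys p" for a c
    using assms that by (auto simp: mpolys_def pvars_def split: if_splits)
  then show ?thesis unfolding mconj_def by (intro mpolys_sum)
qed

lemma mvar_mpolys: "i < n \<Longrightarrow> mvar i \<in> mpolys n"
  by (auto simp: mpolys_alt intro!: free_of_mvar)

lemma peval2_peval:
  assumes "p \<in> mpolys n"
  shows "peval2 n p z \<xi> = peval p z"
  unfolding peval2_def using assms by (intro peval_cong) (auto simp: mpolys_def)

text \<open>Join 0 to a point where \<open>p\<close> does not vanish: on this line \<open>p\<close>
  is a nonzero polynomial in \<open>t\<close>, yet it has infinitely many zeros near 0.\<close>

lemma mpoly_zero_on_ball:
  assumes p: "p \<in> mpolys (2 * n)" and rho: "\<rho> > 0"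
    and zero: "\<And>z \<xi>. z \<in> cball0 n \<rho> \<Longrightarrow> \<xi> \<in> cball0 n \<rho> \<Longrightarrow> peval2 n p z \<xi> = 0"
  shows "p = 0"
proof (rule ccontr)
  assume "p \<noteq> 0"
  then obtain x where x: "peval p x \<noteq> 0" using exists_peval_nonzero[OF p] by blast
  define a where "a = (\<lambda>i. if i < n then x i else 0)"
  define b where "b = (\<lambda>i. if i < n then x (n + i) else 0)"
  have 0: "(\<lambda>_. 0) \<in> cvec n" by (simp add: cvec_def)
  have ab: "a \<in> cvec n" "b \<in> cvec n" by (simp_all add: a_def b_def cvec_def)
  obtain E :: "complex poly" where E: "\<forall>t. poly E t = peval2 n p (cline (\<lambda>_. 0) a t) (cline (\<lambda>_. 0) b t)"
    using peval2_cline_poly by blast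
  have "poly E 1 = peval p x"
    unfolding E[rule_format] peval2_def
    by (rule peval_cong) (use p in \<open>auto simp: cline_def a_def b_def mpolys_def\<close>)
  then have E0: "E \<noteq> 0" using x by auto
  define V where "V = cslice n \<rho> (\<lambda>_. 0) a \<inter> cslice n \<rho> (\<lambda>_. 0) b"
  have "open V" unfolding V_def using open_cslice[OF 0 ab(1)] open_cslice[OF 0 ab(2)] by blast
  moreover have "0 \<in> V" using cball0_zero[OF rho, of n] by (simp add: V_def cslice_def cline_def)
  ultimately have "0 islimpt {t\<in>V. t \<in> \<real>}" by (rule zero_islimpt_real)
  moreover have "{t\<in>V. t \<in> \<real>} \<subseteq> {t. poly E t = 0}" using E zero by (auto simp: V_def cslice_def)
  then have "finite {t\<in>V. t \<in> \<real>}" using poly_roots_finite[OF E0] finite_subset by blast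
  ultimately show False by (simp add: islimpt_finite)
qed

text \<open>A nonconstant polynomial is unbounded along the real axis, and \<open>S\<close> excludes
  only finitely many parameters.\<close>

lemma bounded_poly_real_const:
  fixes E S :: "complex poly"
  assumes S: "S \<noteq> 0" and bd: "\<And>t. t \<in> \<real> \<Longrightarrow> poly S t \<noteq> 0 \<Longrightarrow> cmod (poly E t) \<le> C"
  shows "degree E = 0"
proof (rule ccontr)
  assume "degree E \<noteq> 0"
  then have "filterlim (poly E) at_infinity at_infinity" by (intro filterlim_poly_at_infinity) simp
  moreover have "filterlim (\<lambda>t::real. of_real t :: complex) at_infinity at_top"
    by (intro filterlim_of_real_at_infinity)
  ultimately have "filterlim (\<lambda>t::real. poly E (of_real t)) at_infinity at_top"
    by (rule filterlim_compose)
  then have 1: "eventually (\<lambda>t::real. cmod (poly E (of_real t)) \<ge> max C 0 + 1) at_top"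
    unfolding filterlim_at_infinity[OF order_refl] by (simp add: max_def)
  have "complex_of_real ` {t. poly S (of_real t) = 0} \<subseteq> {x. poly S x = 0}" by auto
  then have "finite (complex_of_real ` {t. poly S (of_real t) = 0})"
    using poly_roots_finite[OF S] finite_subset by blast
  then have "finite {t. poly S (complex_of_real t) = 0}" by (rule finite_imageD) (simp add: inj_on_def)
  then obtain b where b: "\<And>t. poly S (complex_of_real t) = 0 \<Longrightarrow> t \<le> b"
    using bdd_above_finite[of "{t. poly S (complex_of_real t) = 0}"] unfolding bdd_above_def by blast
  have "eventually (\<lambda>t::real. poly S (of_real t) \<noteq> 0) at_top"
    using eventually_gt_at_top[of b] by eventually_elim (use b in force)
  with 1 have "eventually (\<lambda>t::real. False) at_top"
  proof eventually_elim
    case (elim t)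
    then show ?case using bd[of "of_real t"] by simp
  qed
  then show False by simp
qed

context kernel_relation
begin

definition comps :: "nat \<Rightarrow> ((nat \<Rightarrow> complex) \<Rightarrow> complex) list" where
  "comps i = map (\<lambda>k z. F i z k) [0..<N i]"

lemma K_sos: "K i z (cconj w) = 1 + sos (comps i) z w"
  by (simp add: K_def hdot_def sos_conv_sum comps_def)

lemma K_not_const:
  assumes i: "i < M" and const: "\<And>z \<xi>. z \<in> B \<Longrightarrow> \<xi> \<in> B \<Longrightarrow> K i z \<xi> = C"
  shows False
proof -
  obtain z1 z2 k where z: "z1 \<in> B" "z2 \<in> B" "k < N i" "F i z1 k \<noteq> F i z2 k"
    using F_nonconst[OF i] unfolding nonconst_map_on_def by blast
  have "sos (comps i) z w = C - 1" if "z \<in> B" "w \<in> B" for z w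
    using const[of z "cconj w"] that by (simp add: K_sos algebra_simps)
  moreover have "(\<lambda>z. F i z k) \<in> set (comps i)" using z(3) by (auto simp: comps_def)
  ultimately show False using sos_const_imp_const[of B "comps i" "C - 1" "\<lambda>z. F i z k" z1 z2] z by blast
qed

text \<open>Polarization would make \<open>h\<close> a constant polynomial, hence 0 or a unit, and
  neither is irreducible.\<close>

lemma h_not_const:
  assumes const: "\<And>z. z \<in> B \<Longrightarrow> H z (cconj z) = C"
  shows False
proof -
  have HC: "H z \<xi> = C" if "z \<in> B" "\<xi> \<in> B" for z \<xi>
    using sesqui_holo_eqI[OF sesqui_holo_peval2 sesqui_holo_const _ that, of h C] const by blast
  have "h - mconst C = 0"
  proof (rule mpoly_zero_on_ball[OF _ rho])
    show "h - mconst C \<in> mpolys (2 * n)" using h_mem by (intro mpolys_closed)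
    show "peval2 n (h - mconst C) z \<xi> = 0" if "z \<in> B" "\<xi> \<in> B" for z \<xi>
      using HC[OF that] by (simp add: peval2_def peval_diff)
  qed
  then have "h = mconst C" by simp
  moreover have "h \<noteq> 0" "\<not> h dvd 1" using h_irr by (auto simp: irreducible_def)
  ultimately show False using mconst_dvd_1 by (metis single_zero)
qed

lemma H_left_mpoly: "\<exists>S\<in>mpolys n. \<forall>z. peval S z = H z \<xi>"
proof
  let ?\<sigma> = "\<lambda>i. if i < n then mvar i else mconst (\<xi> (i - n))"
  show "msubst ?\<sigma> h \<in> mpolys n" by (intro msubst_mpolys) (auto intro: mvar_mpolys mpolys_closed)
  have "(\<lambda>i. peval (?\<sigma> i) z) = (\<lambda>i. if i < n then z i else \<xi> (i - n))" for z by auto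
  then show "\<forall>z. peval (msubst ?\<sigma> h) z = H z \<xi>"
    by (simp only: peval_msubst peval2_def simp_thms)
qed

text \<open>The product of the kernels expands into 1 plus a kernel whose list contains every
  component, so \<open>gram_reproduces\<close> writes the components through the functions C H(.,
  w)^q - 1, which are polynomials in \<open>z\<close>.\<close>

lemma polynomial_components:
  assumes p: "\<And>i. i < M \<Longrightarrow> p i \<ge> 1"
    and rel: "\<And>z \<xi>. z \<in> B \<Longrightarrow> \<xi> \<in> B \<Longrightarrow> (\<Prod>i<M. K i z \<xi> ^ p i) = complex_of_real C * H z \<xi> ^ q"
    and ik: "i < M" "k < N i"
  shows "\<exists>P\<in>mpolys n. \<forall>z\<in>B. F i z k = peval P z"
proof -
  obtain hs where hs: "\<And>z w. (\<Prod>i<M. (1 + sos (comps i) z w) ^ p i) = 1 + sos hs z w"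
    "\<And>i. i < M \<Longrightarrow> set (comps i) \<subseteq> set hs"
    using sos_prod_power[of M p comps] p by blast
  have sosH: "sos hs z w = complex_of_real C * H z (cconj w) ^ q - 1" if "z \<in> B" "w \<in> B" for z w
    using rel[of z "cconj w"] that hs(1)[of z w] by (simp add: K_sos algebra_simps)
  obtain W d where W: "finite W" "W \<subseteq> B" and d: "\<And>k z. k < length hs \<Longrightarrow> z \<in> B \<Longrightarrow>
     (hs ! k) z = (\<Sum>w\<in>W. d k w * sos hs z w)"
    using gram_reproduces[of B "length hs" "\<lambda>k. hs ! k"] unfolding sos_conv_sum by blast
  have "(\<lambda>z. F i z k) \<in> set hs" using hs(2)[OF ik(1)] ik(2) by (auto simp: comps_def)
  then obtain j where j: "j < length hs" "hs ! j = (\<lambda>z. F i z k)" by (metis in_set_conv_nth)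
  have "\<forall>w. \<exists>S. S \<in> mpolys n \<and> (\<forall>z. peval S z = H z (cconj w))" using H_left_mpoly by blast
  then obtain S where S: "\<And>w. S w \<in> mpolys n" "\<And>w z. peval (S w) z = H z (cconj w)" by metis
  define P where "P = (\<Sum>w\<in>W. mconst (d j w) * (mconst C * S w ^ q - 1))"
  have "F i z k = peval P z" if z: "z \<in> B" for z
  proof -
    have "F i z k = (\<Sum>w\<in>W. d j w * sos hs z w)" using d[OF j(1) z] j(2) by metis
    also have "\<dots> = (\<Sum>w\<in>W. d j w * (complex_of_real C * H z (cconj w) ^ q - 1))"
      using sosH[OF z] W(2) by (intro sum.cong refl) auto
    also have "\<dots> = peval P z"
      by (simp add: P_def peval_sum peval_mult peval_diff peval_power S)
    finally show ?thesis .
  qed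
  moreover have "P \<in> mpolys n"
    unfolding P_def using S(1) by (intro mpolys_sum mpolys_closed mpolys_power)
  ultimately show ?thesis by blast
qed

text \<open>On a line through 0 the identity becomes one between polynomials in \<open>t\<close> and
  so holds at all real \<open>t\<close>. There it bounds \<open>h\<close>, which makes
  \<open>h\<close> constant on the line; as the line is arbitrary, \<open>h\<close> is
  constant.\<close>

lemma positive_exponent:
  assumes p: "\<And>i. i < M \<Longrightarrow> p i \<ge> 1" and C: "C > 0" and q: "q \<ge> 1"
    and rel: "\<And>z \<xi>. z \<in> B \<Longrightarrow> \<xi> \<in> B \<Longrightarrow> (\<Prod>i<M. K i z \<xi> ^ p i) * H z \<xi> ^ q = complex_of_real C"
  shows False
proof -
  obtain hs where hs: "\<And>z w. (\<Prod>i<M. (1 + sos (comps i) z w) ^ p i) = 1 + sos hs z w"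
    using sos_prod_power[of M p comps] p by blast
  have rel': "(1 + sos hs z w) * H z (cconj w) ^ q = complex_of_real C" if "z \<in> B" "w \<in> B" for z w
    using rel[of z "cconj w"] that hs(1)[of z w] by (simp add: K_sos)
  then have Hnz: "H z (cconj w) \<noteq> 0" if "z \<in> B" "w \<in> B" for z w
    using C q that by (metis mult_zero_right of_real_eq_0_iff less_irrefl power_0_left not_one_le_zero)
  have sosH: "sos hs z w = complex_of_real C / H z (cconj w) ^ q - 1" if "z \<in> B" "w \<in> B" for z w
    using rel'[OF that] Hnz[OF that] by (simp add: field_simps)
  obtain W d where W: "finite W" "W \<subseteq> B" and d: "\<And>k z. k < length hs \<Longrightarrow> z \<in> B \<Longrightarrow>
     (hs ! k) z = (\<Sum>w\<in>W. d k w * sos hs z w)"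
    using gram_reproduces[of B "length hs" "\<lambda>k. hs ! k"] unfolding sos_conv_sum by blast
  have line: "H z (cconj z) = H (\<lambda>_. 0) (\<lambda>_. 0)" if z: "z \<in> cvec n" for z
  proof -
    have 0: "(\<lambda>_. 0) \<in> cvec n" by (simp add: cvec_def)
    let ?l = "cline (\<lambda>_. 0) z"
    obtain \<eta> :: "complex poly" where \<eta>: "\<And>t. poly \<eta> t = H (?l t) (cline (\<lambda>_. 0) (cconj z) t)"
      using peval2_cline_poly by blast
    have "\<forall>w. \<exists>s :: complex poly. \<forall>t. poly s t = H (?l t) (cline (cconj w) (\<lambda>_. 0) t)"
      using peval2_cline_poly by blast
    then obtain s :: "_ \<Rightarrow> complex poly" where s: "\<And>w t. poly (s w) t = H (?l t) (cconj w)"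
      by (metis (no_types, lifting) cline_def ext add_0_right mult_zero_right)
    \<comment> \<open>The functions \<open>hs ! j\<close> are combinations of the C/H(., w)^q - 1.
      \<open>S\<close> is the common denominator on the line, and \<open>R j\<close> the numerator
      of \<open>hs ! j\<close>.\<close>
    define S where "S = (\<Prod>w\<in>W. s w ^ q)"
    define R where "R = (\<lambda>j. \<Sum>w\<in>W. smult (d j w) (smult (of_real C) (\<Prod>w'\<in>W - {w}. s w' ^ q) - S))"
    have S_nz: "poly S t \<noteq> 0" if "?l t \<in> B" for t
      using Hnz[OF that] W by (auto simp: S_def poly_prod poly_power s)
    have R: "poly (R j) t = poly S t * (hs ! j) (?l t)" if t: "?l t \<in> B" and j: "j < length hs" for t j
    proof -
      have "poly S t * (hs ! j) (?l t)
          = (\<Sum>w\<in>W. d j w * (of_real C * (poly S t / H (?l t) (cconj w) ^ q) - poly S t))"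
        unfolding d[OF j t] sum_distrib_left
      proof (intro sum.cong refl)
        fix w assume "w \<in> W"
        then have "sos hs (?l t) w = of_real C / H (?l t) (cconj w) ^ q - 1" using sosH[OF t] W(2) by blast
        then show "poly S t * (d j w * sos hs (?l t) w)
          = d j w * (of_real C * (poly S t / H (?l t) (cconj w) ^ q) - poly S t)"
          by (simp only:) (simp add: algebra_simps)
      qed
      also have "\<dots> = poly (R j) t"
        unfolding R_def poly_sum
      proof (intro sum.cong refl)
        fix w assume w: "w \<in> W"
        have "poly S t = H (?l t) (cconj w) ^ q * poly (\<Prod>w'\<in>W - {w}. s w' ^ q) t"
          unfolding S_def using prod.remove[OF W(1) w, of "\<lambda>w. s w ^ q"] by (simp add: poly_power s)
        moreover have "H (?l t) (cconj w) ^ q \<noteq> 0" using Hnz[OF t] w W(2) by auto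
        ultimately have "poly S t / H (?l t) (cconj w) ^ q = poly (\<Prod>w'\<in>W - {w}. s w' ^ q) t" by simp
        then show "d j w * (of_real C * (poly S t / H (?l t) (cconj w) ^ q) - poly S t)
          = poly (smult (d j w) (smult (of_real C) (\<Prod>w'\<in>W - {w}. s w' ^ q) - S)) t" by simp
      qed
      finally show ?thesis by simp
    qed
    \<comment> \<open>Conjugate coefficients give conjugate values at real \<open>t\<close>, so
      |S|^2 and |R j|^2 are polynomials on the real axis.\<close>
    define conjp :: "complex poly \<Rightarrow> complex poly" where "conjp = map_poly cnj"
    have conjp: "poly (conjp p) t = cnj (poly p t)" if "t \<in> \<real>" for p t
    proof -
      have "poly (conjp p) (cnj t) = cnj (poly p t)" unfolding conjp_def poly_cnj[symmetric] ..
      then show ?thesis using that by (simp add: Reals_cnj_iff)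
    qed
    \<comment> \<open>\<open>T = 0\<close> is the given relation with denominators cleared. It holds
      at real \<open>t\<close> near 0, hence identically, also where the line has left the
      ball.\<close>
    define T where "T = (S * conjp S + (\<Sum>j<length hs. R j * conjp (R j))) * \<eta> ^ q - smult (of_real C) (S * conjp S)"
    have \<eta>_real: "poly \<eta> t = H (?l t) (cconj (?l t))" if "t \<in> \<real>" for t
    proof -
      have "cnj t = t" using that by (simp add: Reals_cnj_iff)
      then show ?thesis by (simp add: \<eta> cconj_cline)
    qed
    have Tval: "poly T t = of_real ((cmod (poly S t))\<^sup>2 + (\<Sum>j<length hs. (cmod (poly (R j) t))\<^sup>2)) * poly \<eta> t ^ q
        - of_real (C * (cmod (poly S t))\<^sup>2)" if t: "t \<in> \<real>" for t
      using conjp[OF t] by (simp add: T_def poly_sum complex_norm_square del: of_real_power)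
    have "poly T t = 0" if t: "t \<in> \<real>" "?l t \<in> B" for t
    proof -
      have "(\<Sum>j<length hs. (cmod (poly (R j) t))\<^sup>2)
          = (cmod (poly S t))\<^sup>2 * (\<Sum>j<length hs. (cmod ((hs ! j) (?l t)))\<^sup>2)"
        using R[OF t(2)] by (simp add: norm_mult power_mult_distrib sum_distrib_left)
      moreover have "of_real (\<Sum>j<length hs. (cmod ((hs ! j) (?l t)))\<^sup>2) = sos hs (?l t) (?l t)"
        unfolding sos_conv_sum by (simp add: complex_norm_square del: of_real_power)
      ultimately have "poly T t = of_real ((cmod (poly S t))\<^sup>2) *
         ((1 + sos hs (?l t) (?l t)) * H (?l t) (cconj (?l t)) ^ q - of_real C)"
        unfolding Tval[OF t(1)] \<eta>_real[OF t(1)] by (simp add: algebra_simps)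
      then show ?thesis using rel'[OF t(2,2)] by simp
    qed
    then have "{t \<in> cslice n \<rho> (\<lambda>_. 0) z. t \<in> \<real>} \<subseteq> {t. poly T t = 0}" by (auto simp: cslice_def)
    moreover have "0 islimpt {t \<in> cslice n \<rho> (\<lambda>_. 0) z. t \<in> \<real>}"
      using zero_B by (intro zero_islimpt_real open_cslice 0 z) (simp add: cslice_def cline_def)
    ultimately have "infinite {t. poly T t = 0}" by (metis finite_subset islimpt_finite)
    then have T0: "T = 0" using poly_roots_finite by blast
    have "?l 0 \<in> B" using zero_B by (simp add: cline_def)
    then have "S \<noteq> 0" using S_nz by (metis poly_0)
    \<comment> \<open>Dropping the nonnegative |R j|^2 leaves the bound \<open>C\<close> for the
      \<open>q\<close>-th power of \<open>\<eta>\<close>; the 1 covers the values at most 1, for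
      which a power says less than the value itself.\<close>
    moreover have "cmod (poly \<eta> t) \<le> max 1 C" if t: "t \<in> \<real>" "poly S t \<noteq> 0" for t
    proof -
      define x where "x = Re (H (?l t) (cconj (?l t)))"
      have lt: "?l t \<in> cvec n" using cline_cvec[OF 0 z] .
      have x: "poly \<eta> t = of_real x" "x > 0"
        unfolding x_def \<eta>_real[OF t(1)] using H_diag[OF lt] h_pos[OF lt] by auto
      define a where "a = (cmod (poly S t))\<^sup>2"
      define b where "b = (\<Sum>j<length hs. (cmod (poly (R j) t))\<^sup>2)"
      have ab: "a > 0" "b \<ge> 0" using t(2) by (auto simp: a_def b_def intro: sum_nonneg)
      have "of_real ((a + b) * x ^ q - C * a) = (0 :: complex)"
        using Tval[OF t(1)] T0 x(1) unfolding a_def b_def by simp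
      then have "(a + b) * x ^ q = C * a" unfolding of_real_eq_0_iff by simp
      moreover have "a * x ^ q \<le> (a + b) * x ^ q" using ab x(2) by (intro mult_right_mono) auto
      ultimately have "a * x ^ q \<le> a * C" by (simp add: mult.commute)
      then have xq: "x ^ q \<le> C" using ab(1) by simp
      have "x \<le> max 1 C"
      proof (cases "x \<le> 1")
        case False
        then have "x ^ 1 \<le> x ^ q" using q by (intro power_increasing) auto
        then show ?thesis using xq by simp
      qed simp
      then show ?thesis using x by simp
    qed
    ultimately have "degree \<eta> = 0" by (rule bounded_poly_real_const)
    then obtain a where "\<eta> = [:a:]" by (metis degree_eq_zeroE)
    then have "poly \<eta> 1 = poly \<eta> 0" by simp
    then show ?thesis unfolding \<eta> by (simp add: cline_def)
  qed
  show False by (rule h_not_const[of "H (\<lambda>_. 0) (\<lambda>_. 0)"]) (use line B_cvec in blast)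
qed

theorem polynomial_relation:
  "(\<forall>i<M. polynomial_map_on n B (N i) (F i)) \<and>
   (\<exists>k A. (\<forall>i<M. k i \<ge> (1::nat) \<and> A i > 0 \<and>
      (\<forall>z\<in>B. \<forall>\<xi>\<in>B. 1 + hdot (N i) (F i) z \<xi> = complex_of_real (A i) * H z \<xi> ^ k i)) \<and>
     r = (\<Sum>i<M. c i * real (k i)))"
proof -
  obtain p q1 q2 C where p: "\<And>i. i < M \<Longrightarrow> p i \<ge> (1::nat)" and q12: "q1 = (0::nat) \<or> q2 = (0::nat)"
    and C: "C > 0" and rel: "\<And>z \<xi>. z \<in> B \<Longrightarrow> \<xi> \<in> B \<Longrightarrow>
       (\<Prod>i<M. K i z \<xi> ^ p i) * H z \<xi> ^ q2 = complex_of_real C * H z \<xi> ^ q1"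
    using integer_relation by blast
  have q2: "q2 = 0"
  proof (rule ccontr)
    assume "q2 \<noteq> 0"
    then show False using positive_exponent[of p C q2] p C rel q12 by simp
  qed
  have rel': "(\<Prod>i<M. K i z \<xi> ^ p i) = complex_of_real C * H z \<xi> ^ q1" if "z \<in> B" "\<xi> \<in> B" for z \<xi>
    using rel[OF that] q2 by simp
  have "\<forall>i k. \<exists>P. i < M \<longrightarrow> k < N i \<longrightarrow> P \<in> mpolys n \<and> (\<forall>z\<in>B. F i z k = peval P z)"
    using polynomial_components[OF p rel'] by blast
  then obtain P where P: "\<And>i k. i < M \<Longrightarrow> k < N i \<Longrightarrow> P i k \<in> mpolys n"
    "\<And>i k z. i < M \<Longrightarrow> k < N i \<Longrightarrow> z \<in> B \<Longrightarrow> F i z k = peval (P i k) z"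
    by metis
  \<comment> \<open>The conjugate component: its coefficients are conjugated and its variables
    shifted by \<open>n\<close> into the block of \<open>\<xi>\<close>, so that \<open>T i\<close>
    below is a polynomial in 2n variables.\<close>
  define P' where "P' = (\<lambda>i k. msubst (\<lambda>l. mvar (n + l)) (mconj (P i k)))"
  define T where "T = (\<lambda>i. 1 + (\<Sum>k<N i. P i k * P' i k))"
  have mono: "p \<in> mpolys (2 * n)" if "p \<in> mpolys n" for p
    using that by (auto simp: mpolys_def)
  have P'_mem: "P' i k \<in> mpolys (2 * n)" if "i < M" "k < N i" for i k
    unfolding P'_def using mconj_mpolys[OF P(1)[OF that]]
    by (intro msubst_mpolys mvar_mpolys) (auto simp: mpolys_def)
  have T_mem: "T i \<in> mpolys (2 * n)" if "i < M" for i
    unfolding T_def using that P(1) P'_mem mono by (intro mpolys_closed mpolys_sum) auto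
  have T_ev: "peval2 n (T i) z \<xi> = K i z \<xi>" if i: "i < M" and z: "z \<in> B" "\<xi> \<in> B" for i z \<xi>
  proof -
    have "peval2 n (P i k) z \<xi> = F i z k" if "k < N i" for k
      using peval2_peval[OF P(1)[OF i that]] P(2)[OF i that z(1)] by simp
    moreover have "peval2 n (P' i k) z \<xi> = cnj (F i (cconj \<xi>) k)" if "k < N i" for k
    proof -
      have "peval2 n (P' i k) z \<xi> = peval (mconj (P i k)) \<xi>"
        unfolding P'_def peval2_def peval_msubst by simp
      also have "\<dots> = cnj (peval (P i k) (cconj \<xi>))" by (rule peval_mconj)
      also have "\<dots> = cnj (F i (cconj \<xi>) k)" using P(2)[OF i that, of "cconj \<xi>"] z(2) by simp
      finally show ?thesis .
    qed
    ultimately show ?thesis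
      unfolding T_def K_def hdot_def by (simp add: peval2_def peval_add peval_sum peval_mult)
  qed
  have prodT: "(\<Prod>i<M. T i ^ p i) = mconst C * h ^ q1"
  proof -
    have "(\<Prod>i<M. T i ^ p i) - mconst C * h ^ q1 = 0"
    proof (rule mpoly_zero_on_ball[OF _ rho])
      show "(\<Prod>i<M. T i ^ p i) - mconst C * h ^ q1 \<in> mpolys (2 * n)"
        using T_mem h_mem by (intro mpolys_closed mpolys_prod mpolys_power) auto
      show "peval2 n ((\<Prod>i<M. T i ^ p i) - mconst C * h ^ q1) z \<xi> = 0" if "z \<in> B" "\<xi> \<in> B" for z \<xi>
        using rel'[OF that] T_ev[OF _ that]
        by (simp add: peval2_def peval_diff peval_prod peval_power peval_mult)
    qed
    then show ?thesis by simp
  qed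
  have "\<exists>d k. d \<noteq> 0 \<and> T i = mconst d * h ^ k" if i: "i < M" for i
  proof (rule factor_of_irreducible_power[OF h_irr h_mem T_mem[OF i]])
    \<comment> \<open>As \<open>p i \<ge> 1\<close>, one factor \<open>T i\<close> can be split off
      the product; this is what remains.\<close>
    let ?W = "T i ^ (p i - 1) * (\<Prod>j\<in>{..<M} - {i}. T j ^ p j)"
    show "?W \<in> mpolys (2 * n)"
      using T_mem i by (intro mpolys_closed mpolys_prod mpolys_power) auto
    have "T i * ?W = T i ^ p i * (\<Prod>j\<in>{..<M} - {i}. T j ^ p j)"
      using p[OF i] by (cases "p i") (simp_all add: mult.assoc)
    also have "\<dots> = (\<Prod>i<M. T i ^ p i)" using i by (subst prod.remove[of _ i]) auto
    finally show "T i * ?W = mconst C * h ^ q1" using prodT by simp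
    show "complex_of_real C \<noteq> 0" using C by simp
  qed
  then obtain d k where dk: "\<And>i. i < M \<Longrightarrow> T i = mconst (d i) * h ^ k i" by metis
  have Kdk: "K i z \<xi> = d i * H z \<xi> ^ k i" if "i < M" "z \<in> B" "\<xi> \<in> B" for i z \<xi>
    using T_ev[OF that] dk[OF that(1)] by (simp add: peval2_def peval_mult peval_power)
  have k1: "k i \<ge> 1" if i: "i < M" for i
  proof (rule ccontr)
    assume "\<not> k i \<ge> 1"
    then have "k i = 0" by simp
    then have "K i z \<xi> = d i" if "z \<in> B" "\<xi> \<in> B" for z \<xi> using Kdk[OF i that] by simp
    then show False by (rule K_not_const[OF i])
  qed
  have 0: "(\<lambda>_. 0) \<in> cvec n" by (simp add: cvec_def)
  have "\<exists>A>0. d i = complex_of_real A" if i: "i < M" for i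
  proof -
    define x where "x = Re (H (\<lambda>_. 0) (\<lambda>_. 0))"
    have x: "x > 0" "H (\<lambda>_. 0) (\<lambda>_. 0) = of_real x"
      unfolding x_def using h_pos[OF 0] H_diag[OF 0] by auto
    define y where "y = 1 + sqnorm (N i) (F i) (\<lambda>_. 0)"
    have y: "y > 0" "K i (\<lambda>_. 0) (\<lambda>_. 0) = of_real y"
      unfolding y_def using K_diag_pos K_diag[of i "\<lambda>_. 0"] by auto
    have "d i = of_real (y / x ^ k i)"
      using Kdk[OF i zero_B zero_B] x y by (simp add: field_simps)
    then show ?thesis using x(1) y(1) by (intro exI[of _ "y / x ^ k i"]) simp
  qed
  then obtain A where A: "\<And>i. i < M \<Longrightarrow> A i > 0" "\<And>i. i < M \<Longrightarrow> d i = complex_of_real (A i)" by metis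
  have main: "1 + hdot (N i) (F i) z \<xi> = complex_of_real (A i) * H z \<xi> ^ k i"
    if "i < M" "z \<in> B" "\<xi> \<in> B" for i z \<xi>
    using Kdk[OF that] A(2)[OF that(1)] by (simp add: K_def)
  have "r = (\<Sum>i<M. c i * real (k i))"
  proof (rule ccontr)
    \<comment> \<open>Taking logarithms of the relation on the diagonal gives
      \<open>\<delta>\<close> times log h = constant, so a nonzero \<open>\<delta>\<close> would
      make \<open>h\<close> constant.\<close>
    define \<delta> where "\<delta> = r - (\<Sum>i<M. c i * real (k i))"
    assume "r \<noteq> (\<Sum>i<M. c i * real (k i))"
    then have \<delta>: "\<delta> \<noteq> 0" by (simp add: \<delta>_def)
    define L where "L = (\<Sum>i<M. c i * ln (A i)) / \<delta>"
    have "H z (cconj z) = of_real (exp L)" if z: "z \<in> B" for z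
    proof -
      define x where "x = Re (H z (cconj z))"
      have x: "x > 0" "H z (cconj z) = of_real x"
        unfolding x_def using h_pos[OF B_cvec[OF z]] H_diag[OF B_cvec[OF z]] by auto
      have "1 + sqnorm (N i) (F i) z = A i * x ^ k i" if i: "i < M" for i
      proof -
        have "complex_of_real (1 + sqnorm (N i) (F i) z) = complex_of_real (A i * x ^ k i)"
          using main[OF i z, of "cconj z"] z x(2) by (simp add: hdot_diag)
        then show ?thesis unfolding of_real_eq_iff .
      qed
      then have "r * ln x = (\<Sum>i<M. c i * ln (A i * x ^ k i))"
        using eq_ln[OF z] by (simp add: x_def)
      also have "\<dots> = (\<Sum>i<M. c i * ln (A i) + c i * real (k i) * ln x)"
      proof (intro sum.cong refl)
        fix i assume "i \<in> {..<M}"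
        then have "A i > 0" using A(1) by simp
        then show "c i * ln (A i * x ^ k i) = c i * ln (A i) + c i * real (k i) * ln x"
          using x(1) by (simp add: ln_mult ln_realpow algebra_simps)
      qed
      also have "\<dots> = (\<Sum>i<M. c i * ln (A i)) + (\<Sum>i<M. c i * real (k i)) * ln x"
        by (simp add: sum.distrib sum_distrib_right)
      finally have "\<delta> * ln x = (\<Sum>i<M. c i * ln (A i))" by (simp add: \<delta>_def algebra_simps)
      then have "ln x = L" using \<delta> by (simp add: L_def field_simps)
      then have "x = exp L" using x(1) by (metis exp_ln)
      then show ?thesis using x(2) by simp
    qed
    then show False by (rule h_not_const)
  qed
  moreover have "polynomial_map_on n B (N i) (F i)" if "i < M" for i
    unfolding polynomial_map_on_def using P that unfolding mpolys_def by blast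
  ultimately show ?thesis using main k1 A(1) by blast
qed

end

theorem theorem4p1:
  fixes n m v :: nat and h :: mpoly and rho r :: real
    and N :: "nat \<Rightarrow> nat" and F :: "nat \<Rightarrow> (nat \<Rightarrow> complex) \<Rightarrow> nat \<Rightarrow> complex"
    and N' :: "nat \<Rightarrow> nat" and G :: "nat \<Rightarrow> (nat \<Rightarrow> complex) \<Rightarrow> nat \<Rightarrow> complex"
    and mu lam :: "nat \<Rightarrow> real"
  assumes n: "n \<ge> 1"
    and h_vars: "pvars h \<subseteq> {..<2 * n}"
    and h_irr: "irreducible h"
    and h_pos: "\<forall>z\<in>cvec n. Im (peval2 n h z (cconj z)) = 0 \<and> Re (peval2 n h z (cconj z)) > 0"
    and rho: "rho > 0"
    and F: "\<forall>l<m. holo_map_on n (cball0 n rho) (N l) (F l) \<and> algebraic_map_on n (cball0 n rho) (N l) (F l)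
              \<and> nonconst_map_on (cball0 n rho) (N l) (F l)"
    and G: "\<forall>j<v. holo_map_on n (cball0 n rho) (N' j) (G j) \<and> algebraic_map_on n (cball0 n rho) (N' j) (G j)
              \<and> nonconst_map_on (cball0 n rho) (N' j) (G j)"
    and r: "r \<noteq> 0"
    and mu: "\<forall>l<m. mu l > 0" and lam: "\<forall>j<v. lam j > 0"
    and span: "qspan v lam \<inter> qspan m mu = {0}"
    and eq: "\<forall>z\<in>cball0 n rho. Re (peval2 n h z (cconj z)) powr r =
              (\<Prod>l<m. (1 + sqnorm (N l) (F l) z) powr mu l) *
              (\<Prod>j<v. (1 + sqnorm (N' j) (G j) z) powr (- lam j))"
  shows "(\<forall>l<m. polynomial_map_on n (cball0 n rho) (N l) (F l)) \<and>
         (\<forall>j<v. polynomial_map_on n (cball0 n rho) (N' j) (G j)) \<and>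
         (\<exists>ml nj :: nat \<Rightarrow> nat. \<exists>A B :: nat \<Rightarrow> real.
            (\<forall>l<m. ml l \<ge> 1 \<and> A l > 0 \<and>
               (\<forall>z\<in>cball0 n rho. \<forall>\<xi>\<in>cball0 n rho.
                  1 + hdot (N l) (F l) z \<xi> = complex_of_real (A l) * peval2 n h z \<xi> ^ ml l)) \<and>
            (\<forall>j<v. nj j \<ge> 1 \<and> B j > 0 \<and>
               (\<forall>z\<in>cball0 n rho. \<forall>\<xi>\<in>cball0 n rho.
                  1 + hdot (N' j) (G j) z \<xi> = complex_of_real (B j) * peval2 n h z \<xi> ^ nj j)) \<and>
            r = (\<Sum>l<m. real (ml l) * mu l) - (\<Sum>j<v. lam j * real (nj j)))"
proof -
  let ?B = "cball0 n rho"
  \<comment> \<open>Indices below \<open>m\<close> belong to \<open>F\<close>; the index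
    \<open>m + j\<close> belongs to \<open>G j\<close>, with the exponent
    \<open>- lam j\<close>.\<close>
  define NN where "NN = (\<lambda>i. if i < m then N i else N' (i - m))"
  define E where "E = (\<lambda>i. if i < m then F i else G (i - m))"
  define c where "c = (\<lambda>i. if i < m then mu i else - lam (i - m))"
  have split_sum: "(\<Sum>i<m + v. f i) = (\<Sum>i<m. f i) + (\<Sum>j<v. f (m + j))" for f :: "nat \<Rightarrow> real"
    by (induction v) simp_all
  have split_prod: "(\<Prod>i<m + v. f i) = (\<Prod>i<m. f i) * (\<Prod>j<v. f (m + j))" for f :: "nat \<Rightarrow> real"
    by (induction v) simp_all
  have left: "NN i = N i" "E i = F i" "c i = mu i" if "i < m" for i
    using that by (simp_all add: NN_def E_def c_def)
  have right: "NN (m + j) = N' j" "E (m + j) = G j" "c (m + j) = - lam j" for j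
    by (simp_all add: NN_def E_def c_def)
  have E: "holo_map_on n ?B (NN i) (E i) \<and> algebraic_map_on n ?B (NN i) (E i) \<and> nonconst_map_on ?B (NN i) (E i)"
    if "i < m + v" for i
    using F G that by (cases "i < m") (auto simp: NN_def E_def)
  interpret kernel_relation n "m + v" h rho r NN E c
  proof
    show "h \<in> mpolys (2 * n)" using h_vars by (simp add: mpolys_def)
    show "Re (peval2 n h z (cconj z)) powr r = (\<Prod>i<m + v. (1 + sqnorm (NN i) (E i) z) powr c i)"
      if "z \<in> ?B" for z
      using eq that by (simp add: split_prod left right)
    show "\<forall>i<m + v. q i = 0" if q: "\<forall>i<m + v. q i \<ge> 0" and sum: "(\<Sum>i<m + v. of_rat (q i) * c i) = 0"
      for q :: "nat \<Rightarrow> rat"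
    proof -
      \<comment> \<open>The terms with \<open>lam\<close>, moved to the other side, show that
        \<open>s\<close> lies in both spans, hence is 0. As all \<open>mu l\<close> and
        \<open>lam j\<close> are positive, every coefficient vanishes.\<close>
      define s where "s = (\<Sum>l<m. of_rat (q l) * mu l)"
      have s_lam: "s = (\<Sum>j<v. of_rat (q (m + j)) * lam j)"
        using sum by (simp add: s_def split_sum left right sum_negf)
      have "s \<in> qspan m mu" using q unfolding qspan_def s_def by auto
      moreover have "s \<in> qspan v lam" using q unfolding qspan_def s_lam by (auto intro!: exI[of _ "\<lambda>j. q (m + j)"])
      ultimately have s0: "s = 0" using span by blast
      have zl: "\<forall>l\<in>{..<m}. of_rat (q l) * mu l = 0"
        using s0 q mu unfolding s_def by (subst (asm) sum_nonneg_eq_0_iff) (auto simp: less_imp_le)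
      have zj: "\<forall>j\<in>{..<v}. of_rat (q (m + j)) * lam j = 0"
        using s0 q lam unfolding s_lam by (subst (asm) sum_nonneg_eq_0_iff) (auto simp: less_imp_le)
      have ql: "q l = 0" if "l < m" for l using zl mu that by force
      have qj: "q (m + j) = 0" if "j < v" for j using zj lam that by force
      show ?thesis
      proof (intro allI impI)
        fix i assume "i < m + v"
        then show "q i = 0" using ql[of i] qj[of "i - m"] by (cases "i < m") auto
      qed
    qed
  qed (use h_irr h_pos rho E in \<open>auto simp: holo_map_on_def algebraic_map_on_def\<close>)
  obtain k A where poly: "\<And>i. i < m + v \<Longrightarrow> polynomial_map_on n ?B (NN i) (E i)"
    and k: "\<And>i. i < m + v \<Longrightarrow> k i \<ge> (1::nat) \<and> A i > 0 \<and>
      (\<forall>z\<in>?B. \<forall>\<xi>\<in>?B. 1 + hdot (NN i) (E i) z \<xi> = complex_of_real (A i) * peval2 n h z \<xi> ^ k i)"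
    and r_eq: "r = (\<Sum>i<m + v. c i * real (k i))"
    using polynomial_relation by blast
  have poly_F: "\<forall>l<m. polynomial_map_on n ?B (N l) (F l)"
  proof (intro allI impI)
    fix l assume "l < m"
    then show "polynomial_map_on n ?B (N l) (F l)" using poly[of l] left[of l] by simp
  qed
  have poly_G: "\<forall>j<v. polynomial_map_on n ?B (N' j) (G j)"
    using poly[of "m + _"] right by simp
  have main_F: "\<forall>l<m. k l \<ge> 1 \<and> A l > 0 \<and> (\<forall>z\<in>?B. \<forall>\<xi>\<in>?B.
      1 + hdot (N l) (F l) z \<xi> = complex_of_real (A l) * peval2 n h z \<xi> ^ k l)"
  proof (intro allI impI)
    fix l assume "l < m"
    then show "k l \<ge> 1 \<and> A l > 0 \<and> (\<forall>z\<in>?B. \<forall>\<xi>\<in>?B.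
      1 + hdot (N l) (F l) z \<xi> = complex_of_real (A l) * peval2 n h z \<xi> ^ k l)"
      using k[of l] left[of l] by simp
  qed
  have main_G: "\<forall>j<v. k (m + j) \<ge> 1 \<and> A (m + j) > 0 \<and> (\<forall>z\<in>?B. \<forall>\<xi>\<in>?B.
      1 + hdot (N' j) (G j) z \<xi> = complex_of_real (A (m + j)) * peval2 n h z \<xi> ^ k (m + j))"
    using k[of "m + _"] right by simp
  have r_split: "r = (\<Sum>l<m. real (k l) * mu l) - (\<Sum>j<v. lam j * real (k (m + j)))"
    unfolding r_eq by (simp add: split_sum left right sum_negf mult.commute)
  show ?thesis
    by (intro conjI poly_F poly_G, rule exI[of _ k], rule exI[of _ "\<lambda>j. k (m + j)"],
        rule exI[of _ A], rule exI[of _ "\<lambda>j. A (m + j)"], intro conjI main_F main_G r_split)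
qed

end
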